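(* Let $Z$ be a locally compact Hausdorff space, and let $(X_z)_{z\in Z}$ be a continuous field of Banach spaces over $Z$. Let $X$ be the Banach space of continuous sections of $(X_z)_{z\in Z}$ vanishing at infinity. Let $\alpha$ be an isometric automorphism of $X$ which arises from isometric automorphisms $\alpha_z$ of $X_z$ for $z\in Z$, i.e. $\alpha(x)(z)=\alpha_z(x(z))$ for all $x\in X$ and $z\in Z$. Then $\mathrm{hc}(\alpha)=0$ if and only if $\mathrm{hc}(\alpha_z)=0$ for all $z\in Z$.
   Context: All Banach spaces are over $\mathbb{C}$. Continuous fields of Banach spaces are in the usual (Dixmier) sense; $X$ carries the supremum norm. CA entropy: For a bounded linear map $\gamma:X\to Y$ of Banach spaces, a finite set $\Omega\subseteq X$ and $\delta>0$, let $\mathrm{CA}(\gamma,\Omega,\delta)$ be the collection of triples $(\phi,\psi,d)$ where $d$ is a positive integer and $\phi:X\to\ell_\infty^d$, $\psi:\ell_\infty^d\to Y$ are contractive (norm $\le1$) linear maps with $\|\psi\circ\phi(x)-\gamma(x)\|<\delta$ for all $x\in\Omega$. A CA embedding of $X$ is an isometric linear map $\iota$ from $X$ into a Banach space $Y$ such that $\mathrm{CA}(\iota,\Omega,\delta)\neq\emptyset$ for all finite $\Omega\subseteq X$ and $\delta>0$; every Banach space has one (e.g. the evaluation map $X\to C(B_1(X^* ))$, where $B_1(X^* )$ is the weak$^*$ compact unit ball of the dual). Set $\mathrm{rc}(\Omega,\delta)=\inf\{d:(\phi,\psi,d)\in\mathrm{CA}(\iota,\Omega,\delta)\}$, which does not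 depend on the CA embedding $\iota$. For an isometric (surjective linear) automorphism $\alpha$ of $X$ put $\mathrm{hc}(\alpha,\Omega,\delta)=\limsup_{n\to\infty}\frac1n\log\mathrm{rc}(\Omega\cup\alpha\Omega\cup\cdots\cup\alpha^{n-1}\Omega,\delta)$, $\mathrm{hc}(\alpha,\Omega)=\sup_{\delta>0}\mathrm{hc}(\alpha,\Omega,\delta)$, and $\mathrm{hc}(\alpha)=\sup_\Omega\mathrm{hc}(\alpha,\Omega)$ over finite $\Omega\subseteq X$. *)

theory Defs
  imports "HOL-Analysis.Analysis" "HOL-Library.Function_Algebras"
begin

section \<open>Complex Banach spaces\<close>

class complex_vector = ab_group_add +
  fixes scaleC :: "complex \<Rightarrow> 'a \<Rightarrow> 'a"  (infixr "*\<^sub>C" 75)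
  assumes scaleC_add_right: "c *\<^sub>C (x + y) = c *\<^sub>C x + c *\<^sub>C y"
    and scaleC_add_left: "(c + d) *\<^sub>C x = c *\<^sub>C x + d *\<^sub>C x"
    and scaleC_scaleC: "c *\<^sub>C d *\<^sub>C x = (c * d) *\<^sub>C x"
    and scaleC_one: "1 *\<^sub>C x = x"

interpretation complex_vector:
  vector_space "scaleC :: complex \<Rightarrow> 'a \<Rightarrow> 'a::complex_vector"
  by unfold_locales (rule scaleC_add_right scaleC_add_left scaleC_scaleC scaleC_one)+

instantiation complex :: complex_vector
begin
definition scaleC_complex :: "complex \<Rightarrow> complex \<Rightarrow> complex"
  where "scaleC_complex c x = c * x"
instance
  by standard (simp_all add: scaleC_complex_def algebra_simps)
end

instantiation "fun" :: (type, complex_vector) complex_vector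
begin
definition scaleC_fun :: "complex \<Rightarrow> ('a \<Rightarrow> 'b) \<Rightarrow> 'a \<Rightarrow> 'b"
  where "scaleC_fun c f = (\<lambda>x. c *\<^sub>C f x)"
instance
  by standard
    (simp_all add: scaleC_fun_def fun_eq_iff scaleC_add_right scaleC_add_left
      scaleC_scaleC scaleC_one)
end

text \<open>
  A normed space is a linear subspace of an ambient complex vector space (a type) together with
  a norm on that subspace; the ambient space carries no topology, and the values of the norm
  function off the carrier are irrelevant. In this way a family of unrelated Banach spaces
  can be indexed by the points of a space: any such family lives inside its algebraic direct sum,
  and each member has its own carrier and its own norm.
\<close>

record 'a nspace =
  carrier :: "'a set"
  nrm :: "'a \<Rightarrow> real"

definition complex_banach :: "'a::complex_vector nspace \<Rightarrow> bool" where
  "complex_banach E \<longleftrightarrow>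
     complex_vector.subspace (carrier E) \<and>
     (\<forall>x\<in>carrier E. nrm E x \<ge> 0 \<and> (nrm E x = 0 \<longrightarrow> x = 0)) \<and>
     (\<forall>x\<in>carrier E. \<forall>c. nrm E (c *\<^sub>C x) = cmod c * nrm E x) \<and>
     (\<forall>x\<in>carrier E. \<forall>y\<in>carrier E. nrm E (x + y) \<le> nrm E x + nrm E y) \<and>
     (\<forall>s. (\<forall>n::nat. s n \<in> carrier E) \<longrightarrow>
          (\<forall>e>0. \<exists>N. \<forall>m\<ge>N. \<forall>n\<ge>N. nrm E (s m - s n) < e) \<longrightarrow>
          (\<exists>l\<in>carrier E. (\<lambda>n. nrm E (s n - l)) \<longlonglongrightarrow> 0))"

definition linear_between ::
    "'a::complex_vector set \<Rightarrow> 'b::complex_vector set \<Rightarrow> ('a \<Rightarrow> 'b) \<Rightarrow> bool" where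
  "linear_between S T f \<longleftrightarrow>
     (\<forall>x\<in>S. f x \<in> T) \<and>
     (\<forall>x\<in>S. \<forall>y\<in>S. f (x + y) = f x + f y) \<and>
     (\<forall>c. \<forall>x\<in>S. f (c *\<^sub>C x) = c *\<^sub>C f x)"

definition contraction ::
    "'a::complex_vector nspace \<Rightarrow> 'b::complex_vector nspace \<Rightarrow> ('a \<Rightarrow> 'b) \<Rightarrow> bool" where
  "contraction E F f \<longleftrightarrow>
     linear_between (carrier E) (carrier F) f \<and> (\<forall>x\<in>carrier E. nrm F (f x) \<le> nrm E x)"

definition isometric_automorphism :: "'a::complex_vector nspace \<Rightarrow> ('a \<Rightarrow> 'a) \<Rightarrow> bool" where
  "isometric_automorphism E f \<longleftrightarrow>
     linear_between (carrier E) (carrier E) f \<and> f ` carrier E = carrier E \<and>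
     (\<forall>x\<in>carrier E. nrm E (f x) = nrm E x)"

text \<open>Supremum of a nonnegative function over a possibly empty index set (then \<open>0\<close>).\<close>

definition sup_over :: "'i set \<Rightarrow> ('i \<Rightarrow> real) \<Rightarrow> real" where
  "sup_over I g = Sup (insert 0 (g ` I))"

text \<open>\<open>\<ell>\<^sub>\<infinity>\<^sup>d\<close>, realised as the sequences supported on \<open>{..<d}\<close>.\<close>

definition linf :: "nat \<Rightarrow> (nat \<Rightarrow> complex) nspace" where
  "linf d = \<lparr>carrier = {v. \<forall>i\<ge>d. v i = 0},
             nrm = (\<lambda>v. sup_over {..<d} (\<lambda>i. cmod (v i)))\<rparr>"

text \<open>\<open>C(K)\<close> for a compact set \<open>K\<close>; functions are extended by \<open>0\<close> off \<open>K\<close>.\<close>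

definition C_space :: "'k::topological_space set \<Rightarrow> ('k \<Rightarrow> complex) nspace" where
  "C_space K = \<lparr>carrier = {g. continuous_on K g \<and> (\<forall>k. k \<notin> K \<longrightarrow> g k = 0)},
                nrm = (\<lambda>g. sup_over K (\<lambda>k. cmod (g k)))\<rparr>"

text \<open>
  The closed unit ball of the dual. Functionals are extended by \<open>0\<close> off the carrier, so the topology
  induced on this set by the product topology of the function type is that of
  pointwise convergence on the carrier, i.e. the weak* topology.
\<close>

definition dual_ball :: "'a::complex_vector nspace \<Rightarrow> ('a \<Rightarrow> complex) set" where
  "dual_ball E = {f. linear_between (carrier E) UNIV f \<and>
                     (\<forall>x\<in>carrier E. cmod (f x) \<le> nrm E x) \<and>
                     (\<forall>x. x \<notin> carrier E \<longrightarrow> f x = 0)}"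

definition eval_map :: "'a::complex_vector nspace \<Rightarrow> 'a \<Rightarrow> ('a \<Rightarrow> complex) \<Rightarrow> complex" where
  "eval_map E x = (\<lambda>f. if f \<in> dual_ball E then f x else 0)"


section \<open>CA entropy\<close>

definition CA :: "'a::complex_vector nspace \<Rightarrow> 'b::complex_vector nspace \<Rightarrow> ('a \<Rightarrow> 'b) \<Rightarrow>
    'a set \<Rightarrow> real \<Rightarrow> (('a \<Rightarrow> nat \<Rightarrow> complex) \<times> ((nat \<Rightarrow> complex) \<Rightarrow> 'b) \<times> nat) set" where
  "CA E F \<gamma> \<Omega> \<delta> = {(\<phi>, \<psi>, d). d > 0 \<and> contraction E (linf d) \<phi> \<and> contraction (linf d) F \<psi> \<and>
     (\<forall>x\<in>\<Omega>. nrm F (\<psi> (\<phi> x) - \<gamma> x) < \<delta>)}"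

text \<open>
  The contractive rank may be computed in any CA embedding, i.e. any isometric linear map \<open>\<iota>\<close> with all
  \<open>CA(\<iota>, \<Omega>, \<delta>)\<close> nonempty, and does not depend on the choice. We fix the CA embedding given by
  evaluation into the continuous functions on the weak* compact dual unit ball.
\<close>

definition rc :: "'a::complex_vector nspace \<Rightarrow> 'a set \<Rightarrow> real \<Rightarrow> nat" where
  "rc E \<Omega> \<delta> = Inf {d. \<exists>\<phi> \<psi>. (\<phi>, \<psi>, d) \<in> CA E (C_space (dual_ball E)) (eval_map E) \<Omega> \<delta>}"

definition hc_at :: "'a::complex_vector nspace \<Rightarrow> ('a \<Rightarrow> 'a) \<Rightarrow> 'a set \<Rightarrow> real \<Rightarrow> ereal" where
  "hc_at E \<alpha> \<Omega> \<delta> =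
     limsup (\<lambda>n. ereal (1 / real n * ln (real (rc E (\<Union>i<n. (\<alpha> ^^ i) ` \<Omega>) \<delta>))))"

definition hc_on :: "'a::complex_vector nspace \<Rightarrow> ('a \<Rightarrow> 'a) \<Rightarrow> 'a set \<Rightarrow> ereal" where
  "hc_on E \<alpha> \<Omega> = (SUP \<delta>\<in>{0<..}. hc_at E \<alpha> \<Omega> \<delta>)"

definition hc :: "'a::complex_vector nspace \<Rightarrow> ('a \<Rightarrow> 'a) \<Rightarrow> ereal" where
  "hc E \<alpha> = (SUP \<Omega>\<in>{\<Omega>. finite \<Omega> \<and> \<Omega> \<subseteq> carrier E}. hc_on E \<alpha> \<Omega>)"


section \<open>Continuous fields of Banach spaces\<close>

text \<open>The product of the fibres; vector fields are extended by \<open>0\<close> off the base space.\<close>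

definition vector_fields ::
    "'z topology \<Rightarrow> ('z \<Rightarrow> 'b::complex_vector nspace) \<Rightarrow> ('z \<Rightarrow> 'b) set" where
  "vector_fields Z E =
     {x. (\<forall>z\<in>topspace Z. x z \<in> carrier (E z)) \<and> (\<forall>z. z \<notin> topspace Z \<longrightarrow> x z = 0)}"

text \<open>
  Dixmier's axioms: \<open>\<Gamma>\<close> (the continuous sections) is a linear subspace of the product, has dense
  range in every fibre, consists of fields with continuous norm, and is closed under local
  uniform approximation.
\<close>

definition continuous_field ::
    "'z topology \<Rightarrow> ('z \<Rightarrow> 'b::complex_vector nspace) \<Rightarrow> ('z \<Rightarrow> 'b) set \<Rightarrow> bool" where
  "continuous_field Z E \<Gamma> \<longleftrightarrow>
     (\<forall>z\<in>topspace Z. complex_banach (E z)) \<and>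
     \<Gamma> \<subseteq> vector_fields Z E \<and> complex_vector.subspace \<Gamma> \<and>
     (\<forall>z\<in>topspace Z. \<forall>v\<in>carrier (E z). \<forall>e>0. \<exists>x\<in>\<Gamma>. nrm (E z) (x z - v) < e) \<and>
     (\<forall>x\<in>\<Gamma>. continuous_map Z euclideanreal (\<lambda>z. nrm (E z) (x z))) \<and>
     (\<forall>x\<in>vector_fields Z E.
        (\<forall>z\<in>topspace Z. \<forall>e>0. \<exists>y\<in>\<Gamma>. \<exists>U. openin Z U \<and> z \<in> U \<and>
            (\<forall>w\<in>U. nrm (E w) (x w - y w) \<le> e)) \<longrightarrow> x \<in> \<Gamma>)"

definition C0_sections :: "'z topology \<Rightarrow> ('z \<Rightarrow> 'b::complex_vector nspace) \<Rightarrow>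
    ('z \<Rightarrow> 'b) set \<Rightarrow> ('z \<Rightarrow> 'b) nspace" where
  "C0_sections Z E \<Gamma> =
     \<lparr>carrier = {x\<in>\<Gamma>. \<forall>e>0. \<exists>K. compactin Z K \<and> (\<forall>z\<in>topspace Z - K. nrm (E z) (x z) < e)},
      nrm = (\<lambda>x. sup_over (topspace Z) (\<lambda>z. nrm (E z) (x z)))\<rparr>"

end

theory Submission
  imports Defs
begin

text \<open>
  The proof passes through the values of functionals along orbits. For an isometric automorphism \<open>\<alpha>\<close>
  of \<open>E\<close> and a vector \<open>x\<close>, the functionals \<open>\<sigma>\<close> of norm at most one give a set of sequences
  \<open>(\<sigma>(\<alpha>\<^sup>i x))\<^sub>i\<close>, and CA entropy vanishes exactly if for every \<open>x\<close> the initial segments of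
  length \<open>n\<close> of these sequences can be covered by subexponentially many balls in the supremum norm.

  If the sequences are covered by few balls, even if only those of a norming set of functionals are, then
  the centres are the coordinates of a map to \<open>\<ell>\<^sub>\<infinity>\<^sup>d\<close> that almost preserves norms on the span of the
  orbit segment, and Helly's criterion together with a partition of unity on the dual ball turns
  it into an approximate factorisation (\<open>hc_eq_0_of_norming\<close>). Conversely, a factorisation
  through \<open>\<ell>\<^sub>\<infinity>\<^sup>d\<close> only places the sequences near the absolutely convex hull of \<open>d\<close> points. Such a
  hull can be covered in the mean square norm by sampling a number of points that does not depend
  on \<open>n\<close>, and the few coordinates at which a mean square approximation is bad can be listed
  explicitly at a negligible exponential cost (\<open>zero_entropy_of_small_hulls\<close>).

  With this characterisation the fibres inherit zero entropy from the section space, because their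
  dual balls embed in its dual ball by evaluation. In the other direction the evaluations form a norming set.
  Covering numbers of shift invariant sets are submultiplicative in \<open>n\<close>, since blocks can be
  concatenated. So a good scale \<open>n\<close> in the fibre at a point controls all lengths; it persists
  in a neighbourhood by continuity of the norms, and since \<open>\<alpha>\<close> fixes the base space, functionals never leave
  the neighbourhood. Finitely many neighbourhoods cover a compact set off which the section is
  small. This replaces the variational principle for the bundle of dual balls over the base.
\<close>

section \<open>Sublinear functionals and Helly's criterion\<close>

definition sublinear_on :: "'a::complex_vector set \<Rightarrow> ('a \<Rightarrow> real) \<Rightarrow> bool" where
  "sublinear_on V p \<longleftrightarrow>
     (\<forall>x\<in>V. \<forall>y\<in>V. p (x + y) \<le> p x + p y) \<and>
     (\<forall>t>0. \<forall>x\<in>V. p (complex_of_real t *\<^sub>C x) = t * p x)"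

lemma sublinear_on_scale:
  "sublinear_on V p \<Longrightarrow> 0 < t \<Longrightarrow> x \<in> V \<Longrightarrow> p (complex_of_real t *\<^sub>C x) = t * p x"
  by (simp add: sublinear_on_def)

lemma sublinear_on_zero:
  assumes "complex_vector.subspace V" "sublinear_on V p"
  shows "p 0 = 0"
proof -
  have "0 \<in> V" using assms(1) by (rule complex_vector.subspace_0)
  then have "p (complex_of_real 2 *\<^sub>C 0) = 2 * p 0"
    by (intro sublinear_on_scale[OF assms(2)]) simp
  then show ?thesis by (simp del: of_real_numeral)
qed

lemma sublinear_on_minus:
  assumes "complex_vector.subspace V" "sublinear_on V p" "x \<in> V"
  shows "- p (- x) \<le> p x"
proof -
  have "p (x + - x) \<le> p x + p (- x)"
    using assms complex_vector.subspace_neg[OF assms(1,3)] unfolding sublinear_on_def by blast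
  then show ?thesis using sublinear_on_zero[OF assms(1,2)] by simp
qed

text \<open>
  Both steps of the Hahn--Banach argument lower a sublinear functional by an infimal convolution with
  a convex cone \<open>R\<close> of pairs (price, shift): moving the argument by \<open>u\<close> costs \<open>r\<close>. The condition
  \<open>0 \<le> q u + r\<close> says that no shift is cheaper than the gain it can bring, which keeps the infimum finite.
\<close>

lemma sublinear_infimal_shift:
  fixes V :: "'a::complex_vector set" and R :: "(real \<times> 'a) set"
  assumes V: "complex_vector.subspace V" and q: "sublinear_on V q"
    and R: "snd ` R \<subseteq> V" "(0, 0) \<in> R"
    and R_add: "\<And>r u s v. (r, u) \<in> R \<Longrightarrow> (s, v) \<in> R \<Longrightarrow> (r + s, u + v) \<in> R"
    and R_scale: "\<And>t r u. t > 0 \<Longrightarrow> (r, u) \<in> R \<Longrightarrow> (t * r, complex_of_real t *\<^sub>C u) \<in> R"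
    and R_pos: "\<And>r u. (r, u) \<in> R \<Longrightarrow> 0 \<le> q u + r"
  obtains g where "sublinear_on V g" "\<And>y. y \<in> V \<Longrightarrow> g y \<le> q y"
    "\<And>y r u. y \<in> V \<Longrightarrow> (r, u) \<in> R \<Longrightarrow> g y \<le> q (y + u) + r"
proof -
  define g where "g y = (INF w\<in>R. q (y + snd w) + fst w)" for y
  have low: "- q (- y) \<le> q (y + u) + r" if "y \<in> V" "(r, u) \<in> R" for y r u
  proof -
    have uV: "u \<in> V" using R(1) that(2) by force
    have "q ((y + u) + - y) \<le> q (y + u) + q (- y)"
      using q that(1) uV V unfolding sublinear_on_def
      by (meson complex_vector.subspace_add complex_vector.subspace_neg)
    then show ?thesis using R_pos[OF that(2)] by simp
  qed
  have bdd: "bdd_below ((\<lambda>w. q (y + snd w) + fst w) ` R)" if "y \<in> V" for y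
    by (rule bdd_belowI2[where m = "- q (- y)"]) (use low[OF that] in auto)
  have upper: "g y \<le> q (y + u) + r" if "y \<in> V" "(r, u) \<in> R" for y r u
    unfolding g_def using cINF_lower[OF bdd[OF that(1)] that(2)] by simp
  have greatest: "c \<le> g y" if "\<And>r u. (r, u) \<in> R \<Longrightarrow> c \<le> q (y + u) + r" for c y
    unfolding g_def by (rule cINF_greatest) (use R(2) that in auto)
  have add: "g (x + y) \<le> g x + g y" if x: "x \<in> V" and y: "y \<in> V" for x y
  proof -
    have "g (x + y) - (q (y + v) + s) \<le> g x" if sv: "(s, v) \<in> R" for s v
    proof (rule greatest)
      fix r u assume ru: "(r, u) \<in> R"
      have uv: "u \<in> V" "v \<in> V" using R(1) ru sv by force+
      have "g (x + y) \<le> q ((x + y) + (u + v)) + (r + s)"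
        by (rule upper) (use x y V R_add[OF ru sv] complex_vector.subspace_add in blast)+
      also have "(x + y) + (u + v) = (x + u) + (y + v)" by simp
      also have "q \<dots> \<le> q (x + u) + q (y + v)"
        using q x y uv V unfolding sublinear_on_def by (meson complex_vector.subspace_add)
      finally show "g (x + y) - (q (y + v) + s) \<le> q (x + u) + r" by simp
    qed
    then have "g (x + y) - g x \<le> g y" by (intro greatest) (simp add: algebra_simps)
    then show ?thesis by simp
  qed
  have scale_le: "g (complex_of_real t *\<^sub>C x) \<le> t * g x" if t: "t > 0" and x: "x \<in> V" for t x
  proof -
    have "g (complex_of_real t *\<^sub>C x) / t \<le> g x"
    proof (rule greatest)
      fix r u assume ru: "(r, u) \<in> R"
      have u: "u \<in> V" using R(1) ru by force
      have "g (complex_of_real t *\<^sub>C x)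
          \<le> q (complex_of_real t *\<^sub>C x + complex_of_real t *\<^sub>C u) + t * r"
        by (rule upper) (use x V R_scale[OF t ru] complex_vector.subspace_scale in blast)+
      also have "complex_of_real t *\<^sub>C x + complex_of_real t *\<^sub>C u = complex_of_real t *\<^sub>C (x + u)"
        by (simp add: scaleC_add_right)
      also have "q \<dots> = t * q (x + u)"
        using q t x u V unfolding sublinear_on_def by (meson complex_vector.subspace_add)
      finally show "g (complex_of_real t *\<^sub>C x) / t \<le> q (x + u) + r"
        using t by (simp add: field_simps)
    qed
    then show ?thesis using t by (simp add: field_simps)
  qed
  have scale: "g (complex_of_real t *\<^sub>C x) = t * g x" if t: "t > 0" and x: "x \<in> V" for t x
  proof (rule antisym[OF scale_le[OF t x]])
    have "g (complex_of_real (1/t) *\<^sub>C (complex_of_real t *\<^sub>C x))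
        \<le> (1/t) * g (complex_of_real t *\<^sub>C x)"
      by (rule scale_le) (use t x V complex_vector.subspace_scale in auto)
    then show "t * g x \<le> g (complex_of_real t *\<^sub>C x)"
      using t by (simp add: scaleC_scaleC scaleC_one field_simps flip: of_real_mult)
  qed
  show ?thesis
  proof (rule that)
    show "sublinear_on V g" unfolding sublinear_on_def using add scale by blast
    show "g y \<le> q y" if "y \<in> V" for y using upper[OF that R(2)] by simp
  qed (fact upper)
qed

text \<open>
  Zorn's lemma for sublinear functionals under the pointwise order. A chain is bounded below at \<open>x\<close> by
  \<open>- p (- x)\<close>, and its pointwise infimum is subadditive because two members of a chain have a smaller one.
\<close>

lemma minimal_sublinear_exists:
  fixes V :: "'a::complex_vector set"
  assumes V: "complex_vector.subspace V" and p: "sublinear_on V p"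
  obtains q where "sublinear_on V q" "\<And>x. x \<in> V \<Longrightarrow> q x \<le> p x"
    "\<And>g x. sublinear_on V g \<Longrightarrow> (\<And>y. y \<in> V \<Longrightarrow> g y \<le> q y) \<Longrightarrow> x \<in> V \<Longrightarrow> g x = q x"
proof -
  define Q where "Q = {q. sublinear_on V q \<and> (\<forall>x\<in>V. q x \<le> p x) \<and> (\<forall>x. x \<notin> V \<longrightarrow> q x = 0)}"
  define r where "r = {(q, q'). q \<in> Q \<and> q' \<in> Q \<and> q' \<le> q}"
  \<comment> \<open>Functionals are normalised to vanish off V, so that pointwise comparison on V is antisymmetric.\<close>
  define cut where "cut g = (\<lambda>x. if x \<in> V then g x else (0::real))" for g :: "'a \<Rightarrow> real"
  have cut: "sublinear_on V (cut g) \<longleftrightarrow> sublinear_on V g" for g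
    using V unfolding sublinear_on_def cut_def
    by (simp add: complex_vector.subspace_add complex_vector.subspace_scale)
  have fld: "Field r = Q" unfolding r_def Field_def by auto
  have po: "Partial_order r"
    unfolding partial_order_on_def preorder_on_def fld
    by (auto simp: r_def refl_on_def trans_def antisym_def)
  have "\<exists>m\<in>Field r. \<forall>a\<in>Field r. (m, a) \<in> r \<longrightarrow> a = m"
  proof (rule Zorns_po_lemma[OF po])
    fix C assume C: "C \<in> Chains r"
    show "\<exists>u\<in>Field r. \<forall>a\<in>C. (a, u) \<in> r"
    proof (cases "C = {}")
      case True
      have "cut p \<in> Q" using p cut by (auto simp: Q_def cut_def)
      then show ?thesis using True fld by auto
    next
      case False
      have CQ: "C \<subseteq> Q" using C unfolding Chains_def r_def by auto
      have tot: "a \<le> b \<or> b \<le> a" if "a \<in> C" "b \<in> C" for a b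
        using C that unfolding Chains_def r_def by auto
      define u where "u x = (INF q\<in>C. q x)" for x
      have low: "- p (- x) \<le> q x" if "q \<in> C" "x \<in> V" for q x
      proof -
        have "q \<in> Q" using that CQ by auto
        then have "- q (- x) \<le> q x" "q (- x) \<le> p (- x)"
          using sublinear_on_minus[OF V _ that(2)] complex_vector.subspace_neg[OF V that(2)]
          by (auto simp: Q_def)
        then show ?thesis by simp
      qed
      have bdd: "bdd_below ((\<lambda>q. q x) ` C)" if "x \<in> V" for x
        by (rule bdd_belowI2[where m = "- p (- x)"]) (use low that in auto)
      have le: "u x \<le> q x" if "x \<in> V" "q \<in> C" for x q
        unfolding u_def by (rule cINF_lower[OF bdd[OF that(1)] that(2)])
      have great: "c \<le> u x" if "\<And>q. q \<in> C \<Longrightarrow> c \<le> q x" for c x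
        unfolding u_def by (rule cINF_greatest[OF False that])
      have add: "u (x + y) \<le> u x + u y" if x: "x \<in> V" and y: "y \<in> V" for x y
      proof -
        have xy: "x + y \<in> V" using V x y by (rule complex_vector.subspace_add)
        have "u (x + y) - b y \<le> u x" if b: "b \<in> C" for b
        proof (rule great)
          fix a assume a: "a \<in> C"
          have "\<exists>c\<in>C. c x \<le> a x \<and> c y \<le> b y"
            using tot[OF a b] a b unfolding le_fun_def by blast
          then obtain c where c: "c \<in> C" "c x \<le> a x" "c y \<le> b y" by blast
          have "u (x + y) \<le> c (x + y)" by (rule le[OF xy c(1)])
          also have "\<dots> \<le> c x + c y"
            using c(1) CQ x y unfolding Q_def sublinear_on_def by blast
          finally show "u (x + y) - b y \<le> a x" using c by simp
        qed
        then have "u (x + y) - u x \<le> u y" by (intro great) (simp add: algebra_simps)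
        then show ?thesis by simp
      qed
      have hom: "u (complex_of_real t *\<^sub>C x) = t * u x" if t: "t > 0" and x: "x \<in> V" for t x
      proof (rule antisym)
        have tx: "complex_of_real t *\<^sub>C x \<in> V" using V x by (rule complex_vector.subspace_scale)
        have ht: "q (complex_of_real t *\<^sub>C x) = t * q x" if "q \<in> C" for q
          using that CQ t x unfolding Q_def sublinear_on_def by blast
        have "u (complex_of_real t *\<^sub>C x) / t \<le> u x"
        proof (rule great)
          fix q assume "q \<in> C"
          then show "u (complex_of_real t *\<^sub>C x) / t \<le> q x"
            using le[OF tx, of q] ht[of q] t by (simp add: field_simps)
        qed
        then show "u (complex_of_real t *\<^sub>C x) \<le> t * u x" using t by (simp add: field_simps)
        show "t * u x \<le> u (complex_of_real t *\<^sub>C x)"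
          by (rule great) (use le[OF x] t in \<open>simp add: ht\<close>)
      qed
      have subl: "sublinear_on V u" unfolding sublinear_on_def using add hom by blast
      obtain q0 where q0: "q0 \<in> C" using False by auto
      have up: "\<forall>x\<in>V. u x \<le> p x"
      proof
        fix x assume "x \<in> V"
        then show "u x \<le> p x" using le[of x q0] q0 CQ unfolding Q_def by force
      qed
      have cu: "cut u \<in> Q" using subl up cut by (auto simp: Q_def cut_def)
      have "(a, cut u) \<in> r" if "a \<in> C" for a
        unfolding r_def using that CQ cu le by (auto simp: cut_def le_fun_def Q_def)
      then show ?thesis using cu fld by blast
    qed
  qed
  then obtain m where m: "m \<in> Q" and min: "\<And>a. a \<in> Q \<Longrightarrow> a \<le> m \<Longrightarrow> a = m"
    unfolding fld by (auto simp: r_def)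
  show ?thesis
  proof (rule that)
    show "sublinear_on V m" "\<And>x. x \<in> V \<Longrightarrow> m x \<le> p x" using m by (auto simp: Q_def)
    fix g x assume g: "sublinear_on V g" "\<And>y. y \<in> V \<Longrightarrow> g y \<le> m y" and x: "x \<in> V"
    have "cut g \<in> Q" using g cut m by (force simp: Q_def cut_def)
    moreover have "cut g \<le> m" using g(2) m by (auto simp: Q_def cut_def le_fun_def)
    ultimately have "cut g = m" by (rule min)
    then show "g x = m x" using x by (auto simp: cut_def)
  qed
qed

text \<open>
  A minimal sublinear functional \<open>q\<close> is linear: the cone \<open>{(- t q(x), t x) | t \<ge> 0}\<close> lowers \<open>q\<close> to a
  functional that minimality forces to be \<open>q\<close> itself, and the term for \<open>t = 1\<close> then
  reads \<open>q y \<le> q (y + x) - q x\<close>, i.e. \<open>q\<close> is superadditive.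
\<close>

lemma hahn_banach_dominated:
  fixes V :: "'a::complex_vector set"
  assumes V: "complex_vector.subspace V" and p: "sublinear_on V p"
  obtains f where "\<And>x y. x \<in> V \<Longrightarrow> y \<in> V \<Longrightarrow> f (x + y) = f x + f y"
    "\<And>t x. x \<in> V \<Longrightarrow> f (complex_of_real t *\<^sub>C x) = t * f x"
    "\<And>x. x \<in> V \<Longrightarrow> f x \<le> p x"
proof -
  obtain q where q: "sublinear_on V q" "\<And>x. x \<in> V \<Longrightarrow> q x \<le> p x"
    and min: "\<And>g x. sublinear_on V g \<Longrightarrow> (\<And>y. y \<in> V \<Longrightarrow> g y \<le> q y) \<Longrightarrow> x \<in> V \<Longrightarrow> g x = q x"
    using minimal_sublinear_exists[OF V p] by blast
  have q0: "q 0 = 0" by (rule sublinear_on_zero[OF V q(1)])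
  have super: "q x + q y \<le> q (x + y)" if x: "x \<in> V" and y: "y \<in> V" for x y
  proof -
    define R where "R = (\<lambda>t. (- t * q x, complex_of_real t *\<^sub>C x)) ` {0..}"
    have RI: "(- t * q x, complex_of_real t *\<^sub>C x) \<in> R" if "t \<ge> 0" for t
      unfolding R_def using that by auto
    have qt: "q (complex_of_real t *\<^sub>C x) = t * q x" if "t \<ge> 0" for t
      using that q(1) x q0 unfolding sublinear_on_def
      by (cases "t = 0") auto
    obtain g where g: "sublinear_on V g" "\<And>y. y \<in> V \<Longrightarrow> g y \<le> q y"
      "\<And>y r u. y \<in> V \<Longrightarrow> (r, u) \<in> R \<Longrightarrow> g y \<le> q (y + u) + r"
    proof (rule sublinear_infimal_shift[OF V q(1), of R])
      show "snd ` R \<subseteq> V" using V x by (auto simp: R_def intro: complex_vector.subspace_scale)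
      show "(0, 0) \<in> R" using RI[of 0] by simp
      show "(r + s, u + v) \<in> R" if "(r, u) \<in> R" "(s, v) \<in> R" for r u s v
      proof -
        from that obtain a b where "a \<ge> 0" "b \<ge> 0" "r = - a * q x" "s = - b * q x"
          "u = complex_of_real a *\<^sub>C x" "v = complex_of_real b *\<^sub>C x"
          by (auto simp: R_def)
        then show ?thesis using RI[of "a + b"] by (simp add: scaleC_add_left algebra_simps)
      qed
      show "(t * r, complex_of_real t *\<^sub>C u) \<in> R" if "t > 0" "(r, u) \<in> R" for t r u
      proof -
        from that obtain a where "a \<ge> 0" "r = - a * q x" "u = complex_of_real a *\<^sub>C x"
          by (auto simp: R_def)
        then show ?thesis using RI[of "t * a"] that(1) by (simp add: scaleC_scaleC mult.assoc)
      qed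
      show "0 \<le> q u + r" if "(r, u) \<in> R" for r u
        using that qt by (auto simp: R_def)
    qed auto
    have "q y = g y" using min[OF g(1,2) y] by simp
    also have "\<dots> \<le> q (y + x) + - q x" using g(3)[OF y RI[of 1]] by (simp add: scaleC_one)
    finally show ?thesis by (simp add: add.commute)
  qed
  have add: "q (x + y) = q x + q y" if "x \<in> V" "y \<in> V" for x y
    using super[OF that] q(1) that unfolding sublinear_on_def by (simp add: antisym)
  have neg: "q (- x) = - q x" if "x \<in> V" for x
    using add[OF that complex_vector.subspace_neg[OF V that]] q0 by simp
  have "q (complex_of_real t *\<^sub>C x) = t * q x" if x: "x \<in> V" for t x
  proof (cases t "0::real" rule: linorder_cases)
    case less
    have "q (complex_of_real t *\<^sub>C x) = q (- (complex_of_real (- t) *\<^sub>C x))" by simp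
    also have "\<dots> = - q (complex_of_real (- t) *\<^sub>C x)"
      by (rule neg) (use V x in \<open>rule complex_vector.subspace_scale\<close>)
    also have "q (complex_of_real (- t) *\<^sub>C x) = - t * q x"
      by (rule sublinear_on_scale[OF q(1)]) (use less x in auto)
    finally show ?thesis by simp
  next
    case equal
    then show ?thesis using q0 by simp
  next
    case greater
    then show ?thesis using q(1) x unfolding sublinear_on_def by blast
  qed
  then show ?thesis using that add q(2) by blast
qed

definition seminormed :: "'a::complex_vector nspace \<Rightarrow> bool" where
  "seminormed E \<longleftrightarrow>
     complex_vector.subspace (carrier E) \<and>
     (\<forall>x\<in>carrier E. nrm E x \<ge> 0) \<and>
     (\<forall>x\<in>carrier E. \<forall>c. nrm E (c *\<^sub>C x) = cmod c * nrm E x) \<and>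
     (\<forall>x\<in>carrier E. \<forall>y\<in>carrier E. nrm E (x + y) \<le> nrm E x + nrm E y)"

lemma ex_phase: "\<exists>c. cmod c = 1 \<and> c * w = complex_of_real (cmod w)"
proof (cases "w = 0")
  case False
  have "w * cnj w = complex_of_real (cmod w) * complex_of_real (cmod w)"
    by (metis complex_norm_square of_real_mult power2_eq_square)
  then show ?thesis
    using False
    by (intro exI[of _ "cnj w / cmod w"]) (simp add: norm_divide divide_simps mult.commute)
qed (auto intro: exI[of _ 1])

context
  fixes E :: "'a::complex_vector nspace"
  assumes E: "seminormed E"
begin

lemma carrier_subspace: "complex_vector.subspace (carrier E)"
  using E by (simp add: seminormed_def)

lemma nrm_nonneg: "x \<in> carrier E \<Longrightarrow> 0 \<le> nrm E x"
  using E by (simp add: seminormed_def)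

lemma nrm_scale: "x \<in> carrier E \<Longrightarrow> nrm E (c *\<^sub>C x) = cmod c * nrm E x"
  using E by (simp add: seminormed_def)

lemma nrm_triangle: "x \<in> carrier E \<Longrightarrow> y \<in> carrier E \<Longrightarrow> nrm E (x + y) \<le> nrm E x + nrm E y"
  using E by (simp add: seminormed_def)

lemmas carrier_closed =
  complex_vector.subspace_0[OF carrier_subspace]
  complex_vector.subspace_add[OF carrier_subspace]
  complex_vector.subspace_diff[OF carrier_subspace]
  complex_vector.subspace_neg[OF carrier_subspace]
  complex_vector.subspace_scale[OF carrier_subspace]

lemma carrier_sum:
  "(\<And>i. i \<in> I \<Longrightarrow> e i \<in> carrier E) \<Longrightarrow> (\<Sum>i\<in>I. c i *\<^sub>C e i) \<in> carrier E"
  by (rule complex_vector.subspace_sum[OF carrier_subspace]) (rule carrier_closed(5))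

lemma nrm_zero: "nrm E 0 = 0"
  using nrm_scale[OF carrier_closed(1), of 0] by simp

lemma nrm_minus: "x \<in> carrier E \<Longrightarrow> nrm E (- x) = nrm E x"
  using nrm_scale[of x "-1"] by (simp add: scaleC_one)

lemma nrm_sum_le:
  assumes "finite I" "\<And>i. i \<in> I \<Longrightarrow> e i \<in> carrier E"
  shows "nrm E (\<Sum>i\<in>I. c i *\<^sub>C e i) \<le> (\<Sum>i\<in>I. cmod (c i) * nrm E (e i))"
  using assms
proof (induction I rule: finite_induct)
  case empty
  then show ?case by (simp add: nrm_zero)
next
  case (insert j I)
  then have "nrm E (c j *\<^sub>C e j + (\<Sum>i\<in>I. c i *\<^sub>C e i))
      \<le> nrm E (c j *\<^sub>C e j) + nrm E (\<Sum>i\<in>I. c i *\<^sub>C e i)"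
    by (intro nrm_triangle carrier_sum carrier_closed) auto
  then show ?case using insert by (simp add: nrm_scale)
qed

lemma sublinear_nrm: "sublinear_on (carrier E) (nrm E)"
  unfolding sublinear_on_def by (auto simp: nrm_triangle nrm_scale)

text \<open>
  Helly's criterion for approximately prescribing the values of a functional of norm at most one.
  It is the only form in which duality enters below: with \<open>\<delta> = 0\<close> and a single vector it yields norming
  functionals, and with \<open>\<delta> > 0\<close> it moves functionals between a space and \<open>\<ell>\<^sub>\<infinity>\<^sup>d\<close>, or between neighbouring
  fibres, whenever norms of linear combinations compare up to \<open>\<delta> \<Sum>|c\<^sub>i|\<close>.

  The norm is lowered to the sublinear functional
  \<open>inf\<^sub>c (\<parallel>v - \<Sum>c\<^sub>i e\<^sub>i\<parallel> + Re \<Sum>c\<^sub>i s\<^sub>i + \<delta> \<Sum>|c\<^sub>i|)\<close>; a real-linear functional below it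
  is the real part of the functional sought.
\<close>

lemma helly_functional:
  fixes e :: "'i \<Rightarrow> 'a" and s :: "'i \<Rightarrow> complex"
  assumes I: "finite I" and e: "\<And>i. i \<in> I \<Longrightarrow> e i \<in> carrier E" and "0 \<le> \<delta>"
    and dom: "\<And>c. cmod (\<Sum>i\<in>I. c i * s i) \<le> nrm E (\<Sum>i\<in>I. c i *\<^sub>C e i) + \<delta> * (\<Sum>i\<in>I. cmod (c i))"
  obtains \<tau> where "\<tau> \<in> dual_ball E" "\<And>i. i \<in> I \<Longrightarrow> cmod (\<tau> (e i) - s i) \<le> \<delta>"
proof -
  note V = carrier_subspace
  define A where "A c = (\<Sum>i\<in>I. c i *\<^sub>C e i)" for c
  define B where "B c = (\<Sum>i\<in>I. c i * s i)" for c
  define L where "L c = \<delta> * (\<Sum>i\<in>I. cmod (c i))" for c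
  have A: "A c \<in> carrier E" for c unfolding A_def by (rule carrier_sum[OF e])
  define R where "R = {(Re (B c) + r, - A c) | c r. L c \<le> r}"
  have lin: "A (\<lambda>i. c i + d i) = A c + A d" "B (\<lambda>i. c i + d i) = B c + B d"
    "A (\<lambda>i. k * c i) = k *\<^sub>C A c" "B (\<lambda>i. k * c i) = k * B c" for c d k
    unfolding A_def B_def
    by (simp_all add: scaleC_add_left sum.distrib scaleC_scaleC distrib_right sum_distrib_left
        mult.assoc complex_vector.scale_sum_right)
  have Ladd: "L (\<lambda>i. c i + d i) \<le> L c + L d" for c d
  proof -
    have "(\<Sum>i\<in>I. cmod (c i + d i)) \<le> (\<Sum>i\<in>I. cmod (c i) + cmod (d i))"
      by (intro sum_mono norm_triangle_ineq)
    then show ?thesis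
      unfolding L_def using mult_left_mono[OF _ \<open>0 \<le> \<delta>\<close>]
      by (simp add: sum.distrib flip: distrib_left)
  qed
  have Lscale: "L (\<lambda>i. k * c i) = cmod k * L c" for c k
    unfolding L_def by (simp add: norm_mult mult.left_commute flip: sum_distrib_left)
  obtain g where g: "sublinear_on (carrier E) g" "\<And>y. y \<in> carrier E \<Longrightarrow> g y \<le> nrm E y"
      "\<And>y r u. y \<in> carrier E \<Longrightarrow> (r, u) \<in> R \<Longrightarrow> g y \<le> nrm E (y + u) + r"
  proof (rule sublinear_infimal_shift[OF V sublinear_nrm, of R])
    show "snd ` R \<subseteq> carrier E" using A by (auto simp: R_def carrier_closed)
    have "(0, 0) = (Re (B (\<lambda>_. 0)) + 0, - A (\<lambda>_. 0))" "L (\<lambda>_. 0) \<le> 0"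
      by (simp_all add: A_def B_def L_def)
    then show "(0, 0) \<in> R" unfolding R_def by blast
    show "(r + s, u + v) \<in> R" if "(r, u) \<in> R" "(s, v) \<in> R" for r u s v
    proof -
      from that obtain c d r' s' where *: "L c \<le> r'" "L d \<le> s'" "r = Re (B c) + r'"
        "s = Re (B d) + s'" "u = - A c" "v = - A d" by (auto simp: R_def)
      then have "(r + s, u + v) = (Re (B (\<lambda>i. c i + d i)) + (r' + s'), - A (\<lambda>i. c i + d i))"
        "L (\<lambda>i. c i + d i) \<le> r' + s'"
        using Ladd[of c d] by (auto simp: lin)
      then show ?thesis unfolding R_def by blast
    qed
    show "(t * r, complex_of_real t *\<^sub>C u) \<in> R" if "t > 0" "(r, u) \<in> R" for t r u
    proof -
      from that obtain c r' where *: "L c \<le> r'" "r = Re (B c) + r'" "u = - A c"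
        by (auto simp: R_def)
      then have "(t * r, complex_of_real t *\<^sub>C u)
          = (Re (B (\<lambda>i. complex_of_real t * c i)) + t * r', - A (\<lambda>i. complex_of_real t * c i))"
        "L (\<lambda>i. complex_of_real t * c i) \<le> t * r'"
        using that(1) by (auto simp: lin Lscale algebra_simps)
      then show ?thesis unfolding R_def by blast
    qed
    show "0 \<le> nrm E u + r" if ru: "(r, u) \<in> R" for r u
    proof -
      from ru obtain c r' where *: "L c \<le> r'" "r = Re (B c) + r'" "u = - A c"
        by (auto simp: R_def)
      have "- Re (B c) \<le> cmod (B c)" using complex_Re_le_cmod[of "- B c"] by simp
      also have "\<dots> \<le> nrm E (A c) + L c" using dom by (simp add: A_def B_def L_def)
      finally show ?thesis using * nrm_minus[OF A] by simp
    qed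
  qed auto
  obtain f where fadd: "\<And>x y. x \<in> carrier E \<Longrightarrow> y \<in> carrier E \<Longrightarrow> f (x + y) = f x + f y"
    and fscale: "\<And>t x. x \<in> carrier E \<Longrightarrow> f (complex_of_real t *\<^sub>C x) = t * f x"
    and fle: "\<And>x. x \<in> carrier E \<Longrightarrow> f x \<le> g x"
    using hahn_banach_dominated[OF V g(1)] by blast
  define \<tau> where "\<tau> x = (if x \<in> carrier E then Complex (f x) (- f (\<i> *\<^sub>C x)) else 0)" for x
  have Re_\<tau>: "Re (\<tau> x) = f x" if "x \<in> carrier E" for x using that by (simp add: \<tau>_def)
  have add: "\<tau> (x + y) = \<tau> x + \<tau> y" if "x \<in> carrier E" "y \<in> carrier E" for x y
    using that by (auto simp: \<tau>_def carrier_closed scaleC_add_right fadd complex_eq_iff)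
  have scale: "\<tau> (c *\<^sub>C x) = c * \<tau> x" if x: "x \<in> carrier E" for c x
  proof -
    have ix: "\<i> *\<^sub>C x \<in> carrier E" using x by (rule carrier_closed)
    have dec: "f (d *\<^sub>C x) = Re d * f x + Im d * f (\<i> *\<^sub>C x)" for d
    proof -
      have "d = complex_of_real (Re d) + complex_of_real (Im d) * \<i>"
        by (simp add: complex_eq_iff)
      then have "d *\<^sub>C x = complex_of_real (Re d) *\<^sub>C x + complex_of_real (Im d) *\<^sub>C \<i> *\<^sub>C x"
        by (metis scaleC_add_left scaleC_scaleC)
      then show ?thesis
        using x ix by (simp add: fadd fscale carrier_closed del: complex_vector.scale_scale)
    qed
    show ?thesis using x dec[of c] dec[of "\<i> * c"]
      by (simp add: \<tau>_def carrier_closed complex_eq_iff scaleC_scaleC algebra_simps)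
  qed
  have Re_le: "Re (c * \<tau> x) \<le> g (c *\<^sub>C x)" if x: "x \<in> carrier E" for c x
    using fle[of "c *\<^sub>C x"] Re_\<tau>[of "c *\<^sub>C x"] scale[OF x] x by (simp add: carrier_closed)
  have bound: "cmod (\<tau> x) \<le> nrm E x" if x: "x \<in> carrier E" for x
  proof -
    obtain c where c: "cmod c = 1" "c * \<tau> x = complex_of_real (cmod (\<tau> x))" using ex_phase by blast
    have "cmod (\<tau> x) = Re (c * \<tau> x)" using c by simp
    also have "\<dots> \<le> g (c *\<^sub>C x)" by (rule Re_le[OF x])
    also have "\<dots> \<le> nrm E (c *\<^sub>C x)" by (rule g(2)) (use x in \<open>rule carrier_closed\<close>)
    finally show ?thesis using c x by (simp add: nrm_scale)
  qed
  show ?thesis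
  proof (rule that)
    show "\<tau> \<in> dual_ball E"
      unfolding dual_ball_def linear_between_def using add scale bound
      by (auto simp: \<tau>_def scaleC_complex_def)
    fix j assume j: "j \<in> I"
    obtain c where c: "cmod c = 1" "c * (\<tau> (e j) - s j) = complex_of_real (cmod (\<tau> (e j) - s j))"
      using ex_phase by blast
    \<comment> \<open>Testing the single coefficient of modulus one that rotates the error at j to a positive number.\<close>
    define d where "d i = (if i = j then c else 0)" for i
    have d: "A d = c *\<^sub>C e j" "B d = c * s j" "L d = \<delta>"
      unfolding A_def B_def L_def d_def using I j c(1)
      by (simp_all add: if_distrib[where f = "\<lambda>k. k *\<^sub>C _"] if_distrib[where f = cmod]
          mult_delta_left cong: if_cong)
    have "Re (c * \<tau> (e j)) \<le> g (c *\<^sub>C e j)" by (rule Re_le[OF e[OF j]])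
    also have "\<dots> \<le> nrm E (c *\<^sub>C e j + - A d) + (Re (B d) + \<delta>)"
      by (rule g(3)) (use d(3) e[OF j] in \<open>auto simp: R_def carrier_closed\<close>)
    also have "\<dots> = Re (c * s j) + \<delta>" by (simp only: d right_minus nrm_zero)
    finally have "Re (c * (\<tau> (e j) - s j)) \<le> \<delta>" by (simp add: algebra_simps)
    then show "cmod (\<tau> (e j) - s j) \<le> \<delta>" using c by simp
  qed
qed

end

section \<open>Complexity of sets of complex sequences\<close>

definition covered :: "(nat \<Rightarrow> complex) set \<Rightarrow> nat \<Rightarrow> real \<Rightarrow> real \<Rightarrow> bool" where
  "covered T n \<delta> N \<longleftrightarrow>
     (\<exists>C. finite C \<and> real (card C) \<le> N \<and> (\<forall>t\<in>T. \<exists>c\<in>C. \<forall>i<n. cmod (t i - c i) \<le> \<delta>))"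

text \<open>
  The constant \<open>A\<close> and the restriction to large \<open>n\<close> make the notion insensitive to
  subexponential factors, such as those produced by finite unions and sampling.
\<close>

definition zero_entropy :: "(nat \<Rightarrow> complex) set \<Rightarrow> bool" where
  "zero_entropy T \<longleftrightarrow>
     (\<forall>\<delta>>0. \<forall>\<epsilon>>0. \<exists>A. \<forall>\<^sub>F n in sequentially. covered T n \<delta> (A * exp (\<epsilon> * real n)))"

lemma covered_mono: "covered T n \<delta> N \<Longrightarrow> m \<le> n \<Longrightarrow> \<delta> \<le> \<delta>' \<Longrightarrow> N \<le> N' \<Longrightarrow> covered T m \<delta>' N'"
  unfolding covered_def by (meson order.trans less_le_trans)

lemma covered_Un:
  assumes "covered S n \<delta> M" "covered T n \<delta> N"
  shows "covered (S \<union> T) n \<delta> (M + N)"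
proof -
  obtain C D where C: "finite C" "real (card C) \<le> M" "\<forall>t\<in>S. \<exists>c\<in>C. \<forall>i<n. cmod (t i - c i) \<le> \<delta>"
    and D: "finite D" "real (card D) \<le> N" "\<forall>t\<in>T. \<exists>c\<in>D. \<forall>i<n. cmod (t i - c i) \<le> \<delta>"
    using assms unfolding covered_def by blast
  have "real (card (C \<union> D)) \<le> M + N" using card_Un_le[of C D] C(2) D(2) by linarith
  moreover have "\<forall>t\<in>S \<union> T. \<exists>c\<in>C \<union> D. \<forall>i<n. cmod (t i - c i) \<le> \<delta>" using C(3) D(3) by blast
  ultimately show ?thesis unfolding covered_def using C(1) D(1) by blast
qed

lemma zero_entropyD:
  assumes "zero_entropy T" "0 < \<delta>" "0 < \<epsilon>"
  obtains A where "0 \<le> A" "\<forall>\<^sub>F n in sequentially. covered T n \<delta> (A * exp (\<epsilon> * real n))"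
proof -
  obtain A where A: "\<forall>\<^sub>F n in sequentially. covered T n \<delta> (A * exp (\<epsilon> * real n))"
    using assms unfolding zero_entropy_def by blast
  have "\<forall>\<^sub>F n in sequentially. covered T n \<delta> (max 0 A * exp (\<epsilon> * real n))"
    using A by (rule eventually_mono) (erule covered_mono, auto intro!: mult_right_mono)
  then show ?thesis using that[of "max 0 A"] by simp
qed

lemma zero_entropy_transfer:
  assumes "\<And>\<delta>. \<delta> > 0 \<Longrightarrow> \<exists>S. zero_entropy S \<and> (\<forall>t\<in>T. \<exists>s\<in>S. \<forall>i. cmod (t i - s i) \<le> \<delta>)"
  shows "zero_entropy T"
  unfolding zero_entropy_def
proof (intro allI impI)
  fix \<delta> \<epsilon> :: real assume pos: "0 < \<delta>" "0 < \<epsilon>"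
  obtain S where S: "zero_entropy S" "\<forall>t\<in>T. \<exists>s\<in>S. \<forall>i. cmod (t i - s i) \<le> \<delta> / 2"
    using assms[of "\<delta> / 2"] pos by auto
  obtain A where A: "\<forall>\<^sub>F n in sequentially. covered S n (\<delta> / 2) (A * exp (\<epsilon> * real n))"
    using zero_entropyD[OF S(1), of "\<delta> / 2" \<epsilon>] pos by auto
  have "covered T n \<delta> N" if "covered S n (\<delta> / 2) N" for n N
  proof -
    obtain C where C: "finite C" "real (card C) \<le> N"
      "\<forall>t\<in>S. \<exists>c\<in>C. \<forall>i<n. cmod (t i - c i) \<le> \<delta> / 2"
      using \<open>covered S n (\<delta> / 2) N\<close> unfolding covered_def by blast
    have "\<exists>c\<in>C. \<forall>i<n. cmod (t i - c i) \<le> \<delta>" if t: "t \<in> T" for t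
    proof -
      obtain s where s: "s \<in> S" "\<forall>i. cmod (t i - s i) \<le> \<delta> / 2" using S(2) t by blast
      obtain c where c: "c \<in> C" "\<forall>i<n. cmod (s i - c i) \<le> \<delta> / 2" using C(3) s(1) by blast
      have "cmod (t i - c i) \<le> \<delta>" if "i < n" for i
        using norm_triangle_ineq[of "t i - s i" "s i - c i"] s(2)[rule_format, of i] c(2) that
        by fastforce
      then show ?thesis using c(1) by blast
    qed
    then show ?thesis unfolding covered_def using C(1,2) by blast
  qed
  then show "\<exists>A. \<forall>\<^sub>F n in sequentially. covered T n \<delta> (A * exp (\<epsilon> * real n))"
    using A by (blast intro: eventually_mono)
qed

text \<open>
  For a shift invariant set, every window of length \<open>n\<close> of a member is again the beginning of a member,
  so the approximants on consecutive windows can be chosen independently.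
\<close>

lemma covered_blocks:
  assumes inv: "\<And>t. t \<in> T \<Longrightarrow> (\<lambda>i. t (Suc i)) \<in> T" and cov: "covered T n \<delta> N" and "0 \<le> N"
  shows "covered T (k * n) \<delta> (N ^ k)"
proof (induction k)
  case 0
  show ?case unfolding covered_def by (rule exI[of _ "{\<lambda>_. 0}"]) simp
next
  case (Suc k)
  have shift: "(\<lambda>i. t (n + i)) \<in> T" if "t \<in> T" for t
  proof (induction n)
    case (Suc m)
    then show ?case using inv[of "\<lambda>i. t (m + i)"] by simp
  qed (use that in simp)
  obtain C where C: "finite C" "real (card C) \<le> N" "\<forall>t\<in>T. \<exists>c\<in>C. \<forall>i<n. cmod (t i - c i) \<le> \<delta>"
    using cov unfolding covered_def by blast
  obtain D where D: "finite D" "real (card D) \<le> N ^ k"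
      "\<forall>t\<in>T. \<exists>c\<in>D. \<forall>i<k * n. cmod (t i - c i) \<le> \<delta>"
    using Suc unfolding covered_def by blast
  define glue where "glue = (\<lambda>(c, d) i. if i < n then c i else (d (i - n) :: complex))"
  have "real (card (glue ` (C \<times> D))) \<le> real (card C) * real (card D)"
    using card_image_le[of "C \<times> D" glue] C(1) D(1)
    by (simp add: card_cartesian_product flip: of_nat_mult)
  also have "\<dots> \<le> N * N ^ k" using C(2) D(2) \<open>0 \<le> N\<close> by (intro mult_mono) auto
  finally have card: "real (card (glue ` (C \<times> D))) \<le> N ^ Suc k" by simp
  have glued: "\<exists>c\<in>glue ` (C \<times> D). \<forall>i<Suc k * n. cmod (t i - c i) \<le> \<delta>" if t: "t \<in> T" for t
  proof -
    obtain c where c: "c \<in> C" "\<forall>i<n. cmod (t i - c i) \<le> \<delta>" using C(3) t by blast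
    obtain d where d: "d \<in> D" "\<forall>i<k * n. cmod (t (n + i) - d i) \<le> \<delta>"
      using bspec[OF D(3) shift[OF t]] by blast
    have "cmod (t i - glue (c, d) i) \<le> \<delta>" if "i < Suc k * n" for i
      using c(2) d(2)[rule_format, of "i - n"] that by (auto simp: glue_def)
    then show ?thesis using c(1) d(1) by (intro bexI[of _ "glue (c, d)"]) auto
  qed
  show ?case
    unfolding covered_def
    by (intro exI[of _ "glue ` (C \<times> D)"] conjI ballI glued card) (simp add: C(1) D(1))
qed

text \<open>
  Exponential growth is thus controlled for all lengths by one sufficiently good scale \<open>n\<close>. This
  permits scales that depend on the point of the base space.
\<close>

lemma covered_of_single_scale:
  assumes inv: "\<And>t. t \<in> T \<Longrightarrow> (\<lambda>i. t (Suc i)) \<in> T"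
    and n: "0 < n" and cov: "covered T n \<delta> (exp (\<epsilon> * real n))" and "0 \<le> \<epsilon>"
  shows "covered T m \<delta> (exp (\<epsilon> * real n) * exp (\<epsilon> * real m))"
proof -
  define k where "k = Suc (m div n)"
  have "m < k * n" using n dividend_less_div_times[of n m] by (simp add: k_def)
  have "k * n \<le> n + m" using n by (simp add: k_def)
  then have "real k * real n \<le> real n + real m" by (metis of_nat_add of_nat_le_iff of_nat_mult)
  then have "\<epsilon> * (real k * real n) \<le> \<epsilon> * (real n + real m)" using \<open>0 \<le> \<epsilon>\<close> by (rule mult_left_mono)
  then have "exp (\<epsilon> * real n) ^ k \<le> exp (\<epsilon> * real n) * exp (\<epsilon> * real m)"
    by (simp add: algebra_simps flip: exp_of_nat_mult exp_add)
  then show ?thesis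
    using covered_mono[OF covered_blocks[OF inv cov, of k], of m] \<open>m < k * n\<close> by simp
qed

section \<open>Sampling in convex hulls\<close>

lemma weighted_average_le:
  fixes w Q :: "'j \<Rightarrow> real"
  assumes J: "finite J" and w: "\<And>j. j \<in> J \<Longrightarrow> 0 \<le> w j" "sum w J = 1"
    and le: "(\<Sum>j\<in>J. w j * Q j) \<le> B"
  shows "\<exists>j\<in>J. Q j \<le> B"
proof (rule ccontr)
  assume "\<not> ?thesis"
  then have gt: "Q j - B > 0" if "j \<in> J" for j using that by force
  have "(\<Sum>j\<in>J. w j * (Q j - B)) = (\<Sum>j\<in>J. w j * Q j) - B"
    using w(2) by (simp add: right_diff_distrib sum_subtractf flip: sum_distrib_right)
  moreover have "0 \<le> (\<Sum>j\<in>J. w j * (Q j - B))"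
    by (rule sum_nonneg) (use gt w(1) in \<open>simp add: less_imp_le\<close>)
  ultimately have "(\<Sum>j\<in>J. w j * (Q j - B)) = 0" using le by simp
  then have "\<forall>j\<in>J. w j * (Q j - B) = 0"
    using J gt w(1) by (subst (asm) sum_nonneg_eq_0_iff) (auto simp: less_imp_le)
  then have "\<forall>j\<in>J. w j = 0" using gt by force
  then show False using w(2) by simp
qed

text \<open>
  Maurey's empirical method in the mean square norm: averaging \<open>|S + p\<^sub>j - t|\<^sup>2\<close> over \<open>j\<close> with weights
  \<open>w\<^sub>j\<close> kills the cross term, so some choice of \<open>j\<close> increases the squared error by at most \<open>n R\<^sup>2\<close>. The
  number \<open>k\<close> of samples needed for a given accuracy per coordinate does not depend on \<open>n\<close>; with
  the supremum norm in place of the mean square norm it would grow logarithmically.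
\<close>

lemma maurey_sampling:
  fixes p :: "'j \<Rightarrow> nat \<Rightarrow> complex"
  assumes J: "finite J" and w: "\<And>j. j \<in> J \<Longrightarrow> 0 \<le> w j" "sum w J = 1"
    and p: "\<And>j i. j \<in> J \<Longrightarrow> i < n \<Longrightarrow> cmod (p j i) \<le> R"
    and t: "\<And>i. i < n \<Longrightarrow> t i = (\<Sum>j\<in>J. w j *\<^sub>R p j i)"
  shows "\<exists>js. set js \<subseteq> J \<and> length js = k \<and>
    (\<Sum>i<n. (cmod ((\<Sum>j\<leftarrow>js. p j i) - of_nat k * t i))\<^sup>2) \<le> real k * (real n * R\<^sup>2)"
proof (induction k)
  case 0
  show ?case by (intro exI[of _ "[]"]) simp
next
  case (Suc k)
  then obtain js where js: "set js \<subseteq> J" "length js = k"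
    "(\<Sum>i<n. (cmod ((\<Sum>j\<leftarrow>js. p j i) - of_nat k * t i))\<^sup>2) \<le> real k * (real n * R\<^sup>2)" by blast
  define S where "S i = (\<Sum>j\<leftarrow>js. p j i) - of_nat k * t i" for i
  have avg: "(\<Sum>j\<in>J. w j * (cmod (S i + (p j i - t i)))\<^sup>2) \<le> (cmod (S i))\<^sup>2 + R\<^sup>2"
    if i: "i < n" for i
  proof -
    define v where "v = S i - t i"
    have "(\<Sum>j\<in>J. w j * (cmod (S i + (p j i - t i)))\<^sup>2)
        = (\<Sum>j\<in>J. w j * (cmod v)\<^sup>2 + 2 * (v \<bullet> (w j *\<^sub>R p j i)) + w j * (cmod (p j i))\<^sup>2)"
    proof (rule sum.cong[OF refl])
      fix j
      have "S i + (p j i - t i) = v + p j i" by (simp add: v_def)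
      then show "w j * (cmod (S i + (p j i - t i)))\<^sup>2
          = w j * (cmod v)\<^sup>2 + 2 * (v \<bullet> (w j *\<^sub>R p j i)) + w j * (cmod (p j i))\<^sup>2"
        by (simp only: power2_norm_eq_inner inner_add_left inner_add_right inner_scaleR_right)
          (simp add: inner_commute algebra_simps)
    qed
    also have "\<dots> = (cmod v)\<^sup>2 + 2 * (v \<bullet> t i) + (\<Sum>j\<in>J. w j * (cmod (p j i))\<^sup>2)"
      using w(2) t[OF i]
      by (simp add: sum.distrib inner_sum_right sum_distrib_left flip: sum_distrib_right)
    also have "(\<Sum>j\<in>J. w j * (cmod (p j i))\<^sup>2) \<le> (\<Sum>j\<in>J. w j * R\<^sup>2)"
      by (intro sum_mono mult_left_mono power_mono) (use w(1) p i in auto)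
    also have "\<dots> = R\<^sup>2" using w(2) by (simp flip: sum_distrib_right)
    also have "(cmod v)\<^sup>2 + 2 * (v \<bullet> t i) = (cmod (S i))\<^sup>2 - (cmod (t i))\<^sup>2"
      unfolding v_def power2_norm_eq_inner
      by (simp add: inner_diff_left inner_diff_right inner_commute)
    also have "\<dots> \<le> (cmod (S i))\<^sup>2" by simp
    finally show ?thesis by simp
  qed
  have "(\<Sum>j\<in>J. w j * (\<Sum>i<n. (cmod (S i + (p j i - t i)))\<^sup>2))
      = (\<Sum>i<n. \<Sum>j\<in>J. w j * (cmod (S i + (p j i - t i)))\<^sup>2)"
    by (simp add: sum_distrib_left) (rule sum.swap)
  also have "\<dots> \<le> (\<Sum>i<n. (cmod (S i))\<^sup>2 + R\<^sup>2)" by (rule sum_mono) (use avg in simp)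
  also have "\<dots> \<le> real (Suc k) * (real n * R\<^sup>2)"
    using js(3) by (simp add: sum.distrib S_def algebra_simps)
  finally have "\<exists>j\<in>J. (\<Sum>i<n. (cmod (S i + (p j i - t i)))\<^sup>2) \<le> real (Suc k) * (real n * R\<^sup>2)"
    by (rule weighted_average_le[OF J w, rotated])
  then obtain j where j: "j \<in> J"
    "(\<Sum>i<n. (cmod (S i + (p j i - t i)))\<^sup>2) \<le> real (Suc k) * (real n * R\<^sup>2)" ..
  have "S i + (p j i - t i) = (\<Sum>j\<leftarrow>j # js. p j i) - of_nat (Suc k) * t i" for i
    by (simp add: S_def algebra_simps)
  then have "(\<Sum>i<n. (cmod ((\<Sum>j\<leftarrow>j # js. p j i) - of_nat (Suc k) * t i))\<^sup>2)
      \<le> real (Suc k) * (real n * R\<^sup>2)"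
    using j(2) by presburger
  then show ?case using js(1,2) j(1) by (intro exI[of _ "j # js"]) auto
qed

text \<open>
  Complex coefficients are decomposed along these four directions with nonnegative weights, whose sum
  exceeds the modulus by a factor of at most two.
\<close>

definition units4 :: "complex set" where "units4 = {1, \<i>, -1, -\<i>}"

lemma finite_units4: "finite units4" and card_units4: "card units4 = 4"
  by (simp_all add: units4_def complex_eq_iff)

lemma sum_units4: "(\<Sum>u\<in>units4. g u) = g 1 + g \<i> + g (-1) + g (-\<i>)"
  for g :: "complex \<Rightarrow> 'a::comm_monoid_add"
  by (simp add: units4_def complex_eq_iff add.assoc)

text \<open>
  Sampling \<open>k\<close> of the \<open>4 d + 1\<close> points \<open>2 u \<phi>\<^sub>j\<close> and \<open>0\<close>: the factor \<open>2\<close> absorbs the loss in the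
  decomposition along four directions, and the point \<open>0\<close> takes the missing weight.
\<close>

lemma hull_mean_square_cover:
  fixes \<phi> :: "nat \<Rightarrow> nat \<Rightarrow> complex"
  assumes \<phi>: "\<And>j i. j < d \<Longrightarrow> i < n \<Longrightarrow> cmod (\<phi> j i) \<le> M" and M: "0 \<le> M" and k: "0 < k"
  obtains C where "finite C" "card C \<le> (4 * d + 1) ^ k"
    "\<And>a. (\<Sum>j<d. cmod (a j)) \<le> 1 \<Longrightarrow>
      \<exists>c\<in>C. (\<Sum>i<n. (cmod ((\<Sum>j<d. a j * \<phi> j i) - c i))\<^sup>2) \<le> real n * (2 * M)\<^sup>2 / real k"
proof -
  define J0 where "J0 = {..<d} \<times> units4"
  define J where "J = insert None (Some ` J0)"
  define p where "p = (\<lambda>z i. case z of None \<Rightarrow> 0 | Some (j, u) \<Rightarrow> 2 * u * \<phi> j i)"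
  have J0: "finite J0" by (simp add: J0_def finite_units4)
  then have J: "finite J" by (simp add: J_def)
  have cardJ: "card J = 4 * d + 1"
    using J0 by (simp add: J_def J0_def card_image card_cartesian_product card_units4)
  define L where "L = {js. set js \<subseteq> J \<and> length js = k}"
  define C where "C = (\<lambda>js i. (\<Sum>j\<leftarrow>js. p j i) / of_nat k) ` L"
  have L: "finite L" "card L = (4 * d + 1) ^ k"
    unfolding L_def using finite_lists_length_eq[OF J] card_lists_length_eq[OF J] cardJ by auto
  have sumJ: "(\<Sum>z\<in>J. g z) = g None + (\<Sum>j<d. \<Sum>u\<in>units4. g (Some (j, u)))"
    for g :: "(nat \<times> complex) option \<Rightarrow> 'x::comm_monoid_add"
    using J0 by (simp add: J_def sum.reindex J0_def sum.cartesian_product case_prod_unfold)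
  show ?thesis
  proof (rule that)
    show "finite C" "card C \<le> (4 * d + 1) ^ k"
      using L card_image_le[OF L(1)] by (auto simp: C_def)
    fix a :: "nat \<Rightarrow> complex" assume a: "(\<Sum>j<d. cmod (a j)) \<le> 1"
    define q where "q j u = max 0 (a j \<bullet> u) / 2" for j u
    define W where "W = (\<Sum>j<d. \<Sum>u\<in>units4. q j u)"
    define w where "w = (\<lambda>z. case z of None \<Rightarrow> 1 - W | Some (j, u) \<Rightarrow> q j u)"
    have q_sum: "(\<Sum>u\<in>units4. q j u) \<le> cmod (a j)" for j
      using abs_Re_le_cmod[of "a j"] abs_Im_le_cmod[of "a j"]
      by (auto simp: sum_units4 q_def inner_complex_def max_def)
    have q_rep: "(\<Sum>u\<in>units4. q j u *\<^sub>R (2 * u * x)) = a j * x" for j x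
    proof -
      have "(\<Sum>u\<in>units4. complex_of_real (q j u) * 2 * u) = a j"
        by (auto simp: sum_units4 q_def inner_complex_def max_def complex_eq_iff)
      then have "(\<Sum>u\<in>units4. complex_of_real (q j u) * 2 * u) * x = a j * x" by simp
      then show ?thesis by (simp add: scaleR_conv_of_real sum_distrib_right mult.assoc)
    qed
    have "W \<le> 1" unfolding W_def using sum_mono[OF q_sum, of "\<lambda>j. j" "{..<d}"] a
      by (meson order_trans q_sum sum_mono)
    have "\<exists>js. set js \<subseteq> J \<and> length js = k \<and>
      (\<Sum>i<n. (cmod ((\<Sum>j\<leftarrow>js. p j i) - of_nat k * (\<Sum>j<d. a j * \<phi> j i)))\<^sup>2)
        \<le> real k * (real n * (2 * M)\<^sup>2)"
    proof (rule maurey_sampling[OF J])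
      show "0 \<le> w z" if "z \<in> J" for z
        using \<open>W \<le> 1\<close> by (auto simp: w_def q_def split: option.split)
      show "sum w J = 1" by (simp add: sumJ w_def W_def)
      show "cmod (p z i) \<le> 2 * M" if z: "z \<in> J" and i: "i < n" for z i
      proof (cases z)
        case None
        then show ?thesis using M by (simp add: p_def None)
      next
        case (Some ju)
        then obtain j u where ju: "z = Some (j, u)" "j < d" "u \<in> units4"
          using z by (auto simp: J_def J0_def)
        then have "cmod u = 1" by (auto simp: units4_def)
        then show ?thesis using \<phi>[OF ju(2) i] ju(1) by (simp add: p_def norm_mult)
      qed
      show "(\<Sum>j<d. a j * \<phi> j i) = (\<Sum>z\<in>J. w z *\<^sub>R p z i)" for i
        by (simp add: sumJ w_def p_def q_rep)
    qed
    then obtain js where js: "js \<in> L"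
      "(\<Sum>i<n. (cmod ((\<Sum>j\<leftarrow>js. p j i) - of_nat k * (\<Sum>j<d. a j * \<phi> j i)))\<^sup>2)
        \<le> real k * (real n * (2 * M)\<^sup>2)" by (auto simp: L_def)
    have "(\<Sum>i<n. (cmod ((\<Sum>j<d. a j * \<phi> j i) - (\<Sum>j\<leftarrow>js. p j i) / of_nat k))\<^sup>2)
      = (\<Sum>i<n. (cmod ((\<Sum>j\<leftarrow>js. p j i) - of_nat k * (\<Sum>j<d. a j * \<phi> j i)))\<^sup>2) / (real k)\<^sup>2"
      unfolding sum_divide_distrib
    proof (rule sum.cong[OF refl])
      fix i
      have "(\<Sum>j<d. a j * \<phi> j i) - (\<Sum>j\<leftarrow>js. p j i) / of_nat k
          = - (((\<Sum>j\<leftarrow>js. p j i) - of_nat k * (\<Sum>j<d. a j * \<phi> j i)) / of_nat k)"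
        using k by (simp add: field_simps)
      then show "(cmod ((\<Sum>j<d. a j * \<phi> j i) - (\<Sum>j\<leftarrow>js. p j i) / of_nat k))\<^sup>2
        = (cmod ((\<Sum>j\<leftarrow>js. p j i) - of_nat k * (\<Sum>j<d. a j * \<phi> j i)))\<^sup>2 / (real k)\<^sup>2"
        by (simp add: norm_divide power_divide)
    qed
    also have "\<dots> \<le> (real k * (real n * (2 * M)\<^sup>2)) / (real k)\<^sup>2"
      by (rule divide_right_mono[OF js(2)]) simp
    also have "\<dots> = real n * (2 * M)\<^sup>2 / real k" by (simp add: power2_eq_square)
    finally show "\<exists>c\<in>C. (\<Sum>i<n. (cmod ((\<Sum>j<d. a j * \<phi> j i) - c i))\<^sup>2) \<le> real n * (2 * M)\<^sup>2 / real k"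
      unfolding C_def using js(1)
      by (intro bexI[of _ "\<lambda>i. (\<Sum>j\<leftarrow>js. p j i) / of_nat k"] imageI)
  qed
qed

text \<open>
  Chernoff's trick: giving each prescribed entry the weight \<open>exp (- s)\<close> and each free entry the weight
  \<open>1\<close>, all patterns together have weight \<open>(1 + exp (- s) |G|)\<^sup>n\<close>, while each sparse pattern has weight at
  least \<open>exp (- s \<theta> n)\<close>.
\<close>

lemma card_sparse_patterns:
  fixes G :: "'g set" and n :: nat and \<theta> :: real
  assumes G: "finite G" and "0 \<le> s"
  defines "P \<equiv> {f \<in> {..<n} \<rightarrow>\<^sub>E insert None (Some ` G). real (card {i. i < n \<and> f i \<noteq> None}) \<le> \<theta> * real n}"
  shows "finite P" "real (card P) \<le> exp ((s * \<theta> + exp (- s) * real (card G)) * real n)"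
proof -
  define A where "A = insert None (Some ` G)"
  define w :: "'g option \<Rightarrow> real" where "w z = (if z = None then 1 else exp (- s))" for z
  have A: "finite A" using G by (simp add: A_def)
  have PiE: "finite ({..<n} \<rightarrow>\<^sub>E A)" by (rule finite_PiE) (use A in auto)
  then show P: "finite P" unfolding P_def A_def by simp
  have prod_w: "(\<Prod>i<n. w (f i)) = exp (- s * real (card {i. i < n \<and> f i \<noteq> None}))" for f
  proof -
    have "(\<Prod>i<n. w (f i)) = (\<Prod>i\<in>{i\<in>{..<n}. f i \<noteq> None}. exp (- s))"
      unfolding w_def by (subst prod.inter_filter) (auto intro!: prod.cong)
    then show ?thesis by (simp add: exp_of_nat_mult[symmetric] mult.commute)
  qed
  have "real (card P) * exp (- s * (\<theta> * real n)) = (\<Sum>f\<in>P. exp (- s * (\<theta> * real n)))" by simp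
  also have "\<dots> \<le> (\<Sum>f\<in>P. \<Prod>i<n. w (f i))"
    unfolding prod_w by (rule sum_mono) (use \<open>0 \<le> s\<close> in \<open>auto simp: P_def intro: mult_left_mono\<close>)
  also have "\<dots> \<le> (\<Sum>f\<in>{..<n} \<rightarrow>\<^sub>E A. \<Prod>i<n. w (f i))"
  proof (rule sum_mono2[OF PiE])
    show "P \<subseteq> {..<n} \<rightarrow>\<^sub>E A" unfolding P_def A_def by (rule Collect_restrict)
  qed (simp add: prod_w)
  also have "\<dots> = (\<Prod>i<n. \<Sum>z\<in>A. w z)"
    by (rule prod_sum_PiE[symmetric]) (use A in auto)
  also have "(\<Sum>z\<in>A. w z) = 1 + exp (- s) * real (card G)"
    unfolding A_def w_def using G by (simp add: sum.reindex)
  also have "(\<Prod>i<n. 1 + exp (- s) * real (card G)) \<le> exp (exp (- s) * real (card G)) ^ n"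
    by (simp add: power_mono exp_ge_add_one_self)
  finally have "real (card P) * exp (- s * (\<theta> * real n)) \<le> exp (exp (- s) * real (card G)) ^ n" .
  then have "real (card P) \<le> exp (s * (\<theta> * real n)) * exp (exp (- s) * real (card G)) ^ n"
    by (simp add: exp_minus field_simps)
  also have "\<dots> = exp ((s * \<theta> + exp (- s) * real (card G)) * real n)"
    by (simp add: algebra_simps flip: exp_of_nat_mult exp_add)
  finally show "real (card P) \<le> exp ((s * \<theta> + exp (- s) * real (card G)) * real n)" .
qed

lemma disc_net:
  fixes M \<delta> :: real
  assumes "0 < \<delta>"
  obtains G :: "complex set" where "finite G" "\<And>z. cmod z \<le> M \<Longrightarrow> \<exists>g\<in>G. cmod (z - g) \<le> \<delta>"
proof -
  have "compact (cball (0::complex) M)" by simp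
  then obtain G where G: "finite G" "cball (0::complex) M \<subseteq> (\<Union>g\<in>G. ball g \<delta>)"
    using assms unfolding compact_eq_totally_bounded by blast
  have "\<exists>g\<in>G. cmod (z - g) \<le> \<delta>" if z: "cmod z \<le> M" for z
  proof -
    have "z \<in> (\<Union>g\<in>G. ball g \<delta>)" using z by (intro subsetD[OF G(2)]) simp
    then obtain g where "g \<in> G" "dist g z < \<delta>" by auto
    then show ?thesis
      by (intro bexI[of _ g]) (simp_all add: dist_norm norm_minus_commute)
  qed
  then show ?thesis using that G(1) by blast
qed

text \<open>
  A set of sequences has zero entropy if its initial segments lie near absolutely convex hulls of
  subexponentially many points. Sampling gives subexponentially many approximants in mean square; these
  are within \<open>\<delta>\<close> of the target outside a small proportion \<open>\<theta>\<close> of the coordinates, and the values at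
  the exceptional coordinates are listed from a finite net of the disc. The list costs an
  arbitrarily small exponential rate because few coordinates are exceptional.
\<close>

lemma zero_entropy_of_small_hulls:
  fixes T :: "(nat \<Rightarrow> complex) set"
  assumes M: "0 \<le> M" and T: "\<And>t i. t \<in> T \<Longrightarrow> cmod (t i) \<le> M"
    and hull: "\<And>\<delta> \<epsilon>. 0 < \<delta> \<Longrightarrow> 0 < \<epsilon> \<Longrightarrow> \<forall>\<^sub>F n in sequentially. \<exists>d \<phi>.
      0 < d \<and> real d \<le> exp (\<epsilon> * real n) \<and> (\<forall>j<d. \<forall>i<n. cmod (\<phi> j i) \<le> M) \<and>
      (\<forall>t\<in>T. \<exists>a. (\<Sum>j<d. cmod (a j)) \<le> 1 \<and> (\<forall>i<n. cmod (t i - (\<Sum>j<d. a j * \<phi> j i)) \<le> \<delta>))"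
  shows "zero_entropy T"
  unfolding zero_entropy_def
proof (intro allI impI)
  fix \<delta>0 \<epsilon> :: real assume pos: "0 < \<delta>0" "0 < \<epsilon>"
  define \<delta> where "\<delta> = \<delta>0 / 2"
  have \<delta>: "0 < \<delta>" using pos by (simp add: \<delta>_def)
  obtain G where G: "finite G" "\<And>z. cmod z \<le> M \<Longrightarrow> \<exists>g\<in>G. cmod (z - g) \<le> \<delta>"
    using disc_net[OF \<delta>] by blast
  \<comment> \<open>The parameters split the rate into three parts of at most a third each: s makes the factor
    exp (- s) card G small, k then makes the proportion theta of exceptional coordinates small compared
    to 1 / s, and finally the dimension d is taken at rate epsilon / (3 k), as its k-th power appears.\<close>
  define s where "s = ln (1 + 3 * real (card G) / \<epsilon>)"
  have s: "0 \<le> s" unfolding s_def using pos by simp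
  have "exp s = 1 + 3 * real (card G) / \<epsilon>"
    unfolding s_def using pos by (simp add: add_pos_nonneg)
  then have "3 * real (card G) \<le> \<epsilon> * exp s" using pos by (simp add: field_simps)
  then have sG: "exp (- s) * real (card G) \<le> \<epsilon> / 3" by (simp add: exp_minus field_simps)
  obtain k0 :: nat where k0: "3 * s * (2 * M)\<^sup>2 / (\<delta>\<^sup>2 * \<epsilon>) < real k0" using reals_Archimedean2 by blast
  define k where "k = Suc k0"
  have k: "0 < k" by (simp add: k_def)
  define \<theta> where "\<theta> = (2 * M)\<^sup>2 / (real k * \<delta>\<^sup>2)"
  have "3 * s * (2 * M)\<^sup>2 / (\<delta>\<^sup>2 * \<epsilon>) \<le> real k" using k0 by (simp add: k_def)
  then have s\<theta>: "s * \<theta> \<le> \<epsilon> / 3"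
    using pos \<delta> k unfolding \<theta>_def by (simp add: field_simps)
  have "covered T n \<delta>0 (5 ^ k * exp (\<epsilon> * real n))" if
    h: "\<exists>d \<phi>. 0 < d \<and> real d \<le> exp (\<epsilon> / (3 * real k) * real n) \<and> (\<forall>j<d. \<forall>i<n. cmod (\<phi> j i) \<le> M) \<and>
      (\<forall>t\<in>T. \<exists>a. (\<Sum>j<d. cmod (a j)) \<le> 1 \<and> (\<forall>i<n. cmod (t i - (\<Sum>j<d. a j * \<phi> j i)) \<le> \<delta>))" for n
  proof -
    obtain d \<phi> where d: "0 < d" "real d \<le> exp (\<epsilon> / (3 * real k) * real n)"
      and \<phi>: "\<And>j i. j < d \<Longrightarrow> i < n \<Longrightarrow> cmod (\<phi> j i) \<le> M"
      and h: "\<And>t. t \<in> T \<Longrightarrow>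
        \<exists>a. (\<Sum>j<d. cmod (a j)) \<le> 1 \<and> (\<forall>i<n. cmod (t i - (\<Sum>j<d. a j * \<phi> j i)) \<le> \<delta>)"
      using h by blast
    obtain C where C: "finite C" "card C \<le> (4 * d + 1) ^ k"
      "\<And>a. (\<Sum>j<d. cmod (a j)) \<le> 1 \<Longrightarrow>
        \<exists>c\<in>C. (\<Sum>i<n. (cmod ((\<Sum>j<d. a j * \<phi> j i) - c i))\<^sup>2) \<le> real n * (2 * M)\<^sup>2 / real k"
      by (rule hull_mean_square_cover[of d n \<phi> M k, OF \<phi> M k]) (assumption, assumption, rule that)
    define P where "P = {f \<in> {..<n} \<rightarrow>\<^sub>E insert None (Some ` G).
      real (card {i. i < n \<and> f i \<noteq> None}) \<le> \<theta> * real n}"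
    note Pfin = card_sparse_patterns(1)[OF G(1) s, of n \<theta>, folded P_def]
    note Pcard = card_sparse_patterns(2)[OF G(1) s, of n \<theta>, folded P_def]
    define repair where "repair = (\<lambda>(c, f) (i::nat). case f i of None \<Rightarrow> c i | Some g \<Rightarrow> (g :: complex))"
    define D where "D = repair ` (C \<times> P)"
    have Dfin: "finite D" using C(1) Pfin by (simp add: D_def)
    have "real (card D) \<le> real (card C) * real (card P)"
      unfolding D_def using card_image_le[of "C \<times> P" repair] C(1) Pfin
      by (simp add: card_cartesian_product flip: of_nat_mult)
    also have "\<dots> \<le> (5 ^ k * exp (\<epsilon> / 3 * real n)) * exp ((2 * \<epsilon> / 3) * real n)"
    proof (rule mult_mono)
      have "real (card C) \<le> real ((4 * d + 1) ^ k)" using C(2) by (rule of_nat_mono)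
      also have "\<dots> \<le> (5 * real d) ^ k"
        unfolding of_nat_power by (rule power_mono) (use d(1) in auto)
      also have "\<dots> \<le> (5 * exp (\<epsilon> / (3 * real k) * real n)) ^ k"
        using d(2) by (intro power_mono) auto
      also have "\<dots> = 5 ^ k * exp (\<epsilon> / 3 * real n)"
        using k by (simp add: power_mult_distrib flip: exp_of_nat_mult)
      finally show "real (card C) \<le> 5 ^ k * exp (\<epsilon> / 3 * real n)" .
      have "(s * \<theta> + exp (- s) * real (card G)) * real n \<le> (2 * \<epsilon> / 3) * real n"
        using s\<theta> sG by (intro mult_right_mono) auto
      then show "real (card P) \<le> exp ((2 * \<epsilon> / 3) * real n)" using Pcard by (meson exp_le_cancel_iff order_trans)
    qed auto
    also have "\<dots> = 5 ^ k * exp (\<epsilon> * real n)"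
    proof -
      have "\<epsilon> / 3 * real n + (2 * \<epsilon> / 3) * real n = \<epsilon> * real n" by (simp add: algebra_simps)
      then show ?thesis by (simp only: mult.assoc flip: exp_add)
    qed
    finally have Dcard: "real (card D) \<le> 5 ^ k * exp (\<epsilon> * real n)" .
    have "\<exists>c\<in>D. \<forall>i<n. cmod (t i - c i) \<le> \<delta>0" if t: "t \<in> T" for t
    proof -
      obtain a where a: "(\<Sum>j<d. cmod (a j)) \<le> 1" "\<forall>i<n. cmod (t i - (\<Sum>j<d. a j * \<phi> j i)) \<le> \<delta>"
        using h[OF t] by blast
      define t' where "t' i = (\<Sum>j<d. a j * \<phi> j i)" for i
      obtain c where c: "c \<in> C" "(\<Sum>i<n. (cmod (t' i - c i))\<^sup>2) \<le> real n * (2 * M)\<^sup>2 / real k"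
        using C(3)[OF a(1)] unfolding t'_def by blast
      define bad where "bad = {i. i < n \<and> \<delta> < cmod (t' i - c i)}"
      have bad: "finite bad" "bad \<subseteq> {..<n}" by (auto simp: bad_def)
      have "real (card bad) * \<delta>\<^sup>2 = (\<Sum>i\<in>bad. \<delta>\<^sup>2)" by simp
      also have "\<dots> \<le> (\<Sum>i\<in>bad. (cmod (t' i - c i))\<^sup>2)"
        by (intro sum_mono power_mono) (use \<delta> in \<open>auto simp: bad_def\<close>)
      also have "\<dots> \<le> (\<Sum>i<n. (cmod (t' i - c i))\<^sup>2)" by (rule sum_mono2) (use bad in auto)
      also note c(2)
      finally have badcard: "real (card bad) \<le> \<theta> * real n"
        using \<delta> k by (simp add: \<theta>_def field_simps)
      have "\<forall>i. \<exists>g\<in>G. cmod (t i - g) \<le> \<delta>" using G(2) T[OF t] by blast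
      then obtain g where g: "\<And>i. g i \<in> G" "\<And>i. cmod (t i - g i) \<le> \<delta>" by metis
      define f where "f = (\<lambda>i\<in>{..<n}. if i \<in> bad then Some (g i) else None)"
      have "{i. i < n \<and> f i \<noteq> None} = bad" using bad(2) by (auto simp: f_def)
      then have "f \<in> P" using g(1) badcard by (auto simp: P_def f_def)
      then have "repair (c, f) \<in> D" using c(1) by (auto simp: D_def)
      moreover have "cmod (t i - repair (c, f) i) \<le> \<delta>0" if i: "i < n" for i
      proof (cases "i \<in> bad")
        case True
        then show ?thesis using i g(2)[of i] \<delta> by (simp add: repair_def f_def \<delta>_def)
      next
        case False
        then have "cmod (t' i - c i) \<le> \<delta>" using i by (auto simp: bad_def)
        moreover have "cmod (t i - t' i) \<le> \<delta>" using a(2) i by (simp add: t'_def)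
        ultimately have "cmod ((t i - t' i) + (t' i - c i)) \<le> \<delta>0"
          using norm_triangle_ineq[of "t i - t' i" "t' i - c i"] unfolding \<delta>_def by linarith
        then show ?thesis using False i by (simp add: repair_def f_def)
      qed
      ultimately show ?thesis by blast
    qed
    then show ?thesis unfolding covered_def using Dfin Dcard by blast
  qed
  moreover have "\<forall>\<^sub>F n in sequentially.
    \<exists>d \<phi>. 0 < d \<and> real d \<le> exp (\<epsilon> / (3 * real k) * real n) \<and> (\<forall>j<d. \<forall>i<n. cmod (\<phi> j i) \<le> M) \<and>
      (\<forall>t\<in>T. \<exists>a. (\<Sum>j<d. cmod (a j)) \<le> 1 \<and> (\<forall>i<n. cmod (t i - (\<Sum>j<d. a j * \<phi> j i)) \<le> \<delta>))"
    by (rule hull[OF \<delta>]) (use pos k in simp)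
  ultimately show "\<exists>A. \<forall>\<^sub>F n in sequentially. covered T n \<delta>0 (A * exp (\<epsilon> * real n))"
    by (intro exI[of _ "5 ^ k"]) (rule eventually_mono)
qed

section \<open>Contractive rank and coverings of norming sets\<close>

lemma sup_over_upper: "bdd_above (g ` I) \<Longrightarrow> i \<in> I \<Longrightarrow> g i \<le> sup_over I g"
  unfolding sup_over_def by (rule cSup_upper) auto

lemma sup_over_nonneg: "bdd_above (g ` I) \<Longrightarrow> 0 \<le> sup_over I g"
  unfolding sup_over_def by (rule cSup_upper) auto

lemma sup_over_least: "0 \<le> B \<Longrightarrow> (\<And>i. i \<in> I \<Longrightarrow> g i \<le> B) \<Longrightarrow> sup_over I g \<le> B"
  unfolding sup_over_def by (rule cSup_least) auto

lemma seminormed_sup_over: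
  fixes p :: "'i \<Rightarrow> 'a::complex_vector \<Rightarrow> real"
  assumes V: "complex_vector.subspace V"
    and nonneg: "\<And>i x. i \<in> I \<Longrightarrow> x \<in> V \<Longrightarrow> 0 \<le> p i x"
    and scale: "\<And>i x c. i \<in> I \<Longrightarrow> x \<in> V \<Longrightarrow> p i (c *\<^sub>C x) = cmod c * p i x"
    and triangle: "\<And>i x y. i \<in> I \<Longrightarrow> x \<in> V \<Longrightarrow> y \<in> V \<Longrightarrow> p i (x + y) \<le> p i x + p i y"
    and bdd: "\<And>x. x \<in> V \<Longrightarrow> bdd_above ((\<lambda>i. p i x) ` I)"
  shows "seminormed \<lparr>carrier = V, nrm = (\<lambda>x. sup_over I (\<lambda>i. p i x))\<rparr>"
proof -
  define N where "N x = sup_over I (\<lambda>i. p i x)" for x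
  have N0: "0 \<le> N x" if "x \<in> V" for x
    unfolding N_def by (rule sup_over_nonneg[OF bdd[OF that]])
  have N_upper: "p i x \<le> N x" if "i \<in> I" "x \<in> V" for i x
    unfolding N_def using sup_over_upper[OF bdd[OF that(2)] that(1)] .
  have scale_le: "N (c *\<^sub>C x) \<le> cmod c * N x" if x: "x \<in> V" for c x
    unfolding N_def[of "c *\<^sub>C x"]
    by (rule sup_over_least) (use x N0 N_upper scale in \<open>auto intro: mult_left_mono\<close>)
  have "N (c *\<^sub>C x) = cmod c * N x" if x: "x \<in> V" for c x
  proof (cases "c = 0")
    case True
    have "0 *\<^sub>C x \<in> V" using V x by (rule complex_vector.subspace_scale)
    then show ?thesis using scale_le[OF x, of 0] N0[of "0 *\<^sub>C x"] True by simp
  next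
    case False
    have cx: "c *\<^sub>C x \<in> V" using V x by (rule complex_vector.subspace_scale)
    have "N x = N (inverse c *\<^sub>C c *\<^sub>C x)" using False by (simp add: scaleC_one)
    also have "\<dots> \<le> cmod (inverse c) * N (c *\<^sub>C x)" by (rule scale_le[OF cx])
    also have "\<dots> = N (c *\<^sub>C x) / cmod c" by (simp add: norm_inverse divide_inverse)
    finally have "cmod c * N x \<le> N (c *\<^sub>C x)" using False by (simp add: pos_le_divide_eq mult.commute)
    then show ?thesis using scale_le[OF x, of c] by simp
  qed
  moreover have "N (x + y) \<le> N x + N y" if xy: "x \<in> V" "y \<in> V" for x y
    unfolding N_def[of "x + y"]
  proof (rule sup_over_least)
    show "0 \<le> N x + N y" using N0 xy by simp
    show "p i (x + y) \<le> N x + N y" if "i \<in> I" for i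
      using triangle[OF that xy] N_upper[OF that xy(1)] N_upper[OF that xy(2)] by linarith
  qed
  ultimately show ?thesis
    unfolding seminormed_def using V N0 by (simp add: N_def)
qed

lemma seminormed_linf: "seminormed (linf d)"
  unfolding linf_def
proof (rule seminormed_sup_over)
  show "complex_vector.subspace {v :: nat \<Rightarrow> complex. \<forall>i\<ge>d. v i = 0}"
    by (simp add: complex_vector.subspace_def scaleC_fun_def scaleC_complex_def)
qed (auto simp: scaleC_fun_def scaleC_complex_def norm_mult norm_triangle_ineq)

lemma linf_coord_le: "j < d \<Longrightarrow> cmod (v j) \<le> nrm (linf d) v"
  unfolding linf_def nspace.simps by (rule sup_over_upper[where g = "\<lambda>i. cmod (v i)"]) auto

lemma linf_nrm_le: "0 \<le> B \<Longrightarrow> (\<And>j. j < d \<Longrightarrow> cmod (v j) \<le> B) \<Longrightarrow> nrm (linf d) v \<le> B"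
  unfolding linf_def nspace.simps by (rule sup_over_least) auto

lemma dual_ball_bound: "\<sigma> \<in> dual_ball E \<Longrightarrow> x \<in> carrier E \<Longrightarrow> cmod (\<sigma> x) \<le> nrm E x"
  by (simp add: dual_ball_def)

lemma dual_ball_add:
  "\<sigma> \<in> dual_ball E \<Longrightarrow> x \<in> carrier E \<Longrightarrow> y \<in> carrier E \<Longrightarrow> \<sigma> (x + y) = \<sigma> x + \<sigma> y"
  by (simp add: dual_ball_def linear_between_def)

lemma dual_ball_scale: "\<sigma> \<in> dual_ball E \<Longrightarrow> x \<in> carrier E \<Longrightarrow> \<sigma> (c *\<^sub>C x) = c * \<sigma> x"
  by (simp add: dual_ball_def linear_between_def scaleC_complex_def)

lemma zero_in_dual_ball: "seminormed E \<Longrightarrow> (\<lambda>_. 0) \<in> dual_ball E"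
  by (simp add: dual_ball_def linear_between_def nrm_nonneg scaleC_complex_def)

lemma dual_ball_diff:
  assumes "seminormed E" "\<sigma> \<in> dual_ball E" "x \<in> carrier E" "y \<in> carrier E"
  shows "\<sigma> (x - y) = \<sigma> x - \<sigma> y"
proof -
  have "\<sigma> ((x - y) + y) = \<sigma> (x - y) + \<sigma> y"
    by (rule dual_ball_add[OF assms(2)]) (use assms carrier_closed in auto)
  then show ?thesis by simp
qed

lemma dual_ball_sum:
  assumes E: "seminormed E" and \<sigma>: "\<sigma> \<in> dual_ball E"
    and "finite I" "\<And>i. i \<in> I \<Longrightarrow> e i \<in> carrier E"
  shows "\<sigma> (\<Sum>i\<in>I. c i *\<^sub>C e i) = (\<Sum>i\<in>I. c i * \<sigma> (e i))"
  using assms(3,4)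
proof (induction I rule: finite_induct)
  case empty
  have "\<sigma> (0 *\<^sub>C 0) = 0 * \<sigma> 0" by (rule dual_ball_scale[OF \<sigma> carrier_closed(1)[OF E]])
  then show ?case by simp
next
  case (insert j I)
  then have "\<sigma> (c j *\<^sub>C e j + (\<Sum>i\<in>I. c i *\<^sub>C e i)) = \<sigma> (c j *\<^sub>C e j) + \<sigma> (\<Sum>i\<in>I. c i *\<^sub>C e i)"
    by (intro dual_ball_add[OF \<sigma>] carrier_sum[OF E] carrier_closed[OF E]) auto
  then show ?case using insert by (simp add: dual_ball_scale[OF \<sigma>])
qed

lemma dual_ball_norming:
  assumes E: "seminormed E" and x: "x \<in> carrier E"
  obtains \<tau> where "\<tau> \<in> dual_ball E" "cmod (\<tau> x) = nrm E x"
proof -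
  obtain \<tau> where \<tau>: "\<tau> \<in> dual_ball E"
    "\<And>i. i \<in> {()} \<Longrightarrow> cmod (\<tau> x - complex_of_real (nrm E x)) \<le> 0"
    by (rule helly_functional[OF E, of "{()}" "\<lambda>_. x" 0 "\<lambda>_. complex_of_real (nrm E x)"])
      (use x E in \<open>auto simp: norm_mult nrm_scale nrm_nonneg\<close>)
  then have "\<tau> x = complex_of_real (nrm E x)" by simp
  then show ?thesis using that \<tau>(1) nrm_nonneg[OF E x] by simp
qed

text \<open>
  Banach--Alaoglu. Compactness makes the norms in \<open>C_space (dual_ball E)\<close> genuine suprema of
  bounded functions and supplies finite nets in the dual ball.
\<close>

lemma compact_dual_ball: "compact (dual_ball E)"
proof -
  define V where "V = carrier E"
  define B where "B = (\<Pi>\<^sub>E x\<in>UNIV. cball (0::complex) (if x \<in> V then nrm E x else 0))"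
  define A where "A = (\<Inter>x\<in>V. \<Inter>y\<in>V. {f. f (x + y) = f x + (f y :: complex)})
    \<inter> (\<Inter>c. \<Inter>x\<in>V. {f. f (c *\<^sub>C x) = c * f x})"
  have "compactin (product_topology (\<lambda>_. euclidean) UNIV) B"
    unfolding B_def compactin_PiE by simp
  then have "compact B" by (simp add: euclidean_product_topology)
  moreover have "closed A"
    unfolding A_def
    by (intro closed_Int closed_INT ballI closed_Collect_eq continuous_intros)
      (auto intro!: continuous_intros)
  moreover have "dual_ball E = B \<inter> A"
    unfolding dual_ball_def linear_between_def B_def A_def V_def
    by (auto simp: PiE_iff scaleC_complex_def split: if_splits)
  ultimately show ?thesis by (simp add: compact_Int_closed)
qed

lemma dual_ball_finite_net:
  assumes "finite \<Omega>" "0 < \<eta>"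
  obtains F where "finite F" "F \<subseteq> dual_ball E"
    "\<And>\<sigma>. \<sigma> \<in> dual_ball E \<Longrightarrow> \<exists>\<rho>\<in>F. (\<Sum>x\<in>\<Omega>. cmod (\<sigma> x - \<rho> x)) < \<eta>"
proof -
  define U where "U \<rho> = {\<sigma>. (\<Sum>x\<in>\<Omega>. cmod (\<sigma> x - \<rho> x)) < \<eta>}" for \<rho> :: "'a \<Rightarrow> complex"
  have "open (U \<rho>)" for \<rho>
    unfolding U_def by (intro open_Collect_less continuous_intros) auto
  moreover have "dual_ball E \<subseteq> (\<Union>\<rho>\<in>dual_ball E. U \<rho>)" using assms(2) by (auto simp: U_def)
  ultimately obtain F where "F \<subseteq> dual_ball E" "finite F" "dual_ball E \<subseteq> (\<Union>\<rho>\<in>F. U \<rho>)"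
    using compactE_image[OF compact_dual_ball, of "dual_ball E" U E] by blast
  then show ?thesis by (intro that) (auto simp: U_def)
qed

text \<open>
  A contraction into \<open>\<ell>\<^sub>\<infinity>\<^sup>N\<close> that almost preserves norms on the span of \<open>\<Omega>\<close>, in the sense dual to Helly's
  criterion, is the first half of an approximate factorisation. Indeed each functional \<open>\<sigma>\<close> in the dual
  ball has an approximate extension \<open>\<tau> \<sigma>\<close> along it; a weak* continuous choice is obtained by
  averaging the extensions of a finite net with a partition of unity.
\<close>

lemma CA_if_almost_isometric:
  fixes E :: "'a::complex_vector nspace"
  assumes E: "seminormed E" and \<Omega>: "finite \<Omega>" "\<Omega> \<subseteq> carrier E" and \<delta>: "0 \<le> \<delta>" "\<delta> < \<delta>'"
    and N: "0 < N" and \<phi>: "contraction E (linf N) \<phi>"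
    and below: "\<And>c. nrm E (\<Sum>x\<in>\<Omega>. c x *\<^sub>C x)
      \<le> nrm (linf N) (\<Sum>x\<in>\<Omega>. c x *\<^sub>C \<phi> x) + \<delta> * (\<Sum>x\<in>\<Omega>. cmod (c x))"
  shows "\<exists>\<psi>. (\<phi>, \<psi>, N) \<in> CA E (C_space (dual_ball E)) (eval_map E) \<Omega> \<delta>'"
proof -
  define K where "K = dual_ball E"
  define \<eta> where "\<eta> = (\<delta>' - \<delta>) / 2"
  have \<eta>: "0 < \<eta>" using \<delta> by (simp add: \<eta>_def)
  have \<phi>c: "\<phi> x \<in> carrier (linf N)" if "x \<in> carrier E" for x
    using \<phi> that by (simp add: contraction_def linear_between_def)
  have "\<exists>\<tau>. \<tau> \<in> dual_ball (linf N) \<and> (\<forall>x\<in>\<Omega>. cmod (\<tau> (\<phi> x) - \<sigma> x) \<le> \<delta>)" if \<sigma>: "\<sigma> \<in> K" for \<sigma>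
  proof -
    have "cmod (\<Sum>x\<in>\<Omega>. c x * \<sigma> x)
        \<le> nrm (linf N) (\<Sum>x\<in>\<Omega>. c x *\<^sub>C \<phi> x) + \<delta> * (\<Sum>x\<in>\<Omega>. cmod (c x))" for c
    proof -
      have "(\<Sum>x\<in>\<Omega>. c x * \<sigma> x) = \<sigma> (\<Sum>x\<in>\<Omega>. c x *\<^sub>C x)"
        by (rule dual_ball_sum[OF E, symmetric]) (use \<sigma> \<Omega> in \<open>auto simp: K_def\<close>)
      also have "cmod \<dots> \<le> nrm E (\<Sum>x\<in>\<Omega>. c x *\<^sub>C x)"
        using \<sigma> \<Omega>(2) by (intro dual_ball_bound carrier_sum[OF E]) (auto simp: K_def)
      finally show ?thesis using below[of c] by linarith
    qed
    then obtain \<tau> where "\<tau> \<in> dual_ball (linf N)" "\<And>x. x \<in> \<Omega> \<Longrightarrow> cmod (\<tau> (\<phi> x) - \<sigma> x) \<le> \<delta>"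
      using helly_functional[OF seminormed_linf \<Omega>(1), of \<phi> N \<delta> \<sigma>] \<phi>c \<Omega>(2) \<delta>(1) by blast
    then show ?thesis by blast
  qed
  then obtain \<tau> where \<tau>: "\<And>\<sigma>. \<sigma> \<in> K \<Longrightarrow> \<tau> \<sigma> \<in> dual_ball (linf N)"
    "\<And>\<sigma> x. \<sigma> \<in> K \<Longrightarrow> x \<in> \<Omega> \<Longrightarrow> cmod (\<tau> \<sigma> (\<phi> x) - \<sigma> x) \<le> \<delta>" by metis
  obtain F where F: "finite F" "F \<subseteq> K"
    "\<And>\<sigma>. \<sigma> \<in> K \<Longrightarrow> \<exists>\<rho>\<in>F. (\<Sum>x\<in>\<Omega>. cmod (\<sigma> x - \<rho> x)) < \<eta>"
    using dual_ball_finite_net[OF \<Omega>(1) \<eta>, of E] unfolding K_def by blast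
  \<comment> \<open>An explicit partition of unity: a net point has positive weight only at functionals close to it.\<close>
  define w where "w \<rho> \<sigma> = max 0 (\<eta> - (\<Sum>x\<in>\<Omega>. cmod (\<sigma> x - \<rho> x)))" for \<rho> \<sigma>
  define W where "W \<sigma> = (\<Sum>\<rho>\<in>F. w \<rho> \<sigma>)" for \<sigma>
  define h where "h \<rho> \<sigma> = w \<rho> \<sigma> / W \<sigma>" for \<rho> \<sigma>
  have w0: "0 \<le> w \<rho> \<sigma>" for \<rho> \<sigma> by (simp add: w_def)
  have W: "0 < W \<sigma>" if \<sigma>: "\<sigma> \<in> K" for \<sigma>
  proof -
    obtain \<rho> where "\<rho> \<in> F" "0 < w \<rho> \<sigma>" using F(3)[OF \<sigma>] by (force simp: w_def)
    then show ?thesis unfolding W_def by (intro sum_pos2[OF F(1)]) (auto simp: w0)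
  qed
  have h0: "0 \<le> h \<rho> \<sigma>" if "\<sigma> \<in> K" for \<rho> \<sigma> using W[OF that] w0 by (simp add: h_def less_imp_le)
  have h1: "(\<Sum>\<rho>\<in>F. h \<rho> \<sigma>) = 1" if "\<sigma> \<in> K" for \<sigma>
    using W[OF that] by (simp add: h_def W_def flip: sum_divide_distrib)
  have w_cont: "continuous_on K (w \<rho>)" for \<rho>
    unfolding w_def
    by (intro continuous_intros continuous_on_subset[OF continuous_on_product_coordinates]) auto
  have "(\<Sum>\<rho>\<in>F. w \<rho> \<sigma>) \<noteq> 0" if "\<sigma> \<in> K" for \<sigma> using W[OF that] by (simp add: W_def)
  then have h_cont: "continuous_on K (h \<rho>)" for \<rho>
    unfolding h_def W_def by (intro continuous_intros w_cont) auto
  define \<psi> where "\<psi> v \<sigma> = (if \<sigma> \<in> K then \<Sum>\<rho>\<in>F. complex_of_real (h \<rho> \<sigma>) * \<tau> \<rho> v else 0)" for v \<sigma>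
  have avg: "cmod (\<Sum>\<rho>\<in>F. complex_of_real (h \<rho> \<sigma>) * g \<rho>) \<le> B"
    if "\<sigma> \<in> K" "\<And>\<rho>. \<rho> \<in> F \<Longrightarrow> h \<rho> \<sigma> \<noteq> 0 \<Longrightarrow> cmod (g \<rho>) \<le> B" for \<sigma> g B
  proof -
    have "cmod (\<Sum>\<rho>\<in>F. complex_of_real (h \<rho> \<sigma>) * g \<rho>) \<le> (\<Sum>\<rho>\<in>F. h \<rho> \<sigma> * cmod (g \<rho>))"
      by (rule order_trans[OF norm_sum]) (use h0[OF that(1)] in \<open>simp add: norm_mult\<close>)
    also have "\<dots> \<le> (\<Sum>\<rho>\<in>F. h \<rho> \<sigma> * B)"
    proof (rule sum_mono)
      fix \<rho> assume "\<rho> \<in> F"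
      then show "h \<rho> \<sigma> * cmod (g \<rho>) \<le> h \<rho> \<sigma> * B"
        using that(2)[of \<rho>] h0[OF that(1), of \<rho>] by (cases "h \<rho> \<sigma> = 0") (auto intro: mult_left_mono)
    qed
    also have "\<dots> = B" using h1[OF that(1)] by (simp flip: sum_distrib_right)
    finally show ?thesis .
  qed
  have \<psi>: "contraction (linf N) (C_space K) \<psi>"
    unfolding contraction_def linear_between_def
  proof (intro conjI ballI allI)
    fix v w :: "nat \<Rightarrow> complex" and c assume v: "v \<in> carrier (linf N)"
    have "continuous_on K (\<psi> v) \<longleftrightarrow> continuous_on K (\<lambda>\<sigma>. \<Sum>\<rho>\<in>F. complex_of_real (h \<rho> \<sigma>) * \<tau> \<rho> v)"
      by (rule continuous_on_cong) (auto simp: \<psi>_def)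
    then have "continuous_on K (\<psi> v)"
      using h_cont by (auto intro!: continuous_intros)
    then show "\<psi> v \<in> carrier (C_space K)" by (auto simp: C_space_def \<psi>_def)
    show "\<psi> (v + w) = \<psi> v + \<psi> w" if w: "w \<in> carrier (linf N)"
    proof
      fix \<sigma>
      have "\<tau> \<rho> (v + w) = \<tau> \<rho> v + \<tau> \<rho> w" if "\<rho> \<in> F" for \<rho>
        using dual_ball_add[OF \<tau>(1) v w] that F(2) by blast
      then show "\<psi> (v + w) \<sigma> = (\<psi> v + \<psi> w) \<sigma>"
        by (simp add: \<psi>_def distrib_left sum.distrib)
    qed
    show "\<psi> (c *\<^sub>C v) = c *\<^sub>C \<psi> v"
    proof
      fix \<sigma>
      have "\<tau> \<rho> (c *\<^sub>C v) = c * \<tau> \<rho> v" if "\<rho> \<in> F" for \<rho>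
        using dual_ball_scale[OF \<tau>(1) v] that F(2) by blast
      then show "\<psi> (c *\<^sub>C v) \<sigma> = (c *\<^sub>C \<psi> v) \<sigma>"
        by (simp add: \<psi>_def scaleC_fun_def scaleC_complex_def sum_distrib_left mult.left_commute)
    qed
    show "nrm (C_space K) (\<psi> v) \<le> nrm (linf N) v"
      unfolding C_space_def nspace.simps
    proof (rule sup_over_least)
      show "0 \<le> nrm (linf N) v" by (rule nrm_nonneg[OF seminormed_linf v])
      show "cmod (\<psi> v \<sigma>) \<le> nrm (linf N) v" if "\<sigma> \<in> K" for \<sigma>
        using that F(2) dual_ball_bound[OF \<tau>(1) v] by (auto simp: \<psi>_def intro!: avg)
    qed
  qed
  have "nrm (C_space K) (\<psi> (\<phi> x) - eval_map E x) < \<delta>'" if x: "x \<in> \<Omega>" for x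
  proof -
    have "nrm (C_space K) (\<psi> (\<phi> x) - eval_map E x) \<le> \<delta> + \<eta>"
      unfolding C_space_def nspace.simps
    proof (rule sup_over_least)
      show "0 \<le> \<delta> + \<eta>" using \<delta> \<eta> by simp
      fix \<sigma> assume \<sigma>: "\<sigma> \<in> K"
      have "(\<psi> (\<phi> x) - eval_map E x) \<sigma> = (\<Sum>\<rho>\<in>F. complex_of_real (h \<rho> \<sigma>) * (\<tau> \<rho> (\<phi> x) - \<sigma> x))"
      proof -
        have "(\<Sum>\<rho>\<in>F. complex_of_real (h \<rho> \<sigma>) * \<sigma> x) = \<sigma> x"
          using h1[OF \<sigma>] by (simp flip: sum_distrib_right of_real_sum)
        then show ?thesis
          using \<sigma> by (simp add: \<psi>_def eval_map_def right_diff_distrib sum_subtractf K_def)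
      qed
      also have "cmod \<dots> \<le> \<delta> + \<eta>"
      proof (rule avg[OF \<sigma>])
        fix \<rho> assume \<rho>: "\<rho> \<in> F" "h \<rho> \<sigma> \<noteq> 0"
        have "cmod (\<sigma> x - \<rho> x) \<le> (\<Sum>x\<in>\<Omega>. cmod (\<sigma> x - \<rho> x))"
          by (rule member_le_sum[OF x]) (use \<Omega> in auto)
        also have "\<dots> \<le> \<eta>" using \<rho>(2) by (auto simp: h_def w_def max_def split: if_splits)
        finally have "cmod (\<rho> x - \<sigma> x) \<le> \<eta>" by (simp add: norm_minus_commute)
        moreover have "cmod (\<tau> \<rho> (\<phi> x) - \<rho> x) \<le> \<delta>" using \<tau>(2)[of \<rho> x] \<rho>(1) F(2) x by blast
        ultimately show "cmod (\<tau> \<rho> (\<phi> x) - \<sigma> x) \<le> \<delta> + \<eta>"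
          using norm_triangle_ineq[of "\<tau> \<rho> (\<phi> x) - \<rho> x" "\<rho> x - \<sigma> x"] by simp
      qed
      finally show "cmod ((\<psi> (\<phi> x) - eval_map E x) \<sigma>) \<le> \<delta> + \<eta>" .
    qed
    also have "\<dots> < \<delta>'" using \<delta> by (simp add: \<eta>_def field_simps)
    finally show ?thesis .
  qed
  then show ?thesis unfolding CA_def using N \<phi> \<psi> unfolding K_def by blast
qed

text \<open>
  Approximate attainment of the norm suffices for covering arguments, and it is what a norm defined
  as a supremum over the base space provides.
\<close>

definition norming :: "'a::complex_vector nspace \<Rightarrow> ('a \<Rightarrow> complex) set \<Rightarrow> bool" where
  "norming E S \<longleftrightarrow> S \<subseteq> dual_ball E \<and>
     (\<forall>x\<in>carrier E. \<forall>\<eta>>0. \<exists>\<tau>\<in>S. nrm E x \<le> cmod (\<tau> x) + \<eta>)"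

lemma norming_dual_ball: "seminormed E \<Longrightarrow> norming E (dual_ball E)"
  unfolding norming_def by (metis dual_ball_norming less_add_same_cancel1 less_imp_le order_refl)

text \<open>
  Covering a norming set is enough: the elements of \<open>F\<close> are the coordinates of a contraction into \<open>\<ell>\<^sub>\<infinity>\<close>, and for
  \<open>y = \<Sum>c\<^sub>x x\<close> a functional of \<open>S\<close> that nearly attains the norm differs at \<open>y\<close> by at most
  \<open>\<delta> \<Sum>|c\<^sub>x|\<close> from one of these coordinates.
\<close>

lemma CA_of_norming_cover:
  assumes E: "seminormed E" and \<Omega>: "finite \<Omega>" "\<Omega> \<subseteq> carrier E" and \<delta>: "0 \<le> \<delta>" "\<delta> < \<delta>'"
    and S: "norming E S" and F: "finite F" "F \<subseteq> dual_ball E"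
    and cover: "\<And>\<sigma>. \<sigma> \<in> S \<Longrightarrow> \<exists>\<rho>\<in>F. \<forall>x\<in>\<Omega>. cmod (\<sigma> x - \<rho> x) \<le> \<delta>"
  shows "\<exists>\<phi> \<psi>. (\<phi>, \<psi>, card F) \<in> CA E (C_space (dual_ball E)) (eval_map E) \<Omega> \<delta>'"
proof -
  define N where "N = card F"
  obtain r where r: "bij_betw r {..<N} F"
    using ex_bij_betw_nat_finite[OF F(1)] by (auto simp: N_def atLeast0LessThan)
  have rF: "r j \<in> dual_ball E" if "j < N" for j
    using bij_betwE[OF r] that F(2) by blast
  obtain \<sigma>0 where "\<sigma>0 \<in> S"
    using S carrier_closed(1)[OF E] unfolding norming_def by (meson zero_less_one)
  then have "F \<noteq> {}" using cover by blast
  then have N: "0 < N" using F(1) by (simp add: N_def card_gt_0_iff)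
  define \<phi> where "\<phi> x = (\<lambda>j. if j < N then r j x else 0)" for x
  have \<phi>: "contraction E (linf N) \<phi>"
    unfolding contraction_def linear_between_def
  proof (intro conjI ballI allI)
    fix x y c assume x: "x \<in> carrier E"
    show "\<phi> x \<in> carrier (linf N)" by (simp add: \<phi>_def linf_def)
    show "\<phi> (x + y) = \<phi> x + \<phi> y" if "y \<in> carrier E"
      using x that by (auto simp: \<phi>_def fun_eq_iff dual_ball_add[OF rF])
    show "\<phi> (c *\<^sub>C x) = c *\<^sub>C \<phi> x"
      using x by (auto simp: \<phi>_def fun_eq_iff scaleC_fun_def scaleC_complex_def dual_ball_scale[OF rF])
    show "nrm (linf N) (\<phi> x) \<le> nrm E x"
      by (rule linf_nrm_le) (use x nrm_nonneg[OF E] dual_ball_bound[OF rF] in \<open>auto simp: \<phi>_def\<close>)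
  qed
  have "nrm E (\<Sum>x\<in>\<Omega>. c x *\<^sub>C x)
      \<le> nrm (linf N) (\<Sum>x\<in>\<Omega>. c x *\<^sub>C \<phi> x) + \<delta> * (\<Sum>x\<in>\<Omega>. cmod (c x))" (is "nrm E ?y \<le> ?R") for c
  proof (rule field_le_epsilon)
    fix \<eta> :: real assume "0 < \<eta>"
    have y: "?y \<in> carrier E" using \<Omega>(2) by (intro carrier_sum[OF E]) auto
    obtain \<tau> where \<tau>: "\<tau> \<in> S" "nrm E ?y \<le> cmod (\<tau> ?y) + \<eta>"
      using S y \<open>0 < \<eta>\<close> unfolding norming_def by blast
    obtain \<rho> where \<rho>: "\<rho> \<in> F" "\<forall>x\<in>\<Omega>. cmod (\<tau> x - \<rho> x) \<le> \<delta>" using cover[OF \<tau>(1)] by blast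
    obtain j where j: "j < N" "r j = \<rho>" using r \<rho>(1) unfolding bij_betw_def by blast
    have \<tau>': "\<tau> \<in> dual_ball E" using \<tau>(1) S by (auto simp: norming_def)
    have \<rho>': "\<rho> \<in> dual_ball E" using \<rho>(1) F(2) by blast
    have sum_id: "\<sigma> ?y = (\<Sum>x\<in>\<Omega>. c x * \<sigma> x)" if "\<sigma> \<in> dual_ball E" for \<sigma>
      using dual_ball_sum[OF E that \<Omega>(1), of "\<lambda>x. x" c] \<Omega>(2) by auto
    have "cmod (\<tau> ?y - \<rho> ?y) = cmod (\<Sum>x\<in>\<Omega>. c x * (\<tau> x - \<rho> x))"
      by (simp add: sum_id \<tau>' \<rho>' right_diff_distrib sum_subtractf)
    also have "\<dots> \<le> (\<Sum>x\<in>\<Omega>. cmod (c x) * \<delta>)"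
      by (rule order_trans[OF norm_sum]) (use \<rho>(2) in \<open>auto simp: norm_mult intro!: sum_mono mult_left_mono\<close>)
    also have "\<dots> = \<delta> * (\<Sum>x\<in>\<Omega>. cmod (c x))" by (simp add: mult.commute flip: sum_distrib_left)
    finally have 1: "cmod (\<tau> ?y - \<rho> ?y) \<le> \<delta> * (\<Sum>x\<in>\<Omega>. cmod (c x))" .
    have "(\<Sum>x\<in>\<Omega>. c x *\<^sub>C \<phi> x) j = \<rho> ?y"
    proof -
      have "(\<Sum>x\<in>\<Omega>. c x *\<^sub>C \<phi> x) j = (\<Sum>x\<in>\<Omega>. (c x *\<^sub>C \<phi> x) j)"
        using \<Omega>(1) by (induction \<Omega> rule: finite_induct) auto
      then show ?thesis using j \<rho>' by (simp add: sum_id scaleC_fun_def scaleC_complex_def \<phi>_def)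
    qed
    then have 2: "cmod (\<rho> ?y) \<le> nrm (linf N) (\<Sum>x\<in>\<Omega>. c x *\<^sub>C \<phi> x)"
      using linf_coord_le[OF j(1)] by metis
    show "nrm E ?y \<le> ?R + \<eta>"
      using 1 2 \<tau>(2) norm_triangle_ineq[of "\<tau> ?y - \<rho> ?y" "\<rho> ?y"] by simp
  qed
  from CA_if_almost_isometric[OF E \<Omega> \<delta> N \<phi> this] show ?thesis unfolding N_def by blast
qed

lemma rc_attained:
  assumes E: "seminormed E" and \<Omega>: "finite \<Omega>" "\<Omega> \<subseteq> carrier E" and \<delta>: "0 < \<delta>"
  shows "\<exists>\<phi> \<psi>. (\<phi>, \<psi>, rc E \<Omega> \<delta>) \<in> CA E (C_space (dual_ball E)) (eval_map E) \<Omega> \<delta>"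
proof -
  obtain F where F: "finite F" "F \<subseteq> dual_ball E"
    "\<And>\<sigma>. \<sigma> \<in> dual_ball E \<Longrightarrow> \<exists>\<rho>\<in>F. (\<Sum>x\<in>\<Omega>. cmod (\<sigma> x - \<rho> x)) < \<delta> / 2"
    using dual_ball_finite_net[OF \<Omega>(1), of "\<delta> / 2" E] \<delta> by auto
  have "\<exists>\<rho>\<in>F. \<forall>x\<in>\<Omega>. cmod (\<sigma> x - \<rho> x) \<le> \<delta> / 2" if \<sigma>: "\<sigma> \<in> dual_ball E" for \<sigma>
  proof -
    obtain \<rho> where \<rho>: "\<rho> \<in> F" "(\<Sum>x\<in>\<Omega>. cmod (\<sigma> x - \<rho> x)) < \<delta> / 2" using F(3)[OF \<sigma>] by blast
    have "cmod (\<sigma> x - \<rho> x) \<le> (\<Sum>x\<in>\<Omega>. cmod (\<sigma> x - \<rho> x))" if "x \<in> \<Omega>" for x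
      by (rule member_le_sum[OF that]) (use \<Omega> in auto)
    then show ?thesis using \<rho> by (intro bexI[of _ \<rho>]) force+
  qed
  then have "\<exists>\<phi> \<psi>. (\<phi>, \<psi>, card F) \<in> CA E (C_space (dual_ball E)) (eval_map E) \<Omega> \<delta>"
    by (intro CA_of_norming_cover[OF E \<Omega> _ _ norming_dual_ball[OF E] F(1,2), where \<delta> = "\<delta> / 2"])
      (use \<delta> in auto)
  then have "{d. \<exists>\<phi> \<psi>. (\<phi>, \<psi>, d) \<in> CA E (C_space (dual_ball E)) (eval_map E) \<Omega> \<delta>} \<noteq> {}" by blast
  from Inf_nat_def1[OF this] show ?thesis unfolding rc_def by blast
qed

lemma rc_le: "(\<phi>, \<psi>, d) \<in> CA E (C_space (dual_ball E)) (eval_map E) \<Omega> \<delta> \<Longrightarrow> rc E \<Omega> \<delta> \<le> d"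
  unfolding rc_def by (rule cInf_lower) auto

text \<open>
  Evaluating \<open>\<psi>\<close> at \<open>\<sigma>\<close> gives a functional on \<open>\<ell>\<^sub>\<infinity>\<^sup>d\<close>, i.e. coefficients of absolute sum at most one;
  so on \<open>\<Omega>\<close> the whole dual ball lies near the absolutely convex hull of the \<open>d\<close> coordinates of \<open>\<phi>\<close>.
\<close>

lemma CA_imp_hull:
  assumes E: "seminormed E" and \<Omega>: "\<Omega> \<subseteq> carrier E"
    and CA: "(\<phi>, \<psi>, d) \<in> CA E (C_space (dual_ball E)) (eval_map E) \<Omega> \<delta>"
    and \<sigma>: "\<sigma> \<in> dual_ball E"
  obtains a where "(\<Sum>j<d. cmod (a j)) \<le> 1"
    "\<And>x. x \<in> \<Omega> \<Longrightarrow> cmod (\<sigma> x - (\<Sum>j<d. a j * \<phi> x j)) \<le> \<delta>"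
proof -
  define K where "K = dual_ball E"
  have \<phi>: "\<phi> x \<in> carrier (linf d)" if "x \<in> carrier E" for x
    using CA that by (auto simp: CA_def contraction_def linear_between_def)
  have \<psi>: "contraction (linf d) (C_space K) \<psi>" using CA by (auto simp: CA_def K_def)
  have bdd: "bdd_above ((\<lambda>\<rho>. cmod (f \<rho>)) ` K)" if "f \<in> carrier (C_space K)" for f
  proof -
    have "compact ((\<lambda>\<rho>. cmod (f \<rho>)) ` K)"
      using that compact_dual_ball unfolding K_def C_space_def
      by (intro compact_continuous_image continuous_intros) auto
    then show ?thesis by (intro bounded_imp_bdd_above compact_imp_bounded)
  qed
  have \<psi>c: "\<psi> v \<in> carrier (C_space K)" if "v \<in> carrier (linf d)" for v
    using \<psi> that by (auto simp: contraction_def linear_between_def)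
  define \<tau> where "\<tau> v = (if v \<in> carrier (linf d) then \<psi> v \<sigma> else 0)" for v
  have \<tau>: "\<tau> \<in> dual_ball (linf d)"
    unfolding dual_ball_def linear_between_def mem_Collect_eq
  proof (intro conjI ballI allI impI)
    fix v w c assume v: "v \<in> carrier (linf d)"
    show "\<tau> v \<in> UNIV" by simp
    show "\<tau> (v + w) = \<tau> v + \<tau> w" if "w \<in> carrier (linf d)"
      using \<psi> v that carrier_closed(2)[OF seminormed_linf v that]
      by (simp add: \<tau>_def contraction_def linear_between_def)
    show "\<tau> (c *\<^sub>C v) = c *\<^sub>C \<tau> v"
      using \<psi> v carrier_closed(5)[OF seminormed_linf v]
      by (simp add: \<tau>_def contraction_def linear_between_def scaleC_fun_def)
    have "cmod (\<psi> v \<sigma>) \<le> nrm (C_space K) (\<psi> v)"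
      using sup_over_upper[OF bdd[OF \<psi>c[OF v]], of \<sigma>] \<sigma> by (simp add: C_space_def K_def)
    then show "cmod (\<tau> v) \<le> nrm (linf d) v" using \<psi> v by (force simp: \<tau>_def contraction_def)
  qed (simp add: \<tau>_def)
  define e where "e j = (\<lambda>i. if i = j then 1 else (0::complex))" for j :: nat
  have e: "e j \<in> carrier (linf d)" if "j < d" for j
    using that by (auto simp: e_def linf_def)
  have rep_at: "(\<Sum>j<d. c j *\<^sub>C e j) i = (if i < d then c i else 0)" for c i
  proof -
    have "(\<Sum>j<m. c j *\<^sub>C e j) i = (if i < m then c i else 0)" for m
      by (induction m) (auto simp: scaleC_fun_def scaleC_complex_def e_def less_Suc_eq)
    then show ?thesis .
  qed
  have \<tau>_rep: "\<tau> (\<Sum>j<d. c j *\<^sub>C e j) = (\<Sum>j<d. c j * \<tau> (e j))" for c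
    by (rule dual_ball_sum[OF seminormed_linf \<tau>]) (use e in auto)
  show ?thesis
  proof (rule that[of "\<lambda>j. \<tau> (e j)"])
    obtain c where c: "\<And>j. cmod (c j) = 1" "\<And>j. c j * \<tau> (e j) = complex_of_real (cmod (\<tau> (e j)))"
      using choice[of "\<lambda>j c. cmod c = 1 \<and> c * \<tau> (e j) = complex_of_real (cmod (\<tau> (e j)))"] ex_phase
      by blast
    have "(\<Sum>j<d. cmod (\<tau> (e j))) = cmod (\<tau> (\<Sum>j<d. c j *\<^sub>C e j))"
      unfolding \<tau>_rep c(2) by (simp add: sum_nonneg flip: of_real_sum)
    also have "\<dots> \<le> nrm (linf d) (\<Sum>j<d. c j *\<^sub>C e j)"
      by (intro dual_ball_bound[OF \<tau>] carrier_sum[OF seminormed_linf]) (use e in auto)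
    also have "\<dots> \<le> 1" by (rule linf_nrm_le) (auto simp: rep_at c(1))
    finally show "(\<Sum>j<d. cmod (\<tau> (e j))) \<le> 1" .
    fix x assume x: "x \<in> \<Omega>"
    have xE: "x \<in> carrier E" using x \<Omega> by blast
    have "\<phi> x = (\<Sum>j<d. \<phi> x j *\<^sub>C e j)"
      using \<phi>[OF xE] by (auto simp: fun_eq_iff rep_at linf_def)
    then have "\<psi> (\<phi> x) \<sigma> = (\<Sum>j<d. \<phi> x j * \<tau> (e j))"
      using \<tau>_rep[of "\<phi> x"] \<phi>[OF xE] by (simp add: \<tau>_def)
    moreover have "cmod ((\<psi> (\<phi> x) - eval_map E x) \<sigma>) \<le> nrm (C_space K) (\<psi> (\<phi> x) - eval_map E x)"
      unfolding C_space_def nspace.simps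
    proof (rule sup_over_upper)
      obtain B where B: "\<And>\<rho>. \<rho> \<in> K \<Longrightarrow> cmod (\<psi> (\<phi> x) \<rho>) \<le> B"
        using bdd[OF \<psi>c[OF \<phi>[OF xE]]] by (auto simp: bdd_above_def)
      show "bdd_above ((\<lambda>\<rho>. cmod ((\<psi> (\<phi> x) - eval_map E x) \<rho>)) ` K)"
      proof (rule bdd_aboveI2)
        fix \<rho> assume \<rho>: "\<rho> \<in> K"
        have "cmod (\<rho> x) \<le> nrm E x" using dual_ball_bound \<rho> xE unfolding K_def by blast
        then show "cmod ((\<psi> (\<phi> x) - eval_map E x) \<rho>) \<le> B + nrm E x"
          using \<rho> B[OF \<rho>] norm_triangle_ineq4[of "\<psi> (\<phi> x) \<rho>" "\<rho> x"]
          by (simp add: eval_map_def K_def)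
      qed
      show "\<sigma> \<in> K" using \<sigma> by (simp add: K_def)
    qed
    moreover have "nrm (C_space K) (\<psi> (\<phi> x) - eval_map E x) < \<delta>"
      using CA x by (auto simp: CA_def K_def)
    ultimately show "cmod (\<sigma> x - (\<Sum>j<d. \<tau> (e j) * \<phi> x j)) \<le> \<delta>"
      using \<sigma> by (simp add: eval_map_def mult.commute norm_minus_commute)
  qed
qed

section \<open>Zero CA entropy as zero entropy of orbits of functionals\<close>

lemma isometric_automorphism_iterate:
  assumes "isometric_automorphism E \<alpha>" "x \<in> carrier E"
  shows "(\<alpha> ^^ i) x \<in> carrier E" "nrm E ((\<alpha> ^^ i) x) = nrm E x"
proof -
  have "(\<alpha> ^^ i) x \<in> carrier E \<and> nrm E ((\<alpha> ^^ i) x) = nrm E x"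
    by (induction i) (use assms in \<open>auto simp: isometric_automorphism_def linear_between_def\<close>)
  then show "(\<alpha> ^^ i) x \<in> carrier E" "nrm E ((\<alpha> ^^ i) x) = nrm E x" by auto
qed

text \<open>
  Since \<open>rc\<close> is always attained and hence at least one, all growth rates are nonnegative, and \<open>hc\<close>
  vanishes as soon as none of them is positive.
\<close>

lemma hc_eq_0_iff:
  assumes E: "seminormed E" and \<alpha>: "isometric_automorphism E \<alpha>"
  shows "hc E \<alpha> = 0 \<longleftrightarrow> (\<forall>\<Omega>. finite \<Omega> \<and> \<Omega> \<subseteq> carrier E \<longrightarrow> (\<forall>\<delta>>0. \<forall>\<epsilon>>0.
    \<forall>\<^sub>F n in sequentially. real (rc E (\<Union>i<n. (\<alpha> ^^ i) ` \<Omega>) \<delta>) \<le> exp (\<epsilon> * real n)))"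
proof -
  define r where "r \<Omega> \<delta> n = real (rc E (\<Union>i<n. (\<alpha> ^^ i) ` \<Omega>) \<delta>)" for \<Omega> \<delta> n
  define adm where "adm \<Omega> \<longleftrightarrow> finite \<Omega> \<and> \<Omega> \<subseteq> carrier E" for \<Omega>
  have r1: "1 \<le> r \<Omega> \<delta> n" if "adm \<Omega>" "0 < \<delta>" for \<Omega> \<delta> n
  proof -
    have "\<exists>\<phi> \<psi>. (\<phi>, \<psi>, rc E (\<Union>i<n. (\<alpha> ^^ i) ` \<Omega>) \<delta>)
      \<in> CA E (C_space (dual_ball E)) (eval_map E) (\<Union>i<n. (\<alpha> ^^ i) ` \<Omega>) \<delta>"
      by (rule rc_attained[OF E])
        (use that isometric_automorphism_iterate(1)[OF \<alpha>] in \<open>auto simp: adm_def\<close>)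
    then show ?thesis by (auto simp: CA_def r_def)
  qed
  have at: "hc_at E \<alpha> \<Omega> \<delta> = limsup (\<lambda>n. ereal (1 / real n * ln (r \<Omega> \<delta> n)))" for \<Omega> \<delta>
    by (simp add: hc_at_def r_def)
  have at0: "0 \<le> hc_at E \<alpha> \<Omega> \<delta>" if "adm \<Omega>" "0 < \<delta>" for \<Omega> \<delta>
    unfolding at by (rule le_Limsup) (use r1[OF that] in \<open>auto intro!: always_eventually\<close>)
  have growth: "hc_at E \<alpha> \<Omega> \<delta> \<le> 0 \<longleftrightarrow>
      (\<forall>\<epsilon>>0. \<forall>\<^sub>F n in sequentially. r \<Omega> \<delta> n \<le> exp (\<epsilon> * real n))"
    if \<Omega>: "adm \<Omega>" and \<delta>: "0 < \<delta>" for \<Omega> \<delta>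
  proof
    assume le: "hc_at E \<alpha> \<Omega> \<delta> \<le> 0"
    show "\<forall>\<epsilon>>0. \<forall>\<^sub>F n in sequentially. r \<Omega> \<delta> n \<le> exp (\<epsilon> * real n)"
    proof (intro allI impI)
      fix \<epsilon> :: real assume "0 < \<epsilon>"
      then have "hc_at E \<alpha> \<Omega> \<delta> < ereal \<epsilon>" using le by (simp add: le_less_trans)
      then have "\<forall>\<^sub>F n in sequentially. ereal (1 / real n * ln (r \<Omega> \<delta> n)) < ereal \<epsilon>"
        unfolding at by (rule Limsup_lessD)
      then show "\<forall>\<^sub>F n in sequentially. r \<Omega> \<delta> n \<le> exp (\<epsilon> * real n)"
        using eventually_gt_at_top[of 0]
      proof eventually_elim
        case (elim n)
        then have "ln (r \<Omega> \<delta> n) \<le> \<epsilon> * real n" by (simp add: field_simps)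
        then have "exp (ln (r \<Omega> \<delta> n)) \<le> exp (\<epsilon> * real n)" by simp
        then show ?case using r1[OF \<Omega> \<delta>, of n] by simp
      qed
    qed
  next
    assume ev: "\<forall>\<epsilon>>0. \<forall>\<^sub>F n in sequentially. r \<Omega> \<delta> n \<le> exp (\<epsilon> * real n)"
    show "hc_at E \<alpha> \<Omega> \<delta> \<le> 0"
    proof (rule ereal_le_epsilon2)
      fix \<epsilon> :: real assume "0 < \<epsilon>"
      then have "\<forall>\<^sub>F n in sequentially. r \<Omega> \<delta> n \<le> exp (\<epsilon> * real n)" using ev by blast
      then have "\<forall>\<^sub>F n in sequentially. ereal (1 / real n * ln (r \<Omega> \<delta> n)) \<le> ereal \<epsilon>"
        using eventually_gt_at_top[of 0]
      proof eventually_elim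
        case (elim n)
        have "ln (r \<Omega> \<delta> n) \<le> ln (exp (\<epsilon> * real n))"
          using elim(1) r1[OF \<Omega> \<delta>, of n] by (subst ln_le_cancel_iff) auto
        then have "ln (r \<Omega> \<delta> n) \<le> \<epsilon> * real n" by simp
        then show ?case using elim(2) by (simp add: field_simps)
      qed
      then show "hc_at E \<alpha> \<Omega> \<delta> \<le> 0 + ereal \<epsilon>" unfolding at by (simp add: Limsup_bounded)
    qed
  qed
  have "hc E \<alpha> = 0 \<longleftrightarrow> (\<forall>\<Omega>. adm \<Omega> \<longrightarrow> (\<forall>\<delta>>0. hc_at E \<alpha> \<Omega> \<delta> \<le> 0))"
  proof
    assume "hc E \<alpha> = 0"
    moreover have "hc_at E \<alpha> \<Omega> \<delta> \<le> hc E \<alpha>" if "adm \<Omega>" "0 < \<delta>" for \<Omega> \<delta>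
      unfolding hc_def hc_on_def
      by (rule SUP_upper2[of \<Omega>], use that in \<open>simp add: adm_def\<close>, rule SUP_upper) (use that in simp)
    ultimately show "\<forall>\<Omega>. adm \<Omega> \<longrightarrow> (\<forall>\<delta>>0. hc_at E \<alpha> \<Omega> \<delta> \<le> 0)" by simp
  next
    assume le: "\<forall>\<Omega>. adm \<Omega> \<longrightarrow> (\<forall>\<delta>>0. hc_at E \<alpha> \<Omega> \<delta> \<le> 0)"
    have "hc E \<alpha> \<le> 0"
      unfolding hc_def hc_on_def using le by (intro SUP_least) (auto simp: adm_def)
    moreover have "0 \<le> hc E \<alpha>"
    proof -
      have "adm {}" by (simp add: adm_def)
      then have "0 \<le> hc_at E \<alpha> {} 1" by (rule at0) simp
      also have "\<dots> \<le> hc_on E \<alpha> {}" unfolding hc_on_def by (rule SUP_upper) simp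
      also have "\<dots> \<le> hc E \<alpha>" unfolding hc_def by (rule SUP_upper) simp
      finally show ?thesis .
    qed
    ultimately show "hc E \<alpha> = 0" by (rule antisym)
  qed
  also have "\<dots> \<longleftrightarrow> (\<forall>\<Omega>. adm \<Omega> \<longrightarrow> (\<forall>\<delta>>0. \<forall>\<epsilon>>0.
      \<forall>\<^sub>F n in sequentially. r \<Omega> \<delta> n \<le> exp (\<epsilon> * real n)))"
    using growth by blast
  finally show ?thesis unfolding adm_def r_def .
qed

text \<open>
  Passing to sequences of scalars allows the section space and the unrelated fibres, whose elements and
  functionals live in different spaces, to be compared in one place.
\<close>

definition orbits :: "('a \<Rightarrow> complex) set \<Rightarrow> ('a \<Rightarrow> 'a) \<Rightarrow> 'a \<Rightarrow> (nat \<Rightarrow> complex) set" where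
  "orbits S \<alpha> x = (\<lambda>\<sigma> i. \<sigma> ((\<alpha> ^^ i) x)) ` S"

text \<open>
  Small contractive rank places the orbit sequences near the convex hull of few points, namely of the
  coordinates of \<open>\<phi>\<close> along the orbit.
\<close>

lemma zero_entropy_of_hc_eq_0:
  assumes E: "seminormed E" and \<alpha>: "isometric_automorphism E \<alpha>" and hc: "hc E \<alpha> = 0"
    and x: "x \<in> carrier E"
  shows "zero_entropy (orbits (dual_ball E) \<alpha> x)"
proof (rule zero_entropy_of_small_hulls)
  note it = isometric_automorphism_iterate[OF \<alpha> x]
  show "0 \<le> nrm E x" by (rule nrm_nonneg[OF E x])
  show "cmod (t i) \<le> nrm E x" if "t \<in> orbits (dual_ball E) \<alpha> x" for t i
    using that dual_ball_bound[OF _ it(1)] by (force simp: orbits_def it(2))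
  fix \<delta> \<epsilon> :: real assume pos: "0 < \<delta>" "0 < \<epsilon>"
  define Q where "Q n = (\<Union>i<n. (\<alpha> ^^ i) ` {x})" for n
  have Q: "finite (Q n)" "Q n \<subseteq> carrier E" for n using it(1) by (auto simp: Q_def)
  have "\<forall>\<^sub>F n in sequentially. real (rc E (Q n) \<delta>) \<le> exp (\<epsilon> * real n)"
    using hc x pos unfolding hc_eq_0_iff[OF E \<alpha>] Q_def by blast
  then show "\<forall>\<^sub>F n in sequentially. \<exists>d \<phi>.
      0 < d \<and> real d \<le> exp (\<epsilon> * real n) \<and> (\<forall>j<d. \<forall>i<n. cmod (\<phi> j i) \<le> nrm E x) \<and>
      (\<forall>t\<in>orbits (dual_ball E) \<alpha> x. \<exists>a. (\<Sum>j<d. cmod (a j)) \<le> 1 \<and>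
        (\<forall>i<n. cmod (t i - (\<Sum>j<d. a j * \<phi> j i)) \<le> \<delta>))"
  proof (rule eventually_mono)
    fix n assume small: "real (rc E (Q n) \<delta>) \<le> exp (\<epsilon> * real n)"
    define d where "d = rc E (Q n) \<delta>"
    obtain \<phi> \<psi> where CA: "(\<phi>, \<psi>, d) \<in> CA E (C_space (dual_ball E)) (eval_map E) (Q n) \<delta>"
      using rc_attained[OF E Q pos(1)] unfolding d_def by blast
    have "cmod (\<phi> ((\<alpha> ^^ i) x) j) \<le> nrm E x" if "j < d" for i j
    proof -
      have "cmod (\<phi> ((\<alpha> ^^ i) x) j) \<le> nrm (linf d) (\<phi> ((\<alpha> ^^ i) x))" by (rule linf_coord_le[OF that])
      also have "\<dots> \<le> nrm E ((\<alpha> ^^ i) x)" using CA it(1) by (auto simp: CA_def contraction_def)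
      finally show ?thesis by (simp add: it(2))
    qed
    moreover have "\<exists>a. (\<Sum>j<d. cmod (a j)) \<le> 1 \<and>
        (\<forall>i<n. cmod (t i - (\<Sum>j<d. a j * \<phi> ((\<alpha> ^^ i) x) j)) \<le> \<delta>)"
      if t: "t \<in> orbits (dual_ball E) \<alpha> x" for t
    proof -
      obtain \<sigma> where \<sigma>: "\<sigma> \<in> dual_ball E" "t = (\<lambda>i. \<sigma> ((\<alpha> ^^ i) x))" using t by (auto simp: orbits_def)
      obtain a where a: "(\<Sum>j<d. cmod (a j)) \<le> 1"
          "\<And>y. y \<in> Q n \<Longrightarrow> cmod (\<sigma> y - (\<Sum>j<d. a j * \<phi> y j)) \<le> \<delta>"
        by (rule CA_imp_hull[OF E Q(2) CA \<sigma>(1)]) (rule that)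
      have "(\<alpha> ^^ i) x \<in> Q n" if "i < n" for i using that by (auto simp: Q_def)
      then show ?thesis using a \<sigma>(2) by blast
    qed
    ultimately show "\<exists>d \<phi>. 0 < d \<and> real d \<le> exp (\<epsilon> * real n) \<and>
      (\<forall>j<d. \<forall>i<n. cmod (\<phi> j i) \<le> nrm E x) \<and>
      (\<forall>t\<in>orbits (dual_ball E) \<alpha> x. \<exists>a. (\<Sum>j<d. cmod (a j)) \<le> 1 \<and>
        (\<forall>i<n. cmod (t i - (\<Sum>j<d. a j * \<phi> j i)) \<le> \<delta>))"
      using CA small
      by (intro exI[of _ d] exI[of _ "\<lambda>j i. \<phi> ((\<alpha> ^^ i) x) j"]) (auto simp: CA_def d_def)
  qed
qed

lemma eventually_le_exp:
  assumes "0 < \<epsilon>"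
  shows "\<forall>\<^sub>F n in sequentially. (A::real) \<le> exp (\<epsilon> * real n)"
proof -
  have "\<forall>\<^sub>F n in sequentially. A / \<epsilon> \<le> real n"
    using filterlim_real_sequentially unfolding filterlim_at_top by blast
  then show ?thesis
  proof (rule eventually_mono)
    fix n assume "A / \<epsilon> \<le> real n"
    then have "A \<le> \<epsilon> * real n" using assms by (simp add: field_simps)
    also have "\<dots> \<le> exp (\<epsilon> * real n)" using exp_ge_add_one_self[of "\<epsilon> * real n"] by linarith
    finally show "A \<le> exp (\<epsilon> * real n)" .
  qed
qed

text \<open>
  Coverings of the orbit sequences of the finitely many elements of \<open>\<Omega>\<close> combine to a covering of \<open>S\<close>
  on all of their orbits; its cardinality is a product of subexponential quantities. The approximants
  are replaced by members of \<open>S\<close>, at the price of doubling the distance.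
\<close>

lemma hc_eq_0_of_norming:
  assumes E: "seminormed E" and \<alpha>: "isometric_automorphism E \<alpha>" and S: "norming E S"
    and zero: "\<And>x. x \<in> carrier E \<Longrightarrow> zero_entropy (orbits S \<alpha> x)"
  shows "hc E \<alpha> = 0"
  unfolding hc_eq_0_iff[OF E \<alpha>]
proof (intro allI impI)
  fix \<Omega> :: "'a set" and \<delta> \<epsilon> :: real
  assume \<Omega>': "finite \<Omega> \<and> \<Omega> \<subseteq> carrier E" and pos: "0 < \<delta>" "0 < \<epsilon>"
  then have \<Omega>: "finite \<Omega>" "\<Omega> \<subseteq> carrier E" by auto
  define \<epsilon>' where "\<epsilon>' = \<epsilon> / (2 * (real (card \<Omega>) + 1))"
  have \<epsilon>': "0 < \<epsilon>'" "real (card \<Omega>) * \<epsilon>' \<le> \<epsilon> / 2"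
    using pos by (auto simp: \<epsilon>'_def field_simps)
  have "\<exists>A. 0 \<le> A \<and> (\<forall>\<^sub>F n in sequentially. covered (orbits S \<alpha> x) n (\<delta> / 8) (A * exp (\<epsilon>' * real n)))"
    if "x \<in> \<Omega>" for x
    using zero_entropyD[OF zero, of x "\<delta> / 8" \<epsilon>'] that \<Omega> pos \<epsilon>' by auto
  then obtain A where A: "\<And>x. x \<in> \<Omega> \<Longrightarrow> 0 \<le> A x" "\<And>x. x \<in> \<Omega> \<Longrightarrow>
      \<forall>\<^sub>F n in sequentially. covered (orbits S \<alpha> x) n (\<delta> / 8) (A x * exp (\<epsilon>' * real n))"
    by metis
  define B where "B = (\<Prod>x\<in>\<Omega>. A x)"
  have "\<forall>\<^sub>F n in sequentially. \<forall>x\<in>\<Omega>. covered (orbits S \<alpha> x) n (\<delta> / 8) (A x * exp (\<epsilon>' * real n))"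
    using A(2) by (intro eventually_ball_finite[OF \<Omega>(1)] ballI)
  moreover have "\<forall>\<^sub>F n in sequentially. B \<le> exp (\<epsilon> / 2 * real n)"
    using pos by (intro eventually_le_exp) simp
  ultimately show "\<forall>\<^sub>F n in sequentially. real (rc E (\<Union>i<n. (\<alpha> ^^ i) ` \<Omega>) \<delta>) \<le> exp (\<epsilon> * real n)"
  proof eventually_elim
    case (elim n)
    define Q where "Q = (\<Union>i<n. (\<alpha> ^^ i) ` \<Omega>)"
    have Q: "finite Q" "Q \<subseteq> carrier E"
      using \<Omega> isometric_automorphism_iterate(1)[OF \<alpha>] by (auto simp: Q_def)
    have "\<forall>x\<in>\<Omega>. \<exists>C. finite C \<and> real (card C) \<le> A x * exp (\<epsilon>' * real n) \<and>
        (\<forall>t\<in>orbits S \<alpha> x. \<exists>c\<in>C. \<forall>i<n. cmod (t i - c i) \<le> \<delta> / 8)"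
      using elim(1) unfolding covered_def .
    then obtain C where C: "\<And>x. x \<in> \<Omega> \<Longrightarrow> finite (C x)"
      "\<And>x. x \<in> \<Omega> \<Longrightarrow> real (card (C x)) \<le> A x * exp (\<epsilon>' * real n)"
      "\<And>x t. x \<in> \<Omega> \<Longrightarrow> t \<in> orbits S \<alpha> x \<Longrightarrow> \<exists>c\<in>C x. \<forall>i<n. cmod (t i - c i) \<le> \<delta> / 8"
      by metis
    define P where "P = PiE \<Omega> C"
    define near where "near f \<sigma> \<longleftrightarrow> (\<forall>x\<in>\<Omega>. \<forall>i<n. cmod (\<sigma> ((\<alpha> ^^ i) x) - f x i) \<le> \<delta> / 8)" for f \<sigma>
    define pick where "pick f = (SOME \<sigma>. \<sigma> \<in> S \<and> near f \<sigma>)" for f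
    define F where "F = pick ` {f \<in> P. \<exists>\<sigma>\<in>S. near f \<sigma>}"
    have pick: "pick f \<in> S \<and> near f (pick f)" if "\<exists>\<sigma>\<in>S. near f \<sigma>" for f
    proof -
      have "\<exists>\<sigma>. \<sigma> \<in> S \<and> near f \<sigma>" using that by blast
      then show ?thesis unfolding pick_def by (rule someI_ex)
    qed
    have P: "finite P" unfolding P_def using \<Omega>(1) C(1) by (rule finite_PiE)
    have "card F \<le> card {f \<in> P. \<exists>\<sigma>\<in>S. near f \<sigma>}" unfolding F_def using P by (intro card_image_le) auto
    also have "\<dots> \<le> card P" using P by (intro card_mono) auto
    finally have "real (card F) \<le> real (card P)" by simp
    also have "\<dots> = (\<Prod>x\<in>\<Omega>. real (card (C x)))" unfolding P_def using \<Omega>(1) by (simp add: card_PiE)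
    also have "\<dots> \<le> (\<Prod>x\<in>\<Omega>. A x * exp (\<epsilon>' * real n))" by (rule prod_mono) (use C(2) in auto)
    also have "\<dots> = B * exp (\<epsilon>' * real n) ^ card \<Omega>" by (simp add: prod.distrib B_def)
    also have "\<dots> = B * exp ((real (card \<Omega>) * \<epsilon>') * real n)"
      by (simp add: mult.assoc flip: exp_of_nat_mult)
    also have "\<dots> \<le> exp (\<epsilon> / 2 * real n) * exp (\<epsilon> / 2 * real n)"
    proof (rule mult_mono)
      show "exp ((real (card \<Omega>) * \<epsilon>') * real n) \<le> exp (\<epsilon> / 2 * real n)"
        unfolding exp_le_cancel_iff using \<epsilon>'(2) by (rule mult_right_mono) simp
    qed (use elim(2) in auto)
    also have "\<dots> = exp (\<epsilon> * real n)" by (simp add: algebra_simps flip: exp_add)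
    finally have cardF: "real (card F) \<le> exp (\<epsilon> * real n)" .
    have "\<exists>\<rho>\<in>F. \<forall>y\<in>Q. cmod (\<sigma> y - \<rho> y) \<le> \<delta> / 4" if \<sigma>: "\<sigma> \<in> S" for \<sigma>
    proof -
      have "\<exists>c. c \<in> C x \<and> (\<forall>i<n. cmod (\<sigma> ((\<alpha> ^^ i) x) - c i) \<le> \<delta> / 8)" if "x \<in> \<Omega>" for x
        using C(3)[OF that, of "\<lambda>i. \<sigma> ((\<alpha> ^^ i) x)"] \<sigma> by (auto simp: orbits_def)
      then obtain g where g: "\<And>x. x \<in> \<Omega> \<Longrightarrow> g x \<in> C x \<and> (\<forall>i<n. cmod (\<sigma> ((\<alpha> ^^ i) x) - g x i) \<le> \<delta> / 8)"
        by metis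
      define f where "f = restrict g \<Omega>"
      have f: "f \<in> P" "near f \<sigma>" using g by (auto simp: f_def P_def near_def)
      then have ex: "\<exists>\<sigma>\<in>S. near f \<sigma>" using \<sigma> by blast
      have "cmod (\<sigma> ((\<alpha> ^^ i) x) - pick f ((\<alpha> ^^ i) x)) \<le> \<delta> / 4" if "x \<in> \<Omega>" "i < n" for x i
      proof -
        have "cmod (\<sigma> ((\<alpha> ^^ i) x) - f x i) \<le> \<delta> / 8" "cmod (pick f ((\<alpha> ^^ i) x) - f x i) \<le> \<delta> / 8"
          using f(2) pick[OF ex] that by (auto simp: near_def)
        then show ?thesis
          using norm_triangle_ineq4[of "\<sigma> ((\<alpha> ^^ i) x) - f x i" "pick f ((\<alpha> ^^ i) x) - f x i"] by simp
      qed
      then have "\<forall>y\<in>Q. cmod (\<sigma> y - pick f y) \<le> \<delta> / 4" by (auto simp: Q_def)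
      moreover have "pick f \<in> F" using f(1) ex by (auto simp: F_def)
      ultimately show ?thesis by blast
    qed
    moreover have "finite F" "F \<subseteq> dual_ball E"
      using P pick S by (auto simp: F_def norming_def)
    ultimately have "\<exists>\<phi> \<psi>. (\<phi>, \<psi>, card F) \<in> CA E (C_space (dual_ball E)) (eval_map E) Q \<delta>"
      using pos by (intro CA_of_norming_cover[OF E Q _ _ S, where \<delta> = "\<delta> / 4"]) auto
    then have "rc E Q \<delta> \<le> card F" using rc_le by blast
    then show ?case using cardF unfolding Q_def by linarith
  qed
qed

section \<open>The space of sections vanishing at infinity\<close>

lemma seminormed_of_banach: "complex_banach E \<Longrightarrow> seminormed E"
  by (auto simp: complex_banach_def seminormed_def)

lemma sum_scaleC_apply:
  fixes y :: "'i \<Rightarrow> 'z \<Rightarrow> 'b::complex_vector"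
  assumes "finite I"
  shows "(\<Sum>i\<in>I. c i *\<^sub>C y i) z = (\<Sum>i\<in>I. c i *\<^sub>C y i z)"
  using assms by (induction I rule: finite_induct) (auto simp: scaleC_fun_def)

definition fibre_orbits ::
    "('z \<Rightarrow> 'b::complex_vector nspace) \<Rightarrow> ('z \<Rightarrow> 'b \<Rightarrow> 'b) \<Rightarrow> 'z set \<Rightarrow> ('z \<Rightarrow> 'b) \<Rightarrow> (nat \<Rightarrow> complex) set" where
  "fibre_orbits E \<beta> A x = (\<Union>z\<in>A. orbits (dual_ball (E z)) (\<beta> z) (x z))"

lemma orbits_dual_ball_shift:
  assumes E: "seminormed E" and \<beta>: "isometric_automorphism E \<beta>" and v: "v \<in> carrier E"
    and t: "t \<in> orbits (dual_ball E) \<beta> v"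
  shows "(\<lambda>i. t (Suc i)) \<in> orbits (dual_ball E) \<beta> v"
proof -
  obtain \<tau> where \<tau>: "\<tau> \<in> dual_ball E" "t = (\<lambda>i. \<tau> ((\<beta> ^^ i) v))" using t by (auto simp: orbits_def)
  define \<tau>' where "\<tau>' w = (if w \<in> carrier E then \<tau> (\<beta> w) else 0)" for w
  have lin: "\<beta> w \<in> carrier E" "nrm E (\<beta> w) = nrm E w" "\<beta> (c *\<^sub>C w) = c *\<^sub>C \<beta> w"
    if "w \<in> carrier E" for c w
    using \<beta> that by (auto simp: isometric_automorphism_def linear_between_def)
  have add: "\<beta> (w + w') = \<beta> w + \<beta> w'" if "w \<in> carrier E" "w' \<in> carrier E" for w w'
    using \<beta> that by (auto simp: isometric_automorphism_def linear_between_def)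
  have "\<tau>' \<in> dual_ball E"
    unfolding dual_ball_def linear_between_def
    using dual_ball_bound[OF \<tau>(1) lin(1)] carrier_closed[OF E]
    by (auto simp: \<tau>'_def lin add dual_ball_add[OF \<tau>(1)] dual_ball_scale[OF \<tau>(1)] scaleC_complex_def)
  moreover have "(\<lambda>i. t (Suc i)) = (\<lambda>i. \<tau>' ((\<beta> ^^ i) v))"
    using isometric_automorphism_iterate(1)[OF \<beta> v] by (simp add: \<tau>(2) \<tau>'_def)
  ultimately show ?thesis by (auto simp: orbits_def)
qed

context
  fixes Z :: "'z topology"
    and E :: "'z \<Rightarrow> 'b::complex_vector nspace"
    and \<Gamma> :: "('z \<Rightarrow> 'b) set"
  assumes field: "continuous_field Z E \<Gamma>"
begin

lemma fibre_seminormed: "z \<in> topspace Z \<Longrightarrow> seminormed (E z)"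
  using field by (auto simp: continuous_field_def intro: seminormed_of_banach)

lemma section_in_fibre: "x \<in> \<Gamma> \<Longrightarrow> z \<in> topspace Z \<Longrightarrow> x z \<in> carrier (E z)"
  using field by (auto simp: continuous_field_def vector_fields_def)

lemma section_outside: "x \<in> \<Gamma> \<Longrightarrow> z \<notin> topspace Z \<Longrightarrow> x z = 0"
  using field by (auto simp: continuous_field_def vector_fields_def)

lemma sections_subspace: "complex_vector.subspace \<Gamma>"
  using field by (simp add: continuous_field_def)

lemma section_norm_continuous: "x \<in> \<Gamma> \<Longrightarrow> continuous_map Z euclideanreal (\<lambda>z. nrm (E z) (x z))"
  using field by (simp add: continuous_field_def)

lemma sections_dense:
  "z \<in> topspace Z \<Longrightarrow> v \<in> carrier (E z) \<Longrightarrow> 0 < e \<Longrightarrow> \<exists>x\<in>\<Gamma>. nrm (E z) (x z - v) < e"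
  using field by (simp add: continuous_field_def)

lemma locally_approximable_is_section:
  assumes "x \<in> vector_fields Z E"
    and "\<And>z e. z \<in> topspace Z \<Longrightarrow> 0 < e \<Longrightarrow> \<exists>y\<in>\<Gamma>. \<exists>U. openin Z U \<and> z \<in> U \<and>
      (\<forall>w\<in>U. nrm (E w) (x w - y w) \<le> e)"
  shows "x \<in> \<Gamma>"
proof -
  have "\<forall>x\<in>vector_fields Z E. (\<forall>z\<in>topspace Z. \<forall>e>0. \<exists>y\<in>\<Gamma>. \<exists>U. openin Z U \<and> z \<in> U \<and>
      (\<forall>w\<in>U. nrm (E w) (x w - y w) \<le> e)) \<longrightarrow> x \<in> \<Gamma>"
    using field unfolding continuous_field_def by (elim conjE)
  from this[rule_format, OF assms(1)] show ?thesis using assms(2) by simp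
qed

lemma sum_sections: "(\<And>i. i \<in> I \<Longrightarrow> y i \<in> \<Gamma>) \<Longrightarrow> (\<Sum>i\<in>I. c i *\<^sub>C y i) \<in> \<Gamma>"
  by (rule complex_vector.subspace_sum[OF sections_subspace])
    (rule complex_vector.subspace_scale[OF sections_subspace])

lemma section_norm_nonneg: "x \<in> \<Gamma> \<Longrightarrow> z \<in> topspace Z \<Longrightarrow> 0 \<le> nrm (E z) (x z)"
  by (rule nrm_nonneg[OF fibre_seminormed section_in_fibre])

lemma C0_imp_section: "x \<in> carrier (C0_sections Z E \<Gamma>) \<Longrightarrow> x \<in> \<Gamma>"
  by (simp add: C0_sections_def)

lemma C0_vanishing:
  assumes "x \<in> carrier (C0_sections Z E \<Gamma>)" "0 < e"
  obtains K where "compactin Z K" "\<And>z. z \<in> topspace Z - K \<Longrightarrow> nrm (E z) (x z) < e"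
  using assms unfolding C0_sections_def by auto

lemma C0_subspace: "complex_vector.subspace (carrier (C0_sections Z E \<Gamma>))"
  unfolding complex_vector.subspace_def
proof (intro conjI ballI allI)
  note s = complex_vector.subspace_0[OF sections_subspace]
    complex_vector.subspace_add[OF sections_subspace]
    complex_vector.subspace_scale[OF sections_subspace]
  have "\<exists>K. compactin Z K \<and> (\<forall>z\<in>topspace Z - K. nrm (E z) ((0 :: 'z \<Rightarrow> 'b) z) < e)" if "0 < e" for e :: real
    by (rule exI[of _ "{}"]) (use that nrm_zero[OF fibre_seminormed] in auto)
  then show "0 \<in> carrier (C0_sections Z E \<Gamma>)" using s(1) by (simp add: C0_sections_def)
  fix x assume x: "x \<in> carrier (C0_sections Z E \<Gamma>)"
  note xs = C0_imp_section[OF x]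
  show "x + y \<in> carrier (C0_sections Z E \<Gamma>)" if y: "y \<in> carrier (C0_sections Z E \<Gamma>)" for y
  proof -
    note ys = C0_imp_section[OF y]
    have "\<exists>K. compactin Z K \<and> (\<forall>z\<in>topspace Z - K. nrm (E z) ((x + y) z) < e)" if "0 < e" for e :: real
    proof -
      obtain K L where K: "compactin Z K" "\<And>z. z \<in> topspace Z - K \<Longrightarrow> nrm (E z) (x z) < e / 2"
        and L: "compactin Z L" "\<And>z. z \<in> topspace Z - L \<Longrightarrow> nrm (E z) (y z) < e / 2"
        using C0_vanishing[OF x, of "e / 2"] C0_vanishing[OF y, of "e / 2"] \<open>0 < e\<close> by (metis half_gt_zero)
      have "nrm (E z) ((x + y) z) < e" if z: "z \<in> topspace Z - (K \<union> L)" for z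
      proof -
        have "nrm (E z) (x z + y z) \<le> nrm (E z) (x z) + nrm (E z) (y z)"
          using z by (intro nrm_triangle fibre_seminormed section_in_fibre xs ys) auto
        then show ?thesis using K(2)[of z] L(2)[of z] z by auto
      qed
      then show ?thesis using compactin_Un[OF K(1) L(1)] by blast
    qed
    then show ?thesis using s(2)[OF xs ys] by (simp add: C0_sections_def)
  qed
  show "c *\<^sub>C x \<in> carrier (C0_sections Z E \<Gamma>)" for c
  proof -
    have "\<exists>K. compactin Z K \<and> (\<forall>z\<in>topspace Z - K. nrm (E z) ((c *\<^sub>C x) z) < e)" if e: "0 < e" for e :: real
    proof -
      obtain K where K: "compactin Z K" "\<And>z. z \<in> topspace Z - K \<Longrightarrow> nrm (E z) (x z) < e / (cmod c + 1)"
        using C0_vanishing[OF x, of "e / (cmod c + 1)"] e by (auto simp: add_nonneg_pos)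
      have "nrm (E z) ((c *\<^sub>C x) z) < e" if z: "z \<in> topspace Z - K" for z
      proof -
        have "nrm (E z) ((c *\<^sub>C x) z) = cmod c * nrm (E z) (x z)"
          using nrm_scale[OF fibre_seminormed section_in_fibre[OF xs]] z by (simp add: scaleC_fun_def)
        also have "\<dots> \<le> (cmod c + 1) * nrm (E z) (x z)"
          using section_norm_nonneg[OF xs, of z] z by (intro mult_right_mono) auto
        also have "\<dots> < e"
          using K(2)[OF z] by (simp add: pos_less_divide_eq add_nonneg_pos mult.commute)
        finally show ?thesis .
      qed
      then show ?thesis using K(1) by blast
    qed
    then show ?thesis using s(3)[OF xs] by (simp add: C0_sections_def)
  qed
qed

lemma C0_bounded:
  assumes x: "x \<in> carrier (C0_sections Z E \<Gamma>)"
  shows "bdd_above ((\<lambda>z. nrm (E z) (x z)) ` topspace Z)"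
proof -
  obtain K where K: "compactin Z K" "\<And>z. z \<in> topspace Z - K \<Longrightarrow> nrm (E z) (x z) < 1"
    using C0_vanishing[OF x, of 1] by auto
  have "compactin euclideanreal ((\<lambda>z. nrm (E z) (x z)) ` K)"
    by (rule image_compactin[OF K(1) section_norm_continuous[OF C0_imp_section[OF x]]])
  then have "bdd_above ((\<lambda>z. nrm (E z) (x z)) ` K)"
    by (simp add: compact_imp_bounded bounded_imp_bdd_above)
  then obtain B where "\<And>z. z \<in> K \<Longrightarrow> nrm (E z) (x z) \<le> B" by (auto simp: bdd_above_def)
  then show ?thesis
    using K(2) by (intro bdd_aboveI2[where M = "max B 1"]) (force simp: le_max_iff_disj)
qed

lemma C0_seminormed: "seminormed (C0_sections Z E \<Gamma>)"
proof -
  let ?X = "C0_sections Z E \<Gamma>"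
  have "seminormed \<lparr>carrier = carrier ?X, nrm = (\<lambda>x. sup_over (topspace Z) (\<lambda>z. nrm (E z) (x z)))\<rparr>"
  proof (rule seminormed_sup_over[OF C0_subspace])
    fix z x y and c :: complex
    assume z: "z \<in> topspace Z" and x: "x \<in> carrier ?X"
    note xz = section_in_fibre[OF C0_imp_section[OF x] z]
    show "0 \<le> nrm (E z) (x z)" by (rule nrm_nonneg[OF fibre_seminormed[OF z] xz])
    show "nrm (E z) ((c *\<^sub>C x) z) = cmod c * nrm (E z) (x z)"
      using nrm_scale[OF fibre_seminormed[OF z] xz] by (simp add: scaleC_fun_def)
    show "nrm (E z) ((x + y) z) \<le> nrm (E z) (x z) + nrm (E z) (y z)" if "y \<in> carrier ?X"
      using nrm_triangle[OF fibre_seminormed[OF z] xz section_in_fibre[OF C0_imp_section[OF that] z]]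
      by simp
  qed (rule C0_bounded)
  then show ?thesis by (simp add: C0_sections_def)
qed

lemma C0_pointwise_le:
  "x \<in> carrier (C0_sections Z E \<Gamma>) \<Longrightarrow> z \<in> topspace Z \<Longrightarrow> nrm (E z) (x z) \<le> nrm (C0_sections Z E \<Gamma>) x"
  using sup_over_upper[OF C0_bounded] by (simp add: C0_sections_def)

definition evaluate :: "'z \<Rightarrow> ('b \<Rightarrow> complex) \<Rightarrow> ('z \<Rightarrow> 'b) \<Rightarrow> complex" where
  "evaluate z \<tau> = (\<lambda>x. if x \<in> carrier (C0_sections Z E \<Gamma>) then \<tau> (x z) else 0)"

lemma evaluate_in_dual_ball:
  assumes z: "z \<in> topspace Z" and \<tau>: "\<tau> \<in> dual_ball (E z)"
  shows "evaluate z \<tau> \<in> dual_ball (C0_sections Z E \<Gamma>)"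
  unfolding dual_ball_def linear_between_def mem_Collect_eq
proof (intro conjI ballI allI impI)
  fix x c assume x: "x \<in> carrier (C0_sections Z E \<Gamma>)"
  note xz = section_in_fibre[OF C0_imp_section[OF x] z]
  show "evaluate z \<tau> x \<in> UNIV" by simp
  show "evaluate z \<tau> (x + y) = evaluate z \<tau> x + evaluate z \<tau> y"
    if y: "y \<in> carrier (C0_sections Z E \<Gamma>)" for y
    using x y dual_ball_add[OF \<tau> xz section_in_fibre[OF C0_imp_section[OF y] z]]
      carrier_closed(2)[OF C0_seminormed x y]
    by (simp add: evaluate_def)
  show "evaluate z \<tau> (c *\<^sub>C x) = c *\<^sub>C evaluate z \<tau> x"
    using x dual_ball_scale[OF \<tau> xz] carrier_closed(5)[OF C0_seminormed x]
    by (simp add: evaluate_def scaleC_fun_def scaleC_complex_def)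
  show "cmod (evaluate z \<tau> x) \<le> nrm (C0_sections Z E \<Gamma>) x"
    using dual_ball_bound[OF \<tau> xz] C0_pointwise_le[OF x z] x by (simp add: evaluate_def)
qed (simp add: evaluate_def)

definition point_functionals :: "(('z \<Rightarrow> 'b) \<Rightarrow> complex) set" where
  "point_functionals = insert (\<lambda>_. 0) {evaluate z \<tau> | z \<tau>. z \<in> topspace Z \<and> \<tau> \<in> dual_ball (E z)}"

lemma norming_point_functionals: "norming (C0_sections Z E \<Gamma>) point_functionals"
  unfolding norming_def
proof (intro conjI ballI allI impI)
  let ?X = "C0_sections Z E \<Gamma>"
  show "point_functionals \<subseteq> dual_ball ?X"
    using zero_in_dual_ball[OF C0_seminormed] evaluate_in_dual_ball by (auto simp: point_functionals_def)
  fix x and \<eta> :: real assume x: "x \<in> carrier ?X" and \<eta>: "0 < \<eta>"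
  show "\<exists>\<tau>\<in>point_functionals. nrm ?X x \<le> cmod (\<tau> x) + \<eta>"
  proof (cases "nrm ?X x \<le> \<eta>")
    case True
    then show ?thesis by (intro bexI[of _ "\<lambda>_. 0"]) (auto simp: point_functionals_def)
  next
    case False
    have "\<exists>z\<in>topspace Z. nrm ?X x - \<eta> < nrm (E z) (x z)"
    proof (rule ccontr)
      assume "\<not> ?thesis"
      then have "sup_over (topspace Z) (\<lambda>z. nrm (E z) (x z)) \<le> nrm ?X x - \<eta>"
        using False by (intro sup_over_least) auto
      then show False using \<eta> by (simp add: C0_sections_def)
    qed
    then obtain z where z: "z \<in> topspace Z" "nrm ?X x - \<eta> < nrm (E z) (x z)" by blast
    obtain \<tau> where \<tau>: "\<tau> \<in> dual_ball (E z)" "cmod (\<tau> (x z)) = nrm (E z) (x z)"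
      using dual_ball_norming[OF fibre_seminormed[OF z(1)] section_in_fibre[OF C0_imp_section[OF x] z(1)]] .
    show ?thesis
    proof (rule bexI)
      show "evaluate z \<tau> \<in> point_functionals" using z(1) \<tau>(1) by (auto simp: point_functionals_def)
      show "nrm ?X x \<le> cmod (evaluate z \<tau> x) + \<eta>" using x z(2) \<tau>(2) by (simp add: evaluate_def)
    qed
  qed
qed

text \<open>
  Near a point \<open>z\<close> the field \<open>f x\<close> is uniformly close to the section \<open>f(z) x\<close>, since \<open>x\<close> has
  continuous and hence locally bounded norm.
\<close>

lemma scaled_section:
  assumes f: "continuous_map Z euclideanreal f" and x: "x \<in> \<Gamma>"
  shows "(\<lambda>z. complex_of_real (f z) *\<^sub>C x z) \<in> \<Gamma>"
proof -
  let ?y = "\<lambda>z. complex_of_real (f z) *\<^sub>C x z"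
  have vf: "?y \<in> vector_fields Z E"
    unfolding vector_fields_def
    using carrier_closed(5)[OF fibre_seminormed section_in_fibre[OF x]] section_outside[OF x] by auto
  have "\<exists>y\<in>\<Gamma>. \<exists>U. openin Z U \<and> z \<in> U \<and> (\<forall>w\<in>U. nrm (E w) (?y w - y w) \<le> e)"
    if z: "z \<in> topspace Z" and e: "0 < e" for z and e :: real
  proof -
    define g where "g w = \<bar>f w - f z\<bar> * nrm (E w) (x w)" for w
    define U where "U = {w \<in> topspace Z. g w \<in> {..<e}}"
    have "continuous_map Z euclideanreal g"
      unfolding g_def using f section_norm_continuous[OF x] by (intro continuous_intros) auto
    then have "openin Z U" unfolding U_def by (rule openin_continuous_map_preimage) simp
    moreover have "z \<in> U" using z e by (simp add: U_def g_def)
    moreover have "nrm (E w) (?y w - (complex_of_real (f z) *\<^sub>C x) w) \<le> e" if w: "w \<in> U" for w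
    proof -
      have w': "w \<in> topspace Z" using w by (simp add: U_def)
      have "?y w - (complex_of_real (f z) *\<^sub>C x) w = complex_of_real (f w - f z) *\<^sub>C x w"
        by (simp add: scaleC_fun_def complex_vector.scale_left_diff_distrib)
      then have "nrm (E w) (?y w - (complex_of_real (f z) *\<^sub>C x) w) = g w"
        using nrm_scale[OF fibre_seminormed[OF w'] section_in_fibre[OF x w'], of "complex_of_real (f w - f z)"]
        by (simp add: g_def del: of_real_diff)
      then show ?thesis using w by (simp add: U_def)
    qed
    ultimately show ?thesis using complex_vector.subspace_scale[OF sections_subspace x] by blast
  qed
  with vf show ?thesis by (rule locally_approximable_is_section)
qed

text \<open>
  A section close to \<open>v\<close> at \<open>z\<close> is cut off to compact support by an Urysohn function.
\<close>

lemma C0_dense_in_fibre: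
  assumes Z: "locally_compact_space Z" "Hausdorff_space Z"
    and z: "z \<in> topspace Z" and v: "v \<in> carrier (E z)" and \<delta>: "0 < \<delta>"
  shows "\<exists>x\<in>carrier (C0_sections Z E \<Gamma>). nrm (E z) (x z - v) < \<delta>"
proof -
  obtain x where x: "x \<in> \<Gamma>" "nrm (E z) (x z - v) < \<delta>"
    using sections_dense[OF z v \<delta>] by blast
  obtain U K where UK: "openin Z U" "compactin Z K" "z \<in> U" "U \<subseteq> K"
    using Z(1) z unfolding locally_compact_space_def by blast
  have Z_regular: "completely_regular_space Z"
    using Z by (intro locally_compact_regular_imp_completely_regular_space
        locally_compact_Hausdorff_imp_regular_space) auto
  have "closedin Z (topspace Z - U)" "z \<in> topspace Z - (topspace Z - U)"
    using UK(1,3) z by auto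
  then obtain f :: "'z \<Rightarrow> real" where f: "continuous_map Z (top_of_set {0..1}) f"
      "f z = 0" "f ` (topspace Z - U) \<subseteq> {1}"
    using Z_regular[unfolded completely_regular_space_def, rule_format, OF conjI] by metis
  define g where "g w = 1 - f w" for w
  define y where "y = (\<lambda>w. complex_of_real (g w) *\<^sub>C x w)"
  have "continuous_map Z euclideanreal f" using f(1) by (simp add: continuous_map_in_subtopology)
  then have "continuous_map Z euclideanreal g" unfolding g_def by (intro continuous_intros) auto
  then have y: "y \<in> \<Gamma>" unfolding y_def by (rule scaled_section[OF _ x(1)])
  have "nrm (E w) (y w) = 0" if w: "w \<in> topspace Z - K" for w
  proof -
    have "f w \<in> {1}" by (rule subsetD[OF f(3)]) (use w UK(4) in blast)
    then show ?thesis using nrm_zero[OF fibre_seminormed] w by (simp add: y_def g_def)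
  qed
  then have "y \<in> carrier (C0_sections Z E \<Gamma>)" using y UK(2) by (auto simp: C0_sections_def)
  moreover have "y z = x z" using f(2) by (simp add: y_def g_def scaleC_one)
  ultimately show ?thesis using x(2) by metis
qed

text \<open>
  For fixed coefficients the norm is a continuous function of the point; the Lipschitz dependence on the
  coefficients reduces the uniform statement to a finite net of the coefficient ball.
\<close>

lemma local_upper_semicontinuity:
  fixes y :: "'i \<Rightarrow> 'z \<Rightarrow> 'b"
  assumes I: "finite I" and y: "\<And>i. i \<in> I \<Longrightarrow> y i \<in> \<Gamma>"
    and M: "0 \<le> M" "\<And>i z. i \<in> I \<Longrightarrow> z \<in> topspace Z \<Longrightarrow> nrm (E z) (y i z) \<le> M"
    and z0: "z0 \<in> topspace Z" and \<delta>: "0 < \<delta>"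
  obtains U where "openin Z U" "z0 \<in> U" "\<And>w c. w \<in> U \<Longrightarrow>
    nrm (E w) (\<Sum>i\<in>I. c i *\<^sub>C y i w) \<le> nrm (E z0) (\<Sum>i\<in>I. c i *\<^sub>C y i z0) + \<delta> * (\<Sum>i\<in>I. cmod (c i))"
proof -
  define Y where "Y c w = nrm (E w) (\<Sum>i\<in>I. c i *\<^sub>C y i w)" for c w
  define L where "L c = (\<Sum>i\<in>I. cmod (c i))" for c
  have yw: "y i w \<in> carrier (E w)" if "i \<in> I" "w \<in> topspace Z" for i w
    using section_in_fibre[OF y[OF that(1)] that(2)] .
  have Y_cont: "continuous_map Z euclideanreal (Y c)" for c
    using section_norm_continuous[OF sum_sections[of I y c, OF y]] I
    unfolding Y_def by (simp add: sum_scaleC_apply)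
  have Y_scale: "Y (\<lambda>i. k * c i) w = cmod k * Y c w" if "w \<in> topspace Z" for k c w
  proof -
    have "(\<Sum>i\<in>I. (k * c i) *\<^sub>C y i w) = k *\<^sub>C (\<Sum>i\<in>I. c i *\<^sub>C y i w)"
      by (simp add: complex_vector.scale_sum_right)
    then show ?thesis
      unfolding Y_def
      by (simp add: nrm_scale[OF fibre_seminormed[OF that] carrier_sum[OF fibre_seminormed[OF that] yw[OF _ that]]])
  qed
  have Y_lip: "Y c w \<le> Y d w + (\<Sum>i\<in>I. cmod (c i - d i)) * M" if w: "w \<in> topspace Z" for c d w
  proof -
    note sn = fibre_seminormed[OF w]
    have "(\<Sum>i\<in>I. c i *\<^sub>C y i w) = (\<Sum>i\<in>I. d i *\<^sub>C y i w) + (\<Sum>i\<in>I. (c i - d i) *\<^sub>C y i w)"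
      by (simp add: complex_vector.scale_left_diff_distrib sum_subtractf)
    then have "Y c w \<le> Y d w + nrm (E w) (\<Sum>i\<in>I. (c i - d i) *\<^sub>C y i w)"
      unfolding Y_def using yw[OF _ w] by (simp add: nrm_triangle[OF sn] carrier_sum[OF sn])
    also have "nrm (E w) (\<Sum>i\<in>I. (c i - d i) *\<^sub>C y i w) \<le> (\<Sum>i\<in>I. cmod (c i - d i) * nrm (E w) (y i w))"
      using yw[OF _ w] by (rule nrm_sum_le[OF sn I])
    also have "\<dots> \<le> (\<Sum>i\<in>I. cmod (c i - d i) * M)"
      using M(2)[OF _ w] by (intro sum_mono mult_left_mono) auto
    finally show ?thesis by (simp add: sum_distrib_right)
  qed
  define \<eta> where "\<eta> = \<delta> / (4 * (real (card I) + 1) * (M + 1))"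
  have \<eta>: "0 < \<eta>" using \<delta> M(1) by (simp add: \<eta>_def)
  have "\<eta> * (4 * (real (card I) + 1) * (M + 1)) = \<delta>" using M(1) by (simp add: \<eta>_def)
  moreover have "\<eta> * (4 * (real (card I) * M)) \<le> \<eta> * (4 * (real (card I) + 1) * (M + 1))"
    using \<eta> M(1) by (intro mult_left_mono) (auto simp: algebra_simps)
  ultimately have \<eta>': "real (card I) * \<eta> * M \<le> \<delta> / 4" by (simp add: algebra_simps)
  obtain G where G: "finite G" "\<And>k. cmod k \<le> 1 \<Longrightarrow> \<exists>g\<in>G. cmod (k - g) \<le> \<eta>"
    using disc_net[OF \<eta>, of 1] by blast
  define P where "P = PiE I (\<lambda>_. G)"
  have P: "finite P" unfolding P_def using I G(1) by (intro finite_PiE)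
  define V where "V c = {w \<in> topspace Z. Y c w \<in> {..<Y c z0 + \<delta> / 2}}" for c
  define U where "U = (\<Inter>c\<in>P. V c) \<inter> topspace Z"
  have V: "openin Z (V c)" for c
    unfolding V_def by (rule openin_continuous_map_preimage[OF Y_cont]) simp
  have unit: "Y c w \<le> Y c z0 + \<delta>" if w: "w \<in> U" and c: "L c = 1" for c w
  proof -
    have w': "w \<in> topspace Z" using w by (simp add: U_def)
    have "cmod (c i) \<le> 1" if "i \<in> I" for i
      using member_le_sum[OF that, of "\<lambda>i. cmod (c i)"] I c by (simp add: L_def)
    then have "\<exists>g. g \<in> G \<and> cmod (c i - g) \<le> \<eta>" if "i \<in> I" for i using G(2) that by blast
    then obtain g where g: "\<And>i. i \<in> I \<Longrightarrow> g i \<in> G \<and> cmod (c i - g i) \<le> \<eta>" by metis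
    define d where "d = restrict g I"
    have "d \<in> P" using g by (auto simp: d_def P_def)
    then have "Y d w < Y d z0 + \<delta> / 2" using w by (auto simp: U_def V_def)
    moreover have "(\<Sum>i\<in>I. cmod (c i - d i)) * M \<le> \<delta> / 4"
    proof -
      have "(\<Sum>i\<in>I. cmod (c i - d i)) \<le> (\<Sum>i\<in>I. \<eta>)" using g by (intro sum_mono) (simp add: d_def)
      then have "(\<Sum>i\<in>I. cmod (c i - d i)) * M \<le> (real (card I) * \<eta>) * M"
        using M(1) by (intro mult_right_mono) simp
      then show ?thesis using \<eta>' by simp
    qed
    moreover have "(\<Sum>i\<in>I. cmod (d i - c i)) = (\<Sum>i\<in>I. cmod (c i - d i))"
      by (simp add: norm_minus_commute)
    ultimately show ?thesis using Y_lip[OF w', of c d] Y_lip[OF z0, of d c] by simp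
  qed
  show ?thesis
  proof (rule that)
    show "openin Z U" unfolding U_def using P V by (rule openin_INT)
    show "z0 \<in> U" using z0 \<delta> by (simp add: U_def V_def)
    fix w c assume w: "w \<in> U"
    then have w': "w \<in> topspace Z" by (simp add: U_def)
    have L0: "0 \<le> L c" by (simp add: L_def sum_nonneg)
    have "Y c w \<le> Y c z0 + \<delta> * L c"
    proof (cases "L c = 0")
      case True
      then have "c i = 0" if "i \<in> I" for i
        using that I by (simp add: L_def sum_nonneg_eq_0_iff)
      then have "Y c w = 0" "Y c z0 = 0"
        using nrm_zero[OF fibre_seminormed] w' z0 by (simp_all add: Y_def)
      then show ?thesis using True by simp
    next
      case False
      define k where "k = complex_of_real (inverse (L c))"
      have k: "cmod k = inverse (L c)" using L0 by (simp add: k_def norm_inverse)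
      have "L (\<lambda>i. k * c i) = cmod k * L c" by (simp add: L_def norm_mult sum_distrib_left)
      then have "Y (\<lambda>i. k * c i) w \<le> Y (\<lambda>i. k * c i) z0 + \<delta>" using False k by (intro unit[OF w]) simp
      then have "inverse (L c) * Y c w \<le> inverse (L c) * Y c z0 + \<delta>" by (simp add: Y_scale w' z0 k)
      then have "L c * (inverse (L c) * Y c w) \<le> L c * (inverse (L c) * Y c z0 + \<delta>)"
        using L0 by (rule mult_left_mono)
      moreover have "L c * (inverse (L c) * a) = a" for a using False by (simp flip: mult.assoc)
      ultimately show ?thesis by (simp only: distrib_left mult.commute[of "L c" \<delta>])
    qed
    then show "nrm (E w) (\<Sum>i\<in>I. c i *\<^sub>C y i w)
        \<le> nrm (E z0) (\<Sum>i\<in>I. c i *\<^sub>C y i z0) + \<delta> * (\<Sum>i\<in>I. cmod (c i))"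
      by (simp add: Y_def L_def)
  qed
qed

section \<open>Comparison of the section space with its fibres\<close>

context
  fixes \<alpha> :: "('z \<Rightarrow> 'b) \<Rightarrow> ('z \<Rightarrow> 'b)" and \<beta> :: "'z \<Rightarrow> 'b \<Rightarrow> 'b"
  assumes \<alpha>: "isometric_automorphism (C0_sections Z E \<Gamma>) \<alpha>"
    and \<beta>: "\<And>z. z \<in> topspace Z \<Longrightarrow> isometric_automorphism (E z) (\<beta> z)"
    and \<alpha>\<beta>: "\<And>x z. x \<in> carrier (C0_sections Z E \<Gamma>) \<Longrightarrow> z \<in> topspace Z \<Longrightarrow> \<alpha> x z = \<beta> z (x z)"
begin

lemma iterate_pointwise:
  assumes "x \<in> carrier (C0_sections Z E \<Gamma>)" "z \<in> topspace Z"
  shows "(\<alpha> ^^ i) x z = (\<beta> z ^^ i) (x z)"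
  by (induction i) (use assms \<alpha>\<beta> isometric_automorphism_iterate(1)[OF \<alpha>] in auto)

text \<open>
  Functionals on a fibre induce functionals on sections by evaluation, and every vector of the fibre
  is almost a value of a section; the error stays constant along orbits as \<open>\<beta> z\<close> is isometric.
\<close>

lemma hc_fibre_eq_0:
  assumes Z: "locally_compact_space Z" "Hausdorff_space Z"
    and hc: "hc (C0_sections Z E \<Gamma>) \<alpha> = 0" and z: "z \<in> topspace Z"
  shows "hc (E z) (\<beta> z) = 0"
proof (rule hc_eq_0_of_norming[OF fibre_seminormed[OF z] \<beta>[OF z] norming_dual_ball[OF fibre_seminormed[OF z]]])
  fix v assume v: "v \<in> carrier (E z)"
  show "zero_entropy (orbits (dual_ball (E z)) (\<beta> z) v)"
  proof (rule zero_entropy_transfer)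
    fix \<delta> :: real assume \<delta>: "0 < \<delta>"
    obtain x where x: "x \<in> carrier (C0_sections Z E \<Gamma>)" "nrm (E z) (x z - v) < \<delta>"
      using C0_dense_in_fibre[OF Z z v \<delta>] by blast
    note xz = section_in_fibre[OF C0_imp_section[OF x(1)] z]
    note it = isometric_automorphism_iterate[OF \<beta>[OF z]]
    have diff: "nrm (E z) ((\<beta> z ^^ i) v - (\<beta> z ^^ i) (x z)) = nrm (E z) (v - x z)" for i
    proof (induction i)
      case (Suc i)
      let ?a = "(\<beta> z ^^ i) v" and ?b = "(\<beta> z ^^ i) (x z)"
      have ab: "?a \<in> carrier (E z)" "?b \<in> carrier (E z)" using it(1) v xz by auto
      have d: "?a - ?b \<in> carrier (E z)" using ab by (rule carrier_closed(3)[OF fibre_seminormed[OF z]])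
      have "\<beta> z ((?a - ?b) + ?b) = \<beta> z (?a - ?b) + \<beta> z ?b"
        using \<beta>[OF z] d ab(2) unfolding isometric_automorphism_def linear_between_def by blast
      then have "\<beta> z ?a - \<beta> z ?b = \<beta> z (?a - ?b)" by simp
      then show ?case using Suc d \<beta>[OF z] by (simp add: isometric_automorphism_def)
    qed simp
    have "\<exists>s\<in>orbits (dual_ball (C0_sections Z E \<Gamma>)) \<alpha> x. \<forall>i. cmod (t i - s i) \<le> \<delta>"
      if t: "t \<in> orbits (dual_ball (E z)) (\<beta> z) v" for t
    proof -
      obtain \<tau> where \<tau>: "\<tau> \<in> dual_ball (E z)" "t = (\<lambda>i. \<tau> ((\<beta> z ^^ i) v))"
        using t by (auto simp: orbits_def)
      define s where "s = (\<lambda>i. evaluate z \<tau> ((\<alpha> ^^ i) x))"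
      have "cmod (t i - s i) \<le> \<delta>" for i
      proof -
        have "s i = \<tau> ((\<beta> z ^^ i) (x z))"
          using isometric_automorphism_iterate(1)[OF \<alpha> x(1)] iterate_pointwise[OF x(1) z]
          by (simp add: s_def evaluate_def)
        then have "t i - s i = \<tau> ((\<beta> z ^^ i) v - (\<beta> z ^^ i) (x z))"
          using dual_ball_diff[OF fibre_seminormed[OF z] \<tau>(1)] it(1) v xz by (simp add: \<tau>(2))
        also have "cmod \<dots> \<le> nrm (E z) ((\<beta> z ^^ i) v - (\<beta> z ^^ i) (x z))"
          using it(1) v xz by (intro dual_ball_bound[OF \<tau>(1)] carrier_closed(3)[OF fibre_seminormed[OF z]])
        also have "\<dots> = nrm (E z) (x z - v)"
          using nrm_minus[OF fibre_seminormed[OF z], of "x z - v"] v xz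
          by (simp add: diff carrier_closed(3)[OF fibre_seminormed[OF z]])
        finally show ?thesis using x(2) by simp
      qed
      moreover have "s \<in> orbits (dual_ball (C0_sections Z E \<Gamma>)) \<alpha> x"
        unfolding orbits_def s_def by (intro imageI evaluate_in_dual_ball[OF z \<tau>(1)])
      ultimately show ?thesis by blast
    qed
    then show "\<exists>S. zero_entropy S \<and>
        (\<forall>t\<in>orbits (dual_ball (E z)) (\<beta> z) v. \<exists>s\<in>S. \<forall>i. cmod (t i - s i) \<le> \<delta>)"
      using zero_entropy_of_hc_eq_0[OF C0_seminormed \<alpha> hc x(1)] by blast
  qed
qed

lemma fibre_orbits_shift:
  assumes x: "x \<in> carrier (C0_sections Z E \<Gamma>)" and A: "A \<subseteq> topspace Z"
    and t: "t \<in> fibre_orbits E \<beta> A x"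
  shows "(\<lambda>i. t (Suc i)) \<in> fibre_orbits E \<beta> A x"
  using t A orbits_dual_ball_shift[OF fibre_seminormed \<beta> section_in_fibre[OF C0_imp_section[OF x]]]
  unfolding fibre_orbits_def by blast

text \<open>
  One good scale \<open>n\<close> at the point \<open>z0\<close> extends to a neighbourhood: by upper semicontinuity of
  the norms on the span of the first \<open>n\<close> iterates, Helly's criterion approximates functionals of nearby
  fibres by functionals of the fibre at \<open>z0\<close>. As the maps act fibrewise, the orbit sequences of
  the neighbourhood form a shift invariant set, so a single scale suffices.
\<close>

lemma fibre_orbits_locally_covered:
  assumes hc: "hc (E z0) (\<beta> z0) = 0" and z0: "z0 \<in> topspace Z"
    and x: "x \<in> carrier (C0_sections Z E \<Gamma>)" and pos: "0 < \<delta>" "0 < \<epsilon>"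
  obtains U A where "openin Z U" "z0 \<in> U" "0 \<le> A"
    "\<And>m. covered (fibre_orbits E \<beta> U x) m \<delta> (A * exp (\<epsilon> * real m))"
proof -
  note it = isometric_automorphism_iterate[OF \<alpha> x]
  have "zero_entropy (orbits (dual_ball (E z0)) (\<beta> z0) (x z0))"
    by (rule zero_entropy_of_hc_eq_0[OF fibre_seminormed[OF z0] \<beta>[OF z0] hc
          section_in_fibre[OF C0_imp_section[OF x] z0]])
  then obtain B where B: "\<forall>\<^sub>F n in sequentially.
      covered (orbits (dual_ball (E z0)) (\<beta> z0) (x z0)) n (\<delta> / 2) (B * exp (\<epsilon> / 2 * real n))"
    using zero_entropyD[of _ "\<delta> / 2" "\<epsilon> / 2"] pos by (metis half_gt_zero)
  have "\<forall>\<^sub>F n in sequentially. B \<le> exp (\<epsilon> / 2 * real n)"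
    using pos by (intro eventually_le_exp) simp
  then have "\<forall>\<^sub>F n in sequentially. 0 < n \<and>
      covered (orbits (dual_ball (E z0)) (\<beta> z0) (x z0)) n (\<delta> / 2) (exp (\<epsilon> * real n))"
    using B eventually_gt_at_top[of 0]
  proof eventually_elim
    case (elim n)
    have "B * exp (\<epsilon> / 2 * real n) \<le> exp (\<epsilon> / 2 * real n) * exp (\<epsilon> / 2 * real n)"
      using elim(1) by (intro mult_right_mono) auto
    also have "\<dots> = exp (\<epsilon> * real n)" by (simp add: algebra_simps flip: exp_add)
    finally show ?case using covered_mono[OF elim(2)] elim(3) by blast
  qed
  then obtain n where n: "0 < n"
    and cov: "covered (orbits (dual_ball (E z0)) (\<beta> z0) (x z0)) n (\<delta> / 2) (exp (\<epsilon> * real n))"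
    using eventually_happens'[OF sequentially_bot] by blast
  obtain C where C: "finite C" "real (card C) \<le> exp (\<epsilon> * real n)"
    "\<forall>t\<in>orbits (dual_ball (E z0)) (\<beta> z0) (x z0). \<exists>c\<in>C. \<forall>i<n. cmod (t i - c i) \<le> \<delta> / 2"
    using cov unfolding covered_def by blast
  obtain U where U: "openin Z U" "z0 \<in> U" "\<And>w c. w \<in> U \<Longrightarrow>
    nrm (E w) (\<Sum>i<n. c i *\<^sub>C (\<alpha> ^^ i) x w)
      \<le> nrm (E z0) (\<Sum>i<n. c i *\<^sub>C (\<alpha> ^^ i) x z0) + \<delta> / 2 * (\<Sum>i<n. cmod (c i))"
  proof (rule local_upper_semicontinuity[of "{..<n}" "\<lambda>i. (\<alpha> ^^ i) x" "nrm (C0_sections Z E \<Gamma>) x" z0 "\<delta> / 2"])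
    show "nrm (E z) ((\<alpha> ^^ i) x z) \<le> nrm (C0_sections Z E \<Gamma>) x" if "z \<in> topspace Z" for i z
      using C0_pointwise_le[OF it(1) that] by (simp add: it(2))
  qed (use it(1) C0_imp_section z0 pos nrm_nonneg[OF C0_seminormed x] in auto)
  have UZ: "U \<subseteq> topspace Z" using U(1) by (rule openin_subset)
  have "covered (fibre_orbits E \<beta> U x) n \<delta> (exp (\<epsilon> * real n))"
  proof -
    have "\<exists>c\<in>C. \<forall>i<n. cmod (t i - c i) \<le> \<delta>" if t: "t \<in> fibre_orbits E \<beta> U x" for t
    proof -
      obtain w \<tau> where w: "w \<in> U" "\<tau> \<in> dual_ball (E w)" "t = (\<lambda>i. \<tau> ((\<beta> w ^^ i) (x w)))"
        using t by (auto simp: fibre_orbits_def orbits_def)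
      have w': "w \<in> topspace Z" using w(1) UZ by blast
      have yw: "(\<alpha> ^^ i) x w' \<in> carrier (E w')" if "w' \<in> topspace Z" for i w'
        using section_in_fibre[OF C0_imp_section[OF it(1)] that] .
      have t_eq: "t i = \<tau> ((\<alpha> ^^ i) x w)" for i by (simp add: w(3) iterate_pointwise[OF x w'])
      have dom: "cmod (\<Sum>i<n. c i * t i)
          \<le> nrm (E z0) (\<Sum>i<n. c i *\<^sub>C (\<alpha> ^^ i) x z0) + \<delta> / 2 * (\<Sum>i<n. cmod (c i))" for c
      proof -
        have "(\<Sum>i<n. c i * t i) = \<tau> (\<Sum>i<n. c i *\<^sub>C (\<alpha> ^^ i) x w)"
          unfolding t_eq
          by (rule dual_ball_sum[OF fibre_seminormed[OF w'] w(2), symmetric]) (use yw[OF w'] in auto)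
        also have "cmod \<dots> \<le> nrm (E w) (\<Sum>i<n. c i *\<^sub>C (\<alpha> ^^ i) x w)"
          by (intro dual_ball_bound[OF w(2)] carrier_sum[OF fibre_seminormed[OF w']] yw[OF w'])
        also note U(3)[OF w(1)]
        finally show ?thesis .
      qed
      obtain \<rho> where \<rho>: "\<rho> \<in> dual_ball (E z0)"
        "\<And>i. i \<in> {..<n} \<Longrightarrow> cmod (\<rho> ((\<alpha> ^^ i) x z0) - t i) \<le> \<delta> / 2"
        by (rule helly_functional[OF fibre_seminormed[OF z0], of "{..<n}" "\<lambda>i. (\<alpha> ^^ i) x z0" "\<delta> / 2" t])
          (use yw[OF z0] pos dom in auto)
      have "(\<lambda>i. \<rho> ((\<beta> z0 ^^ i) (x z0))) \<in> orbits (dual_ball (E z0)) (\<beta> z0) (x z0)"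
        using \<rho>(1) by (auto simp: orbits_def)
      from bspec[OF C(3) this]
      obtain c where c: "c \<in> C" "\<forall>i<n. cmod (\<rho> ((\<beta> z0 ^^ i) (x z0)) - c i) \<le> \<delta> / 2" ..
      have "cmod (t i - c i) \<le> \<delta>" if "i < n" for i
      proof -
        have "cmod (\<rho> ((\<alpha> ^^ i) x z0) - t i) \<le> \<delta> / 2" using \<rho>(2) that by simp
        moreover have "cmod (\<rho> ((\<alpha> ^^ i) x z0) - c i) \<le> \<delta> / 2"
          using c(2) that by (simp add: iterate_pointwise[OF x z0])
        ultimately show ?thesis
          using norm_triangle_ineq4[of "\<rho> ((\<alpha> ^^ i) x z0) - c i" "\<rho> ((\<alpha> ^^ i) x z0) - t i"] by simp
      qed
      then show ?thesis using c(1) by (intro bexI[of _ c]) auto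
    qed
    then show ?thesis unfolding covered_def by (intro exI[of _ C] conjI ballI C(1,2))
  qed
  then have "covered (fibre_orbits E \<beta> U x) m \<delta> (exp (\<epsilon> * real n) * exp (\<epsilon> * real m))" for m
    using fibre_orbits_shift[OF x UZ] n pos by (intro covered_of_single_scale) auto
  then show ?thesis by (rule that[OF U(1,2) exp_ge_zero])
qed

text \<open>
  Off a compact set the section is small, so \<open>0\<close> approximates all orbit sequences there; the compact
  set is covered by finitely many of the neighbourhoods on which the growth rate is controlled.
\<close>

lemma hc_sections_eq_0:
  assumes hc: "\<And>z. z \<in> topspace Z \<Longrightarrow> hc (E z) (\<beta> z) = 0"
  shows "hc (C0_sections Z E \<Gamma>) \<alpha> = 0"
proof (rule hc_eq_0_of_norming[OF C0_seminormed \<alpha> norming_point_functionals])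
  fix x assume x: "x \<in> carrier (C0_sections Z E \<Gamma>)"
  note it = isometric_automorphism_iterate[OF \<alpha> x]
  show "zero_entropy (orbits point_functionals \<alpha> x)"
    unfolding zero_entropy_def
  proof (intro allI impI)
    fix \<delta> \<epsilon> :: real assume pos: "0 < \<delta>" "0 < \<epsilon>"
    obtain K where K: "compactin Z K" "\<And>z. z \<in> topspace Z - K \<Longrightarrow> nrm (E z) (x z) < \<delta>"
      using C0_vanishing[OF x pos(1)] by blast
    have KZ: "K \<subseteq> topspace Z" using K(1) by (rule compactin_subset_topspace)
    have "\<exists>U A. openin Z U \<and> z \<in> U \<and> 0 \<le> A \<and>
        (\<forall>m. covered (fibre_orbits E \<beta> U x) m \<delta> (A * exp (\<epsilon> * real m)))" if "z \<in> topspace Z" for z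
      using fibre_orbits_locally_covered[OF hc[OF that] that x pos] by metis
    then obtain U A where U: "\<And>z. z \<in> topspace Z \<Longrightarrow> openin Z (U z)" "\<And>z. z \<in> topspace Z \<Longrightarrow> z \<in> U z"
      "\<And>z m. z \<in> topspace Z \<Longrightarrow> covered (fibre_orbits E \<beta> (U z) x) m \<delta> (A z * exp (\<epsilon> * real m))"
      by metis
    have "\<exists>\<F>. finite \<F> \<and> \<F> \<subseteq> U ` K \<and> K \<subseteq> \<Union>\<F>"
    proof (rule compactinD[OF K(1)])
      show "openin Z V" if "V \<in> U ` K" for V using that U(1) KZ by blast
      show "K \<subseteq> \<Union>(U ` K)" using U(2) KZ by blast
    qed
    then obtain J where J: "finite J" "J \<subseteq> K" "K \<subseteq> (\<Union>z\<in>J. U z)"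
      by (metis finite_subset_image)
    have J_cov: "covered (fibre_orbits E \<beta> (\<Union>z\<in>J. U z) x) m \<delta> ((\<Sum>z\<in>J. A z) * exp (\<epsilon> * real m))" for m
      using J(1) J(2)
    proof (induction J rule: finite_induct)
      case empty
      show ?case by (simp add: covered_def fibre_orbits_def exI[of _ "{}"])
    next
      case (insert z J)
      have "fibre_orbits E \<beta> (\<Union>z\<in>insert z J. U z) x = fibre_orbits E \<beta> (U z) x \<union> fibre_orbits E \<beta> (\<Union>z\<in>J. U z) x"
        by (auto simp: fibre_orbits_def)
      moreover have "z \<in> topspace Z" using insert.prems KZ by blast
      ultimately show ?case
        using covered_Un[OF U(3)[of z m] insert.IH] insert by (simp add: distrib_right)
    qed
    have "covered (orbits point_functionals \<alpha> x) m \<delta> (((\<Sum>z\<in>J. A z) + 1) * exp (\<epsilon> * real m))" for m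
    proof -
      define T0 where "T0 = {t :: nat \<Rightarrow> complex. \<forall>i. cmod (t i) \<le> \<delta>}"
      have sub: "orbits point_functionals \<alpha> x \<subseteq> fibre_orbits E \<beta> (\<Union>z\<in>J. U z) x \<union> T0"
      proof
        fix t assume "t \<in> orbits point_functionals \<alpha> x"
        then consider "t = (\<lambda>_. 0)"
          | z \<tau> where "z \<in> topspace Z" "\<tau> \<in> dual_ball (E z)" "t = (\<lambda>i. evaluate z \<tau> ((\<alpha> ^^ i) x))"
          by (auto simp: orbits_def point_functionals_def)
        then show "t \<in> fibre_orbits E \<beta> (\<Union>z\<in>J. U z) x \<union> T0"
        proof cases
          case 1
          then show ?thesis using pos by (simp add: T0_def)
        next
          case (2 z \<tau>)
          then have t: "t = (\<lambda>i. \<tau> ((\<beta> z ^^ i) (x z)))"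
            using it(1) by (simp add: evaluate_def iterate_pointwise[OF x])
          show ?thesis
          proof (cases "z \<in> K")
            case True
            then have "z \<in> (\<Union>z\<in>J. U z)" using J(3) by blast
            then show ?thesis using t 2(2) unfolding fibre_orbits_def orbits_def by blast
          next
            case False
            note xz = section_in_fibre[OF C0_imp_section[OF x] 2(1)]
            have "cmod (t i) \<le> \<delta>" for i
              using dual_ball_bound[OF 2(2) isometric_automorphism_iterate(1)[OF \<beta>[OF 2(1)] xz], of i]
                K(2)[of z] 2(1) False isometric_automorphism_iterate(2)[OF \<beta>[OF 2(1)] xz, of i]
              by (simp add: t)
            then show ?thesis by (simp add: T0_def)
          qed
        qed
      qed
      have "covered T0 m \<delta> (exp (\<epsilon> * real m))"
        unfolding covered_def using pos by (intro exI[of _ "{\<lambda>_. 0}"]) (simp add: T0_def)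
      from covered_Un[OF J_cov this]
      have "covered (fibre_orbits E \<beta> (\<Union>z\<in>J. U z) x \<union> T0) m \<delta> (((\<Sum>z\<in>J. A z) + 1) * exp (\<epsilon> * real m))"
        by (simp add: distrib_right)
      then show ?thesis using sub unfolding covered_def by (meson subsetD)
    qed
    then show "\<exists>A. \<forall>\<^sub>F n in sequentially. covered (orbits point_functionals \<alpha> x) n \<delta> (A * exp (\<epsilon> * real n))"
      by (blast intro: always_eventually)
  qed
qed

end

end

theorem lemma6p3:
  fixes Z :: "'z topology"
    and E :: "'z \<Rightarrow> 'b::complex_vector nspace"
    and \<Gamma> :: "('z \<Rightarrow> 'b) set"
    and \<alpha> :: "('z \<Rightarrow> 'b) \<Rightarrow> ('z \<Rightarrow> 'b)"
    and \<beta> :: "'z \<Rightarrow> 'b \<Rightarrow> 'b"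
  assumes "locally_compact_space Z"
    and "Hausdorff_space Z"
    and "continuous_field Z E \<Gamma>"
    and "isometric_automorphism (C0_sections Z E \<Gamma>) \<alpha>"
    and "\<And>z. z \<in> topspace Z \<Longrightarrow> isometric_automorphism (E z) (\<beta> z)"
    and "\<And>x z. x \<in> carrier (C0_sections Z E \<Gamma>) \<Longrightarrow> z \<in> topspace Z \<Longrightarrow> \<alpha> x z = \<beta> z (x z)"
  shows "hc (C0_sections Z E \<Gamma>) \<alpha> = 0 \<longleftrightarrow> (\<forall>z\<in>topspace Z. hc (E z) (\<beta> z) = 0)"
  using hc_fibre_eq_0[OF assms(3-6,1,2)] hc_sections_eq_0[OF assms(3-6)] by blast

end
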